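(* Let $k$ be an infinite field, $S=k[x_0,\dots,x_n]$ a standard graded polynomial ring, $\mathfrak p\subset S$ a homogeneous prime ideal, and $R=S/\mathfrak p$, of Krull dimension $r$. Let $d$ be a positive integer and let $M_1,\dots,M_N$, $N=\binom{n+d}{d}$, be all the monomials of degree $d$ in $S$; for $\mathbf a=(a_1,\dots,a_N)\in k^N$ put $f_{\mathbf a}=\sum_{i=1}^N a_iM_i\in S$. Then the set (the Noether normalization locus) $$\mathcal N_{n+1}=\{(\mathbf a_0,\dots,\mathbf a_n)\in\mathbb P^{(n+1)N-1}_k:\ \ell_R(f_{\mathbf a_0},\dots,f_{\mathbf a_n})=r\}$$ is a non-empty (Zariski) open subset of $\mathbb P^{(n+1)N-1}_k$.
   Context: A point of $\mathbb P^{(n+1)N-1}_k$ is written as an $(n+1)$-tuple $(\mathbf a_0,\dots,\mathbf a_n)$ of vectors in $k^N$, not all zero, up to simultaneous scaling by $k\setminus\{0\}$. The ideal $(f_{\mathbf a_0},\dots,f_{\mathbf a_n})$ is taken in $R$. Analytic spread: for a standard graded Noetherian $k$-algebra $(A,\mathfrak m)$ with irrelevant maximal ideal $\mathfrak m$ and a graded ideal $I$ of $A$, let $\mathcal R_A(I)=A[It]\subset A[t]$ be the Rees algebra and $\mathcal F(I)=\mathcal R_A(I)/\mathfrak m\mathcal R_A(I)$ the special fiber. The analytic spread $\ell_A(I)$ is the Krull dimension of $\mathcal F(I)$. (If $I=(f_1,\dots,f_s)$ is generated in a single degree, $\mathcal F(I)\simeq k[f_1,\dots,f_s]\subseteq A$.)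 *)

theory Defs
  imports
    "HOL-Algebra.QuotRing"
    "HOL-Algebra.UnivPoly"
    "HOL-Algebra.Generated_Rings"
    "HOL-Library.Poly_Mapping"
    "HOL-Library.Extended_Nat"
begin

section \<open>Multivariate polynomials\<close>

text \<open>
  A monomial in variables indexed by \<open>'i\<close> is represented by its exponent vector of type
  \<open>'i \<Rightarrow>\<^sub>0 nat\<close>, and a polynomial by the finitely supported map from monomials to coefficients;
  the ring operations of \<^theory>\<open>HOL-Library.Poly_Mapping\<close> on this type are the usual
  polynomial operations.
\<close>

type_synonym 'i mon = "'i \<Rightarrow>\<^sub>0 nat"
type_synonym ('i, 'k) mpol = "('i \<Rightarrow>\<^sub>0 nat) \<Rightarrow>\<^sub>0 'k"

definition mon_degree :: "'i mon \<Rightarrow> nat" where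
  "mon_degree m = (\<Sum>i\<in>Poly_Mapping.keys m. Poly_Mapping.lookup m i)"

definition monomials :: "'i set \<Rightarrow> nat \<Rightarrow> 'i mon set" where
  "monomials V d = {m. Poly_Mapping.keys m \<subseteq> V \<and> mon_degree m = d}"

text \<open>The polynomial ring \<open>k[x\<^sub>i : i \<in> V]\<close>, where \<open>k\<close> is the type \<open>'k\<close>.\<close>

definition poly_ring :: "'i set \<Rightarrow> ('i, 'k::field) mpol ring" where
  "poly_ring V =
    \<lparr>carrier = {f. \<forall>m\<in>Poly_Mapping.keys f. Poly_Mapping.keys m \<subseteq> V},
     mult = (*), one = 1, zero = 0, add = (+)\<rparr>"

definition homogeneous :: "('i, 'k::field) mpol \<Rightarrow> bool" where
  "homogeneous f \<longleftrightarrow> (\<exists>e. \<forall>m\<in>Poly_Mapping.keys f. mon_degree m = e)"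

definition homogeneous_ideal :: "'i set \<Rightarrow> ('i, 'k::field) mpol set \<Rightarrow> bool" where
  "homogeneous_ideal V P \<longleftrightarrow>
     (\<exists>F \<subseteq> carrier (poly_ring V). (\<forall>f\<in>F. homogeneous f) \<and> P = genideal (poly_ring V) F)"

definition mpol_eval :: "('i, 'k::field) mpol \<Rightarrow> ('i \<Rightarrow> 'k) \<Rightarrow> 'k" where
  "mpol_eval f v =
     (\<Sum>m\<in>Poly_Mapping.keys f. Poly_Mapping.lookup f m *
        (\<Prod>i\<in>Poly_Mapping.keys m. v i ^ Poly_Mapping.lookup m i))"

section \<open>Krull dimension and analytic spread\<close>

text \<open>
  The supremum of the lengths of chains of prime ideals. The zero ring would get the value \<open>0\<close>;
  below, the dimension is only taken of nonzero rings.
\<close>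

definition krull_dim :: "('a, 'b) ring_scheme \<Rightarrow> enat" where
  "krull_dim R =
     (SUP l \<in> {l. \<exists>C :: nat \<Rightarrow> 'a set.
                   (\<forall>i\<le>l. primeideal (C i) R) \<and> (\<forall>i<l. C i \<subset> C (Suc i))}. enat l)"

text \<open>The subring \<open>A[It]\<close> of \<open>A[t]\<close> generated by \<open>A\<close> and all \<open>f t\<close> with \<open>f \<in> I\<close>.\<close>

definition rees_algebra :: "('a, 'b) ring_scheme \<Rightarrow> 'a set \<Rightarrow> ('a, nat \<Rightarrow> 'a) up_ring" where
  "rees_algebra A I =
     (UP A)\<lparr>carrier := generate_ring (UP A)
        ((\<lambda>a. monom (UP A) a 0) ` carrier A \<union> (\<lambda>f. monom (UP A) f 1) ` I)\<rparr>"

definition special_fiber :: "('a, 'b) ring_scheme \<Rightarrow> 'a set \<Rightarrow> 'a set \<Rightarrow> (nat \<Rightarrow> 'a) set ring" where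
  "special_fiber A \<mm> I =
     rees_algebra A I Quot genideal (rees_algebra A I) ((\<lambda>a. monom (UP A) a 0) ` \<mm>)"

definition analytic_spread :: "('a, 'b) ring_scheme \<Rightarrow> 'a set \<Rightarrow> 'a set \<Rightarrow> enat" where
  "analytic_spread A \<mm> I = krull_dim (special_fiber A \<mm> I)"

section \<open>Standard graded quotients of polynomial rings\<close>

definition residue ::
    "'i set \<Rightarrow> ('i, 'k::field) mpol set \<Rightarrow> ('i, 'k) mpol \<Rightarrow> ('i, 'k) mpol set" where
  "residue V P f = P +>\<^bsub>poly_ring V\<^esub> f"

text \<open>The sum of the graded components of positive degree of \<open>k[x\<^sub>i : i \<in> V] / P\<close>.\<close>

definition irrelevant_ideal ::
    "'i set \<Rightarrow> ('i, 'k::field) mpol set \<Rightarrow> ('i, 'k) mpol set set" where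
  "irrelevant_ideal V P =
     residue V P ` {f \<in> carrier (poly_ring V). Poly_Mapping.lookup f 0 = 0}"

section \<open>Projective space and its Zariski topology\<close>

text \<open>
  Projective space with homogeneous coordinates indexed by \<open>V\<close>. Coordinate vectors are extensional
  functions on \<open>V\<close>, and a point is the class of a nonzero vector under scaling.
\<close>

definition proj_vectors :: "'i set \<Rightarrow> ('i \<Rightarrow> 'k::field) set" where
  "proj_vectors V = {v \<in> extensional V. \<exists>i\<in>V. v i \<noteq> 0}"

definition proj_point :: "'i set \<Rightarrow> ('i \<Rightarrow> 'k::field) \<Rightarrow> ('i \<Rightarrow> 'k) set" where
  "proj_point V v = {w. \<exists>c. c \<noteq> 0 \<and> w = (\<lambda>i\<in>V. c * v i)}"

definition proj_space :: "'i set \<Rightarrow> ('i \<Rightarrow> 'k::field) set set" where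
  "proj_space V = proj_point V ` proj_vectors V"

definition zariski_closed :: "'i set \<Rightarrow> ('i \<Rightarrow> 'k::field) set set \<Rightarrow> bool" where
  "zariski_closed V Z \<longleftrightarrow>
     (\<exists>F \<subseteq> carrier (poly_ring V). (\<forall>f\<in>F. homogeneous f) \<and>
        Z = {proj_point V v | v. v \<in> proj_vectors V \<and> (\<forall>f\<in>F. mpol_eval f v = 0)})"

definition zariski_open :: "'i set \<Rightarrow> ('i \<Rightarrow> 'k::field) set set \<Rightarrow> bool" where
  "zariski_open V U \<longleftrightarrow> U \<subseteq> proj_space V \<and> zariski_closed V (proj_space V - U)"

section \<open>The Noether normalization locus\<close>

definition form :: "nat \<Rightarrow> (nat \<Rightarrow> nat mon) \<Rightarrow> (nat \<Rightarrow> 'k::field) \<Rightarrow> (nat, 'k) mpol" where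
  "form N M a = (\<Sum>j=1..N. Poly_Mapping.single (M j) (a j))"

text \<open>
  A tuple \<open>(\<a>\<^sub>0, \<dots>, \<a>\<^sub>n)\<close> of vectors in \<open>k\<^sup>N\<close> is a coordinate vector \<open>v\<close> indexed by
  \<open>{0..n} \<times> {1..N}\<close>, with \<open>\<a>\<^sub>i = (v (i, 1), \<dots>, v (i, N))\<close>. The condition on \<open>v\<close> is invariant
  under scaling, since the ideal is.
\<close>

definition noether_locus ::
    "nat \<Rightarrow> (nat, 'k::field) mpol set \<Rightarrow> nat \<Rightarrow> (nat \<Rightarrow> nat mon) \<Rightarrow> enat
       \<Rightarrow> (nat \<times> nat \<Rightarrow> 'k) set set" where
  "noether_locus n P N M r =
     (let R = poly_ring {0..n} Quot P;
          ideal_of = (\<lambda>v. genideal R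
            ((\<lambda>i. residue {0..n} P (form N M (\<lambda>j. v (i, j)))) ` {0..n}))
      in {proj_point ({0..n} \<times> {1..N}) v | v.
            v \<in> proj_vectors ({0..n} \<times> {1..N}) \<and>
            analytic_spread R (irrelevant_ideal {0..n} P) (ideal_of v) = r})"

end

theory Submission
  imports "Jordan_Normal_Form.Determinant" Defs
begin

text \<open>
  Write \<open>S = k[x\<^sub>0, \<dots>, x\<^sub>n]\<close>. Since the \<open>f\<^sub>i\<close> are forms of one degree \<open>d\<close>, the special fiber is the
  subalgebra of \<open>S / P\<close> generated by their residues, that is, the quotient of \<open>S\<close> by the homogeneous
  prime \<open>P\<^sub>f\<close> of all \<open>h\<close> with \<open>h(f\<^sub>0, \<dots>, f\<^sub>n) \<in> P\<close> (locale \<open>fiber\<close>, \<open>rel_ideal\<close>). The analytic spread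
  is thus the dimension of \<open>S / P\<^sub>f\<close>, and it has to be compared with that of \<open>S / P\<close>.

  All dimensions are read off from growth functions: \<open>growth P g W J\<close> is the dimension modulo \<open>P\<close> of
  the space spanned by the products of at most \<open>J\<close> of the elements \<open>g i\<close>. If \<open>P \<subset> Q\<close> are primes, an
  element of \<open>Q\<close> outside \<open>P\<close> acts as an additional variable, so the exponent of growth drops along a
  chain of primes (\<open>growth_prime_step\<close>), which bounds the Krull dimension. Conversely, counting
  standard monomials shows that the growth is as large as \<open>J\<^sup>s\<close> only if some \<open>s\<close> variables are
  independent (\<open>growth_le_of_dependent\<close>), and for homogeneous primes independent variables yield a
  chain of primes (\<open>graded_prime_chain_exists\<close>). So the Krull dimension of \<open>S / P\<close> is the exponent of
  its growth and the largest size \<open>vdim\<close> of an independent set of variables.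

  Openness needs a bound that is uniform in the \<open>f\<^sub>i\<close>, since algebraic independence alone is an
  infinite conjunction of open conditions. If every variable is algebraic over the \<open>f\<^sub>i\<close> modulo \<open>P\<close>,
  both algebras have the same exponent of growth (\<open>growth_algebraic\<close>). Otherwise some variable is
  transcendental over the \<open>f\<^sub>i\<close>, and multiplying by its powers gives
  \<open>(J + 1) growth P f J \<le> growth P x (J d + J)\<close>, whose right hand side does not involve the \<open>f\<^sub>i\<close>
  (\<open>growth_transcendental\<close>). Therefore the dimension drops if and only if the growth at one fixed
  place \<open>J\<close> stays below a fixed bound (\<open>vdim_rel_ideal_threshold\<close>). That the growth at \<open>J\<close> reaches the
  bound means that some determinant of values of linear functionals on products of the \<open>f\<^sub>i\<close> does not
  vanish, and these determinants are forms in the coefficients of the \<open>f\<^sub>i\<close> (\<open>zariski_open_growth\<close>).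
  The locus contains the tuple \<open>f\<^sub>i = x\<^sub>i\<^sup>d\<close>, over which every variable is algebraic.
\<close>

hide_const (open) Polynomial.monom Polynomial.coeff Polynomial.degree

section \<open>Polynomials and their terms\<close>
abbreviation Pol :: "'i set \<Rightarrow> ('i, 'k::field) mpol set" where
  "Pol V \<equiv> carrier (poly_ring V)"

definition cst :: "'k::field \<Rightarrow> ('i, 'k) mpol" where
  "cst c = Poly_Mapping.single 0 c"

definition Mon :: "'i set \<Rightarrow> 'i mon set" where
  "Mon V = {m. Poly_Mapping.keys m \<subseteq> V}"

definition MonL :: "'i set \<Rightarrow> nat \<Rightarrow> 'i mon set" where
  "MonL V J = {m \<in> Mon V. mon_degree m \<le> J}"

abbreviation lk :: "('a \<Rightarrow>\<^sub>0 'b::zero) \<Rightarrow> 'a \<Rightarrow> 'b" where "lk \<equiv> Poly_Mapping.lookup"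

abbreviation xpow :: "'i mon \<Rightarrow> ('i, 'k::field) mpol" where
  "xpow m \<equiv> Poly_Mapping.single m 1"

lemma Pol_iff: "f \<in> Pol V \<longleftrightarrow> Poly_Mapping.keys f \<subseteq> Mon V"
  by (auto simp: poly_ring_def Mon_def)

lemma poly_ring_simps [simp]:
  "mult (poly_ring V) = (*)" "one (poly_ring V) = 1" "zero (poly_ring V) = 0" "add (poly_ring V) = (+)"
  by (simp_all add: poly_ring_def)

lemma sum_terms: "(\<Sum>m\<in>Poly_Mapping.keys f. Poly_Mapping.single m (lk f m)) = f"
proof (rule poly_mapping_eqI)
  fix k
  show "lk (\<Sum>m\<in>Poly_Mapping.keys f. Poly_Mapping.single m (lk f m)) k = lk f k"
    by (cases "k \<in> Poly_Mapping.keys f")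
      (simp_all add: lookup_sum lookup_single when_def sum.delta in_keys_iff)
qed

lemma cst_times_xpow: "cst c * xpow m = Poly_Mapping.single m c"
  by (simp add: cst_def mult_single)

lemma lookup_cst_times [simp]: "lk (cst c * f) m = c * lk f m"
proof -
  have "cst c * f = Poly_Mapping.map ((*) c) f"
    by (simp add: cst_def mult_map_scale_conv_mult)
  then show ?thesis by (simp add: Poly_Mapping.map.rep_eq when_def)
qed

lemma cst_simps [simp]: "cst 0 = 0" "cst 1 = 1"
  by (simp_all add: cst_def)

lemma cst_add: "cst (a + b) = cst a + cst b"
  by (simp add: cst_def single_add)

lemma cst_mult: "cst (a * b) = cst a * cst b"
  by (simp add: cst_def mult_single)

lemma cst_uminus: "cst (- a) = - cst a"
  by (simp add: cst_def single_uminus)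

lemma mpol_expand: "f = (\<Sum>m\<in>Poly_Mapping.keys f. cst (lk f m) * xpow m)"
  by (simp add: cst_times_xpow sum_terms)

lemma mon_degree_superset:
  assumes "finite A" "Poly_Mapping.keys m \<subseteq> A"
  shows "mon_degree m = (\<Sum>i\<in>A. lk m i)"
  unfolding mon_degree_def
  by (rule sum.mono_neutral_left[OF assms]) (simp add: in_keys_iff)

lemma mon_degree_add: "mon_degree (m + m') = mon_degree m + mon_degree m'"
proof -
  let ?A = "Poly_Mapping.keys m \<union> Poly_Mapping.keys m'"
  have "Poly_Mapping.keys (m + m') \<subseteq> ?A" by (rule Poly_Mapping.keys_add)
  then show ?thesis
    using mon_degree_superset[of ?A "m + m'"] mon_degree_superset[of ?A m] mon_degree_superset[of ?A m']
    by (simp add: lookup_add sum.distrib)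
qed

lemma mon_degree_zero [simp]: "mon_degree 0 = 0"
  by (simp add: mon_degree_def)

lemma mon_degree_single [simp]: "mon_degree (Poly_Mapping.single i e) = e"
  by (cases "e = 0") (simp_all add: mon_degree_def)

lemma lookup_le_mon_degree: "lk m i \<le> mon_degree m"
proof (cases "i \<in> Poly_Mapping.keys m")
  case True
  then show ?thesis unfolding mon_degree_def
    by (intro member_le_sum) auto
qed (simp add: in_keys_iff)

lemma mon_degree_eq_0: "mon_degree m = 0 \<longleftrightarrow> m = 0"
proof
  assume "mon_degree m = 0"
  then have "lk m i = 0" for i using lookup_le_mon_degree[of m i] by simp
  then show "m = 0" by (intro poly_mapping_eqI) simp
qed simp

lemma keys_add_nat: "Poly_Mapping.keys (m + m' :: 'i mon) = Poly_Mapping.keys m \<union> Poly_Mapping.keys m'"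
  by (auto simp: in_keys_iff lookup_add)

lemma Mon_add: "m + m' \<in> Mon V \<longleftrightarrow> m \<in> Mon V \<and> m' \<in> Mon V"
  by (auto simp: Mon_def keys_add_nat)

lemma Mon_zero [simp]: "0 \<in> Mon V"
  by (simp add: Mon_def)

lemma Mon_mono: "U \<subseteq> V \<Longrightarrow> Mon U \<subseteq> Mon V"
  by (auto simp: Mon_def)

lemma MonL_add: "m \<in> MonL V I \<Longrightarrow> m' \<in> MonL V J \<Longrightarrow> m + m' \<in> MonL V (I + J)"
  by (auto simp: MonL_def Mon_add mon_degree_add)

lemma finite_bounded_monomials:
  assumes "finite V"
  shows "finite {m \<in> Mon V. \<forall>i\<in>V. lk m i \<le> b i}"
    and "card {m \<in> Mon V. \<forall>i\<in>V. lk m i \<le> b i} = (\<Prod>i\<in>V. b i + 1)"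
proof -
  let ?S = "{m \<in> Mon V. \<forall>i\<in>V. lk m i \<le> b i}"
  let ?T = "PiE V (\<lambda>i. {..b i})"
  let ?g = "\<lambda>h. \<Sum>i\<in>V. Poly_Mapping.single i (h i)"
  have lkg: "lk (?g h) i = (if i \<in> V then h i else 0)" for h i
    using assms by (simp add: lookup_sum lookup_single when_def)
  have bij: "bij_betw (\<lambda>m. \<lambda>i\<in>V. lk m i) ?S ?T"
  proof (rule bij_betw_byWitness[where f' = ?g])
    show "\<forall>m\<in>?S. ?g (\<lambda>i\<in>V. lk m i) = m"
    proof
      fix m assume "m \<in> ?S"
      then have "Poly_Mapping.keys m \<subseteq> V" by (simp add: Mon_def)
      then show "?g (\<lambda>i\<in>V. lk m i) = m"
        by (intro poly_mapping_eqI) (auto simp: lkg in_keys_iff)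
    qed
    show "\<forall>h\<in>?T. (\<lambda>i\<in>V. lk (?g h) i) = h"
      by (auto simp: lkg PiE_def extensional_def fun_eq_iff)
    show "(\<lambda>m. \<lambda>i\<in>V. lk m i) ` ?S \<subseteq> ?T" by auto
    show "?g ` ?T \<subseteq> ?S"
      by (auto simp: lkg Mon_def in_keys_iff PiE_def split: if_splits)
  qed
  have "finite ?T" using assms by (intro finite_PiE) auto
  then show "finite ?S" using bij_betw_finite[OF bij] by simp
  show "card ?S = (\<Prod>i\<in>V. b i + 1)"
    using bij_betw_same_card[OF bij] assms by (simp add: card_PiE)
qed

lemma finite_MonL [intro, simp]: "finite V \<Longrightarrow> finite (MonL V J)"
proof -
  assume "finite V"
  then have "finite {m \<in> Mon V. \<forall>i\<in>V. lk m i \<le> J}" by (rule finite_bounded_monomials(1))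
  moreover have "MonL V J \<subseteq> {m \<in> Mon V. \<forall>i\<in>V. lk m i \<le> J}"
    using lookup_le_mon_degree le_trans by (fastforce simp: MonL_def)
  ultimately show ?thesis by (rule finite_subset[rotated])
qed

section \<open>The polynomial ring and its ideals\<close>

lemma Pol_intros [intro, simp]:
  "0 \<in> Pol V" "1 \<in> Pol V" "cst c \<in> Pol V"
  by (auto simp: Pol_iff cst_def Mon_def)

lemma Pol_xpow_iff [simp]: "(xpow m :: ('i, 'k::field) mpol) \<in> Pol V \<longleftrightarrow> m \<in> Mon V"
  by (simp add: Pol_iff)

lemma Pol_add [intro]: "f \<in> Pol V \<Longrightarrow> g \<in> Pol V \<Longrightarrow> f + g \<in> Pol V"
  using Poly_Mapping.keys_add[of f g] by (auto simp: Pol_iff)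

lemma Pol_uminus [intro]: "f \<in> Pol V \<Longrightarrow> - f \<in> Pol V"
  by (auto simp: Pol_iff in_keys_iff)

lemma Pol_minus [intro]: "f \<in> Pol V \<Longrightarrow> g \<in> Pol V \<Longrightarrow> f - g \<in> Pol V"
  using Pol_add[of f V "- g"] by auto

lemma Pol_mult [intro]: "f \<in> Pol V \<Longrightarrow> g \<in> Pol V \<Longrightarrow> f * g \<in> Pol V"
  using keys_mult[of f g] by (fastforce simp: Pol_iff Mon_add)

lemma Pol_sum [intro]: "(\<And>i. i \<in> A \<Longrightarrow> f i \<in> Pol V) \<Longrightarrow> sum f A \<in> Pol V"
  by (induction A rule: infinite_finite_induct) auto

lemma Pol_prod [intro]: "(\<And>i. i \<in> A \<Longrightarrow> f i \<in> Pol V) \<Longrightarrow> prod f A \<in> Pol V"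
  by (induction A rule: infinite_finite_induct) auto

lemma Pol_power [intro]: "f \<in> Pol V \<Longrightarrow> f ^ e \<in> Pol V"
  by (induction e) auto

lemma Pol_subset: "U \<subseteq> V \<Longrightarrow> Pol U \<subseteq> Pol V"
  using Mon_mono[of U V] unfolding Pol_iff subset_iff by blast

lemma poly_ring_cring: "cring (poly_ring V)"
proof (rule cringI)
  show "abelian_group (poly_ring V)"
    by (rule abelian_groupI) (auto simp: add.assoc add.commute intro: exI[of _ "- _"] bexI[of _ "- _"])
  show "Group.comm_monoid (poly_ring V)"
    by (rule comm_monoidI) (auto simp: mult.assoc mult.commute)
qed (auto simp: distrib_right)

lemma poly_ring_a_inv: "f \<in> Pol V \<Longrightarrow> \<ominus>\<^bsub>poly_ring V\<^esub> f = - f"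
proof -
  assume f: "f \<in> Pol V"
  interpret cring "poly_ring V" by (rule poly_ring_cring)
  have "f \<oplus>\<^bsub>poly_ring V\<^esub> (- f) = \<zero>\<^bsub>poly_ring V\<^esub>" by simp
  then show ?thesis using minus_equality[of "- f" f] f by (auto simp: add.commute)
qed

lemma poly_ideal_iff:
  "ideal P (poly_ring V) \<longleftrightarrow>
     P \<subseteq> Pol V \<and> 0 \<in> P \<and> (\<forall>f\<in>P. \<forall>g\<in>P. f + g \<in> P) \<and> (\<forall>f\<in>Pol V. \<forall>g\<in>P. f * g \<in> P)"
proof
  assume I: "ideal P (poly_ring V)"
  then interpret I: ideal P "poly_ring V" .
  show "P \<subseteq> Pol V \<and> 0 \<in> P \<and> (\<forall>f\<in>P. \<forall>g\<in>P. f + g \<in> P) \<and> (\<forall>f\<in>Pol V. \<forall>g\<in>P. f * g \<in> P)"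
  proof (intro conjI ballI)
    show "P \<subseteq> Pol V" by (rule I.a_subset)
    show "0 \<in> P" using additive_subgroup.zero_closed[OF I.additive_subgroup_axioms] by simp
    show "f + g \<in> P" if "f \<in> P" "g \<in> P" for f g
      using additive_subgroup.a_closed[OF I.additive_subgroup_axioms that] by simp
    show "f * g \<in> P" if "f \<in> Pol V" "g \<in> P" for f g
      using I.I_l_closed[OF that(2,1)] by simp
  qed
next
  assume P: "P \<subseteq> Pol V \<and> 0 \<in> P \<and> (\<forall>f\<in>P. \<forall>g\<in>P. f + g \<in> P) \<and> (\<forall>f\<in>Pol V. \<forall>g\<in>P. f * g \<in> P)"
  interpret cring "poly_ring V" by (rule poly_ring_cring)
  have neg: "- f \<in> P" if "f \<in> P" for f
  proof -
    have "cst (-1) * f \<in> P" using P that by blast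
    then show ?thesis by (simp add: cst_uminus)
  qed
  show "ideal P (poly_ring V)"
  proof (rule idealI)
    show "ring (poly_ring V)" by (rule ring_axioms)
    show "subgroup P (add_monoid (poly_ring V))"
    proof
      fix x assume "x \<in> P"
      then have "inv\<^bsub>add_monoid (poly_ring V)\<^esub> x = - x"
        using poly_ring_a_inv[of x V] P by (auto simp: a_inv_def)
      then show "inv\<^bsub>add_monoid (poly_ring V)\<^esub> x \<in> P" using neg[OF \<open>x \<in> P\<close>] by simp
    qed (use P in auto)
    show "x \<otimes>\<^bsub>poly_ring V\<^esub> a \<in> P" "a \<otimes>\<^bsub>poly_ring V\<^esub> x \<in> P"
      if "a \<in> P" "x \<in> Pol V" for a x
    proof -
      have "x * a \<in> P" using P that by blast
      then show "x \<otimes>\<^bsub>poly_ring V\<^esub> a \<in> P" "a \<otimes>\<^bsub>poly_ring V\<^esub> x \<in> P"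
        by (simp_all add: mult.commute[of a x])
    qed
  qed
qed

lemma poly_primeideal_iff:
  "primeideal P (poly_ring V) \<longleftrightarrow> ideal P (poly_ring V) \<and> 1 \<notin> P \<and>
     (\<forall>f\<in>Pol V. \<forall>g\<in>Pol V. f * g \<in> P \<longrightarrow> f \<in> P \<or> g \<in> P)"
proof
  assume I: "primeideal P (poly_ring V)"
  then interpret I: primeideal P "poly_ring V" .
  show "ideal P (poly_ring V) \<and> 1 \<notin> P \<and>
     (\<forall>f\<in>Pol V. \<forall>g\<in>Pol V. f * g \<in> P \<longrightarrow> f \<in> P \<or> g \<in> P)"
    using I.is_ideal I.I_prime I.I_notcarr I.one_imp_carrier by auto
next
  assume "ideal P (poly_ring V) \<and> 1 \<notin> P \<and>
     (\<forall>f\<in>Pol V. \<forall>g\<in>Pol V. f * g \<in> P \<longrightarrow> f \<in> P \<or> g \<in> P)"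
  then show "primeideal P (poly_ring V)"
    by (intro primeidealI) (auto simp: poly_ring_cring)
qed

context
  fixes P :: "('i, 'k::field) mpol set" and V
  assumes P: "ideal P (poly_ring V)"
begin

lemma ideal_Pol: "f \<in> P \<Longrightarrow> f \<in> Pol V"
  and ideal_zero: "0 \<in> P"
  and ideal_add: "f \<in> P \<Longrightarrow> g \<in> P \<Longrightarrow> f + g \<in> P"
  and ideal_mult: "f \<in> Pol V \<Longrightarrow> g \<in> P \<Longrightarrow> f * g \<in> P"
  using P unfolding poly_ideal_iff by auto

lemma ideal_mult': "g \<in> P \<Longrightarrow> f \<in> Pol V \<Longrightarrow> g * f \<in> P"
  using ideal_mult[of f g] by (simp add: mult.commute)

lemma ideal_uminus: "f \<in> P \<Longrightarrow> - f \<in> P"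
  using ideal_mult[OF Pol_intros(3)[of "-1"], of f] by (simp add: cst_uminus)

lemma ideal_minus: "f \<in> P \<Longrightarrow> g \<in> P \<Longrightarrow> f - g \<in> P"
  using ideal_add[of f "- g"] ideal_uminus[of g] by simp

lemma ideal_sum: "(\<And>i. i \<in> A \<Longrightarrow> f i \<in> P) \<Longrightarrow> sum f A \<in> P"
  by (induction A rule: infinite_finite_induct) (auto intro: ideal_zero ideal_add)

lemma ideal_diff_iff: "f - g \<in> P \<Longrightarrow> f \<in> P \<longleftrightarrow> g \<in> P"
  using ideal_add[of "f - g" g] ideal_minus[of f "f - g"] by auto

end

lemma prime_one: "primeideal P (poly_ring V) \<Longrightarrow> 1 \<notin> P"
  and prime_ideal: "primeideal P (poly_ring V) \<Longrightarrow> ideal P (poly_ring V)"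
  and prime_mult: "primeideal P (poly_ring V) \<Longrightarrow> f * g \<in> P \<Longrightarrow> f \<in> Pol V \<Longrightarrow> g \<in> Pol V \<Longrightarrow> f \<in> P \<or> g \<in> P"
  unfolding poly_primeideal_iff by auto

lemma prime_power: "primeideal P (poly_ring V) \<Longrightarrow> f \<in> Pol V \<Longrightarrow> f ^ e \<in> P \<Longrightarrow> f \<in> P"
  by (induction e) (use prime_one prime_mult Pol_power in \<open>fastforce+\<close>)

section \<open>Substitution\<close>

definition mpow :: "('i \<Rightarrow> 'b::comm_monoid_mult) \<Rightarrow> 'i mon \<Rightarrow> 'b" where
  "mpow g m = (\<Prod>i\<in>Poly_Mapping.keys m. g i ^ lk m i)"

text \<open>Two coefficient maps occur: \<open>cst\<close>, which gives substitution of polynomials, and the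
  identity, which gives \<open>mpol_eval\<close>.\<close>
definition subst :: "('k::field \<Rightarrow> 'b::comm_ring_1) \<Rightarrow> ('i \<Rightarrow> 'b) \<Rightarrow> ('i, 'k) mpol \<Rightarrow> 'b" where
  "subst c g f = (\<Sum>m\<in>Poly_Mapping.keys f. c (lk f m) * mpow g m)"

abbreviation psubst :: "('i \<Rightarrow> ('j, 'k::field) mpol) \<Rightarrow> ('i, 'k) mpol \<Rightarrow> ('j, 'k) mpol" where
  "psubst \<equiv> subst cst"

lemma mpow_superset:
  assumes "finite A" "Poly_Mapping.keys m \<subseteq> A"
  shows "mpow g m = (\<Prod>i\<in>A. g i ^ lk m i)"
  unfolding mpow_def by (rule prod.mono_neutral_left[OF assms]) (simp add: in_keys_iff)

lemma mpow_add: "mpow g (m + m') = mpow g m * mpow g m'"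
proof -
  let ?A = "Poly_Mapping.keys m \<union> Poly_Mapping.keys m'"
  have "finite ?A" by simp
  then show ?thesis
    using mpow_superset[of ?A "m + m'" g] mpow_superset[of ?A m g] mpow_superset[of ?A m' g]
    by (simp add: keys_add_nat lookup_add power_add prod.distrib)
qed

lemma mpow_zero [simp]: "mpow g 0 = 1"
  by (simp add: mpow_def)

lemma mpow_single [simp]: "mpow g (Poly_Mapping.single i e) = g i ^ e"
  by (cases "e = 0") (simp_all add: mpow_def)

lemma mpow_cong: "(\<And>i. i \<in> Poly_Mapping.keys m \<Longrightarrow> g i = h i) \<Longrightarrow> mpow g m = mpow h m"
  by (simp add: mpow_def)

definition X :: "'i \<Rightarrow> ('i, 'k::field) mpol" where
  "X i = xpow (Poly_Mapping.single i 1)"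

lemma X_power: "X i ^ e = xpow (Poly_Mapping.single i e)"
  by (induction e) (simp_all add: X_def mult_single single_add[symmetric] add.commute)

lemma prod_xpow: "finite A \<Longrightarrow> (\<Prod>i\<in>A. xpow (h i) :: ('i, 'k::field) mpol) = xpow (\<Sum>i\<in>A. h i)"
  by (induction A rule: finite_induct) (simp_all add: mult_single)

lemma mpow_X [simp]: "mpow X m = (xpow m :: ('i, 'k::field) mpol)"
  using sum_terms[of m] by (simp add: mpow_def X_power prod_xpow)

lemma X_in_Pol [simp]: "(X i :: ('i, 'k::field) mpol) \<in> Pol V \<longleftrightarrow> i \<in> V"
  by (simp add: X_def Mon_def)

lemma mpow_Pol: "(\<And>i. i \<in> W \<Longrightarrow> g i \<in> Pol V) \<Longrightarrow> m \<in> Mon W \<Longrightarrow> mpow g m \<in> Pol V"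
  by (auto simp: mpow_def Mon_def)

context
  fixes c :: "'k::field \<Rightarrow> 'b::comm_ring_1" and g :: "'i \<Rightarrow> 'b"
  assumes c0: "c 0 = 0" and c1: "c 1 = 1" and cadd: "\<And>a b. c (a + b) = c a + c b"
    and cmul: "\<And>a b. c (a * b) = c a * c b"
begin

lemma subst_superset:
  "finite A \<Longrightarrow> Poly_Mapping.keys f \<subseteq> A \<Longrightarrow> subst c g f = (\<Sum>m\<in>A. c (lk f m) * mpow g m)"
  unfolding subst_def by (rule sum.mono_neutral_left) (auto simp: in_keys_iff c0)

lemma subst_zero: "subst c g 0 = 0"
  by (simp add: subst_def)

lemma subst_add: "subst c g (f + f') = subst c g f + subst c g f'"
proof -
  let ?A = "Poly_Mapping.keys f \<union> Poly_Mapping.keys f'"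
  show ?thesis
    using subst_superset[of ?A f] subst_superset[of ?A f'] subst_superset[of ?A "f + f'"]
      Poly_Mapping.keys_add[of f f']
    by (simp add: lookup_add cadd distrib_right sum.distrib)
qed

lemma subst_sum: "subst c g (sum f A) = (\<Sum>i\<in>A. subst c g (f i))"
  by (induction A rule: infinite_finite_induct) (simp_all add: subst_zero subst_add)

lemma subst_single: "subst c g (Poly_Mapping.single m a) = c a * mpow g m"
  by (cases "a = 0") (simp_all add: subst_def c0)

lemma subst_mult: "subst c g (f * f') = subst c g f * subst c g f'"
proof -
  have "f * f' = (\<Sum>m\<in>Poly_Mapping.keys f. \<Sum>m'\<in>Poly_Mapping.keys f'.
          Poly_Mapping.single (m + m') (lk f m * lk f' m'))"
    by (subst (1 2) sum_terms[symmetric]) (simp add: sum_product mult_single)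
  then have "subst c g (f * f') = (\<Sum>m\<in>Poly_Mapping.keys f. \<Sum>m'\<in>Poly_Mapping.keys f'.
          c (lk f m) * c (lk f' m') * (mpow g m * mpow g m'))"
    by (simp add: subst_sum subst_single cmul mpow_add)
  also have "\<dots> = subst c g f * subst c g f'"
    by (simp add: subst_def sum_product algebra_simps)
  finally show ?thesis .
qed

lemma subst_one: "subst c g 1 = 1"
  using subst_single[of 0 1] by (simp add: c1)

end

lemmas psubst_zero = subst_zero[of cst, OF cst_simps cst_add cst_mult]
  and psubst_one = subst_one[of cst, OF cst_simps cst_add cst_mult]
  and psubst_add = subst_add[of cst, OF cst_simps cst_add cst_mult]
  and psubst_mult = subst_mult[of cst, OF cst_simps cst_add cst_mult]
  and psubst_sum = subst_sum[of cst, OF cst_simps cst_add cst_mult]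
  and psubst_single = subst_single[of cst, OF cst_simps cst_add cst_mult]

lemma psubst_cst: "psubst g (cst c) = cst c"
  using psubst_single[of g 0 c] by (simp add: cst_def)

lemma psubst_X: "psubst g (X i) = g i"
  using psubst_single[of g "Poly_Mapping.single i 1" 1] by (simp add: X_def)

lemma psubst_Pol: "(\<And>i. i \<in> W \<Longrightarrow> g i \<in> Pol V) \<Longrightarrow> f \<in> Pol W \<Longrightarrow> psubst g f \<in> Pol V"
  unfolding subst_def by (intro Pol_sum Pol_mult mpow_Pol[of W] Pol_intros(3)) (simp, simp add: Pol_iff[of f] subset_iff)

lemma mpol_eval_subst: "mpol_eval f v = subst id v f"
  by (simp add: mpol_eval_def subst_def mpow_def)

section \<open>Linear algebra modulo an ideal\<close>

interpretation mp: vector_space "\<lambda>c f. cst c * f :: ('i, 'k::field) mpol"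
  by unfold_locales (simp_all add: cst_add cst_mult algebra_simps)

lemma ideal_subspace: "ideal P (poly_ring V) \<Longrightarrow> mp.subspace P"
  unfolding mp.subspace_def by (auto intro: ideal_zero ideal_add ideal_mult)

text \<open>Families instead of sets, because distinct products of the generators of a subalgebra may be
  equal, and such a coincidence has to count as a relation.\<close>
definition indep_mod :: "('i, 'k::field) mpol set \<Rightarrow> ('j \<Rightarrow> ('i, 'k) mpol) \<Rightarrow> 'j set \<Rightarrow> bool" where
  "indep_mod P b B \<longleftrightarrow> (\<forall>c. (\<Sum>j\<in>B. cst (c j) * b j) \<in> P \<longrightarrow> (\<forall>j\<in>B. c j = 0))"

lemma indep_modD: "indep_mod P b B \<Longrightarrow> (\<Sum>j\<in>B. cst (c j) * b j) \<in> P \<Longrightarrow> j \<in> B \<Longrightarrow> c j = 0"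
  by (auto simp: indep_mod_def)

lemma indep_mod_mono: "indep_mod Q b B \<Longrightarrow> P \<subseteq> Q \<Longrightarrow> indep_mod P b B"
  by (auto simp: indep_mod_def)

lemma indep_mod_subset:
  assumes "indep_mod P b B" "A \<subseteq> B" "finite B"
  shows "indep_mod P b A"
  unfolding indep_mod_def
proof (intro allI impI ballI)
  fix c j assume c: "(\<Sum>j\<in>A. cst (c j) * b j) \<in> P" and j: "j \<in> A"
  have "(\<Sum>j\<in>B. cst (if j \<in> A then c j else 0) * b j) = (\<Sum>j\<in>A. cst (c j) * b j)"
    using assms(2,3) by (intro sum.mono_neutral_cong_right) auto
  then show "c j = 0"
    using indep_modD[OF assms(1), of "\<lambda>j. if j \<in> A then c j else 0" j] c j assms(2) by auto
qed

lemma span_family: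
  assumes "finite B" "x \<in> mp.span (b ` B)"
  obtains c where "x = (\<Sum>j\<in>B. cst (c j) * b j)"
proof -
  let ?S = "{\<Sum>j\<in>B. cst (c j) * b j | c. True}"
  have "mp.subspace ?S"
    unfolding mp.subspace_def
  proof (intro conjI ballI allI)
    show "0 \<in> ?S" by (auto intro: exI[of _ "\<lambda>_. 0"])
    fix x y assume "x \<in> ?S" "y \<in> ?S"
    then obtain c d where "x = (\<Sum>j\<in>B. cst (c j) * b j)" "y = (\<Sum>j\<in>B. cst (d j) * b j)" by auto
    then have "x + y = (\<Sum>j\<in>B. cst (c j + d j) * b j)"
      by (simp add: sum.distrib cst_add distrib_right)
    then show "x + y \<in> ?S" by (auto intro!: exI[of _ "\<lambda>j. c j + d j"])
  next
    fix a x assume "x \<in> ?S"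
    then obtain c where "x = (\<Sum>j\<in>B. cst (c j) * b j)" by auto
    then have "cst a * x = (\<Sum>j\<in>B. cst (a * c j) * b j)"
      by (simp add: sum_distrib_left)
    then show "cst a * x \<in> ?S" by (auto intro!: exI[of _ "\<lambda>j. a * c j"])
  qed
  moreover have "b ` B \<subseteq> ?S"
  proof (rule image_subsetI)
    fix i assume "i \<in> B"
    then have "b i = (\<Sum>j\<in>B. cst (if j = i then 1 else 0) * b j)"
      using assms(1) by (simp add: if_distrib[of cst] if_distrib[of "\<lambda>x. x * _"] sum.delta cong: if_cong)
    then show "b i \<in> ?S" by (auto intro!: exI[of _ "\<lambda>j. if j = i then 1 else 0"])
  qed
  ultimately have "mp.span (b ` B) \<subseteq> ?S" by (rule mp.span_minimal[rotated])
  then show ?thesis using assms(2) that by auto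
qed

lemma span_Un_subspaceE:
  assumes "mp.subspace P" "x \<in> mp.span (A \<union> P)"
  obtains a where "a \<in> mp.span A" "x - a \<in> P"
proof -
  have "mp.span P = P" using assms(1) by (simp add: mp.span_eq_iff)
  then obtain a p where "x = a + p" "a \<in> mp.span A" "p \<in> P"
    using assms(2) unfolding mp.span_Un by fastforce
  then show ?thesis using that[of a] by simp
qed

text \<open>Steinitz: subtracting elements of \<open>P\<close> moves the family into the span of \<open>A\<close>
  without destroying its independence.\<close>
lemma indep_mod_card_le:
  fixes P :: "('i, 'k::field) mpol set"
  assumes P: "mp.subspace P" and "finite A" "finite B" and ind: "indep_mod P b B"
    and sp: "\<And>j. j \<in> B \<Longrightarrow> b j \<in> mp.span (A \<union> P)"
  shows "card B \<le> card A"
proof -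
  have "\<forall>j\<in>B. \<exists>a. a \<in> mp.span A \<and> b j - a \<in> P"
    using span_Un_subspaceE[OF P sp] by metis
  then obtain a where a: "\<And>j. j \<in> B \<Longrightarrow> a j \<in> mp.span A" "\<And>j. j \<in> B \<Longrightarrow> b j - a j \<in> P"
    by metis
  have zero: "c j = 0" if c: "(\<Sum>j\<in>B. cst (c j) * a j) = 0" and j: "j \<in> B" for c j
  proof -
    have "(\<Sum>j\<in>B. cst (c j) * (b j - a j)) \<in> P"
      using P a(2) by (intro mp.subspace_sum mp.subspace_scale) auto
    then have "(\<Sum>j\<in>B. cst (c j) * b j) \<in> P"
      using c by (simp add: right_diff_distrib sum_subtractf)
    then show ?thesis using indep_modD[OF ind] j by blast
  qed
  have inj: "inj_on a B"
  proof (rule inj_onI, rule ccontr)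
    fix i j assume ij: "i \<in> B" "j \<in> B" "a i = a j" "i \<noteq> j"
    let ?c = "\<lambda>l. (if l = i then 1 else 0) - (if l = j then 1 else 0) :: 'k"
    have cst_diff: "cst (x - y) = cst x - cst y" for x y
      using cst_add[of x "- y"] by (simp add: cst_uminus)
    have "(\<Sum>l\<in>B. cst (?c l) * a l) = a i - a j"
      using \<open>finite B\<close> ij
      by (simp add: cst_diff left_diff_distrib sum_subtractf if_distrib[of cst]
          if_distrib[of "\<lambda>x. x * _"] sum.delta cong: if_cong)
    then have "?c i = 0" using zero[of ?c i] ij by auto
    then show False using ij by auto
  qed
  have "mp.independent (a ` B)"
  proof (rule mp.independent_if_scalars_zero)
    fix f x assume f: "(\<Sum>x\<in>a ` B. cst (f x) * x) = 0" and x: "x \<in> a ` B"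
    have "(\<Sum>j\<in>B. cst (f (a j)) * a j) = 0"
      using f sum.reindex[OF inj, of "\<lambda>x. cst (f x) * x"] by (simp add: o_def)
    then show "f x = 0" using zero[of "\<lambda>j. f (a j)"] x by auto
  qed (use \<open>finite B\<close> in simp)
  then have "card (a ` B) \<le> card A"
    using mp.independent_span_bound[OF \<open>finite A\<close>] a(1) by blast
  then show ?thesis using card_image[OF inj] by simp
qed

definition rank_mod :: "('i, 'k::field) mpol set \<Rightarrow> ('j \<Rightarrow> ('i, 'k) mpol) \<Rightarrow> 'j set \<Rightarrow> nat" where
  "rank_mod P b A = Max (card ` {B. B \<subseteq> A \<and> indep_mod P b B})"

lemma rank_mod_basis:
  assumes P: "mp.subspace P" and "finite A"
  obtains B where "B \<subseteq> A" "finite B" "card B = rank_mod P b A" "indep_mod P b B"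
    "\<And>j. j \<in> A \<Longrightarrow> b j \<in> mp.span (b ` B \<union> P)"
proof -
  let ?\<B> = "{B. B \<subseteq> A \<and> indep_mod P b B}"
  have fin: "finite ?\<B>" using \<open>finite A\<close> by simp
  have ne: "{} \<in> ?\<B>" by (simp add: indep_mod_def)
  have "rank_mod P b A \<in> card ` ?\<B>"
    unfolding rank_mod_def using fin ne by (intro Max_in) auto
  then obtain B where B: "B \<subseteq> A" "indep_mod P b B" "card B = rank_mod P b A" by auto
  have finB: "finite B" using B(1) \<open>finite A\<close> finite_subset by blast
  have "b j \<in> mp.span (b ` B \<union> P)" if j: "j \<in> A" for j
  proof (cases "j \<in> B")
    case True then show ?thesis by (intro mp.span_base) auto
  next
    case False
    have "\<not> indep_mod P b (insert j B)"
    proof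
      assume "indep_mod P b (insert j B)"
      then have "card (insert j B) \<le> rank_mod P b A"
        unfolding rank_mod_def using fin B(1) j by (intro Max_ge) auto
      then show False using False finB B(3) by simp
    qed
    then obtain c i where c: "(\<Sum>l\<in>insert j B. cst (c l) * b l) \<in> P" and i: "i \<in> insert j B" "c i \<noteq> 0"
      unfolding indep_mod_def by auto
    have s: "(\<Sum>l\<in>insert j B. cst (c l) * b l) = cst (c j) * b j + (\<Sum>l\<in>B. cst (c l) * b l)"
      using finB False by simp
    have cj: "c j \<noteq> 0"
    proof
      assume "c j = 0"
      then show False using c s i indep_modD[OF B(2), of c i] by auto
    qed
    have "cst (c j) * b j \<in> mp.span (b ` B \<union> P)"
    proof -
      have "cst (c j) * b j + (\<Sum>l\<in>B. cst (c l) * b l) \<in> mp.span (b ` B \<union> P)"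
        using c s by (intro mp.span_base) auto
      moreover have "(\<Sum>l\<in>B. cst (c l) * b l) \<in> mp.span (b ` B \<union> P)"
        by (intro mp.span_sum mp.span_scale mp.span_base) auto
      ultimately show ?thesis using mp.span_diff by fastforce
    qed
    then have "cst (inverse (c j)) * (cst (c j) * b j) \<in> mp.span (b ` B \<union> P)"
      by (rule mp.span_scale)
    then show ?thesis using cj by (simp add: mult.assoc[symmetric] cst_mult[symmetric])
  qed
  then show ?thesis using that B finB by blast
qed

lemma indep_mod_le_rank:
  assumes P: "mp.subspace P" and "finite A" "finite B" "indep_mod P b B"
    and sp: "\<And>j. j \<in> B \<Longrightarrow> b j \<in> mp.span (a ` A \<union> P)"
  shows "card B \<le> rank_mod P a A"
proof -
  obtain A' where A': "A' \<subseteq> A" "finite A'" "card A' = rank_mod P a A"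
    "\<And>j. j \<in> A \<Longrightarrow> a j \<in> mp.span (a ` A' \<union> P)"
    using rank_mod_basis[OF P \<open>finite A\<close>, of a] by metis
  have "a ` A \<union> P \<subseteq> mp.span (a ` A' \<union> P)"
    using A'(4) by (auto intro: mp.span_base)
  then have "mp.span (a ` A \<union> P) \<subseteq> mp.span (a ` A' \<union> P)"
    by (intro mp.span_minimal mp.subspace_span)
  then have "card B \<le> card (a ` A')"
    using indep_mod_card_le[OF P _ \<open>finite B\<close> assms(4), of "a ` A'"] A'(2) sp by blast
  then show ?thesis using A'(2,3) card_image_le[of A' a] by simp
qed

lemma rank_mod_le:
  assumes "mp.subspace P" "finite A" "finite C" "\<And>j. j \<in> A \<Longrightarrow> b j \<in> mp.span (C \<union> P)"
  shows "rank_mod P b A \<le> card C"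
proof -
  obtain B where "B \<subseteq> A" "finite B" "card B = rank_mod P b A" "indep_mod P b B"
    using rank_mod_basis[OF assms(1,2)] by metis
  then show ?thesis using indep_mod_card_le[OF assms(1,3)] assms(4) by (metis subsetD)
qed

lemma rank_mod_mono:
  assumes "mp.subspace P" "finite A" "finite A'" "\<And>j. j \<in> A \<Longrightarrow> b j \<in> mp.span (b' ` A' \<union> P)"
  shows "rank_mod P b A \<le> rank_mod P b' A'"
proof -
  obtain B where "B \<subseteq> A" "finite B" "card B = rank_mod P b A" "indep_mod P b B"
    using rank_mod_basis[OF assms(1,2)] by metis
  then show ?thesis using indep_mod_le_rank[OF assms(1,3)] assms(4) by (metis subsetD)
qed

text \<open>Independence modulo \<open>Q\<close> handles the coefficients and \<open>trans\<close> the powers of \<open>z\<close>. It is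
  used with \<open>Q\<close> a larger prime, and with \<open>Q = P\<close> and \<open>z\<close> transcendental.\<close>
lemma indep_mod_powers:
  assumes "finite B" "indep_mod Q b B"
    and trans: "\<And>\<beta>. (\<And>i. i \<le> m \<Longrightarrow> \<beta> i \<in> mp.span (b ` B)) \<Longrightarrow> (\<Sum>i\<le>m. \<beta> i * z ^ i) \<in> P \<Longrightarrow>
      (\<And>i. i \<le> m \<Longrightarrow> \<beta> i \<in> Q)"
  shows "indep_mod P (\<lambda>(j, i). b j * z ^ i) (B \<times> {..m})"
  unfolding indep_mod_def
proof (intro allI impI ballI)
  fix c x assume c: "(\<Sum>x\<in>B \<times> {..m}. cst (c x) * (case x of (j, i) \<Rightarrow> b j * z ^ i)) \<in> P"
    and x: "x \<in> B \<times> {..m}"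
  obtain j i where ji: "x = (j, i)" "j \<in> B" "i \<le> m" using x by auto
  let ?\<beta> = "\<lambda>i. \<Sum>j\<in>B. cst (c (j, i)) * b j"
  have "(\<Sum>x\<in>B \<times> {..m}. cst (c x) * (case x of (j, i) \<Rightarrow> b j * z ^ i)) =
      (\<Sum>j\<in>B. \<Sum>i\<le>m. cst (c (j, i)) * (b j * z ^ i))"
    by (subst sum.cartesian_product) (simp add: split_def)
  also have "\<dots> = (\<Sum>i\<le>m. \<Sum>j\<in>B. cst (c (j, i)) * (b j * z ^ i))"
    by (rule sum.swap)
  also have "\<dots> = (\<Sum>i\<le>m. ?\<beta> i * z ^ i)"
    by (simp add: sum_distrib_right mult.assoc)
  finally have "(\<Sum>i\<le>m. ?\<beta> i * z ^ i) \<in> P" using c by simp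
  moreover have "?\<beta> i \<in> mp.span (b ` B)" for i
    by (intro mp.span_sum mp.span_scale mp.span_base) auto
  ultimately have "?\<beta> i \<in> Q" using trans[of ?\<beta> i] ji(3) by blast
  then show "c x = 0" using indep_modD[OF assms(2), of "\<lambda>j. c (j, i)" j] ji by blast
qed

section \<open>Growth functions\<close>

definition PolL :: "'i set \<Rightarrow> nat \<Rightarrow> ('i, 'k::field) mpol set" where
  "PolL V J = {f. Poly_Mapping.keys f \<subseteq> MonL V J}"

lemma PolL_Pol: "f \<in> PolL V J \<Longrightarrow> f \<in> Pol V"
  by (auto simp: PolL_def Pol_iff MonL_def)

lemma PolL_obtain: assumes "f \<in> Pol V" obtains e where "f \<in> PolL V e"
proof
  show "f \<in> PolL V (\<Sum>m\<in>Poly_Mapping.keys f. mon_degree m)"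
    using assms by (auto simp: PolL_def Pol_iff MonL_def intro!: member_le_sum)
qed

lemma PolL_mono: "f \<in> PolL V I \<Longrightarrow> I \<le> J \<Longrightarrow> f \<in> PolL V J"
  by (auto simp: PolL_def MonL_def)

lemma PolL_mult: "f \<in> PolL V I \<Longrightarrow> g \<in> PolL V J \<Longrightarrow> f * g \<in> PolL V (I + J)"
  using keys_mult[of f g] MonL_add[of _ V I _ J] by (fastforce simp: PolL_def)

lemma PolL_one: "1 \<in> PolL V J"
  by (simp add: PolL_def MonL_def)

lemma PolL_xpow_iff [simp]: "(xpow m :: ('i, 'k::field) mpol) \<in> PolL V J \<longleftrightarrow> m \<in> MonL V J"
  by (simp add: PolL_def)

lemma PolL_power: "f \<in> PolL V e \<Longrightarrow> f ^ i \<in> PolL V (i * e)"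
  by (induction i) (auto simp: PolL_one intro: PolL_mult)

lemma PolL_span: "f \<in> PolL V J \<Longrightarrow> f \<in> mp.span (xpow ` MonL V J)"
  by (subst mpol_expand, intro mp.span_sum mp.span_scale mp.span_base imageI) (auto simp: PolL_def)

lemma PolL_span_Un: "f \<in> PolL V J \<Longrightarrow> f \<in> mp.span (xpow ` MonL V J \<union> P)"
  using PolL_span mp.span_mono[of "xpow ` MonL V J" "xpow ` MonL V J \<union> P"] by blast

text \<open>For the family of the variables this is the affine Hilbert function of the quotient by \<open>P\<close>.\<close>
definition growth :: "('i, 'k::field) mpol set \<Rightarrow> ('j \<Rightarrow> ('i, 'k) mpol) \<Rightarrow> 'j set \<Rightarrow> nat \<Rightarrow> nat" where
  "growth P g W J = rank_mod P (mpow g) (MonL W J)"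

definition growth_le :: "('i, 'k::field) mpol set \<Rightarrow> ('j \<Rightarrow> ('i, 'k) mpol) \<Rightarrow> 'j set \<Rightarrow> nat \<Rightarrow> bool" where
  "growth_le P g W s \<longleftrightarrow> (\<exists>C. \<forall>J. growth P g W J \<le> C * (J + 1) ^ s)"

lemma mpow_X_fun: "mpow X = (xpow :: 'i mon \<Rightarrow> ('i, 'k::field) mpol)"
  by (rule ext) simp

lemma growth_basis:
  assumes "ideal P (poly_ring V)" "finite W"
  obtains B where "B \<subseteq> MonL W J" "finite B" "card B = growth P g W J" "indep_mod P (mpow g) B"
    "\<And>m. m \<in> MonL W J \<Longrightarrow> mpow g m \<in> mp.span (mpow g ` B \<union> P)"
  using rank_mod_basis[OF ideal_subspace[OF assms(1)] finite_MonL[OF assms(2)], where b = "mpow g"]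
  unfolding growth_def by blast

lemma growth_pos:
  assumes P: "ideal P (poly_ring V)" "1 \<notin> P" and "finite W"
  shows "1 \<le> growth P g W J"
proof -
  have "indep_mod P (mpow g) {0}"
    unfolding indep_mod_def
  proof (intro allI impI ballI, rule ccontr)
    fix c j assume "(\<Sum>j\<in>{0}. cst (c j) * mpow g j) \<in> P" "j \<in> {0}" "c j \<noteq> 0"
    then have "cst (c 0) \<in> P" "c 0 \<noteq> 0" by simp_all
    then have "cst (inverse (c 0)) * cst (c 0) \<in> P" using ideal_mult[OF P(1)] by blast
    then show False using P(2) \<open>c 0 \<noteq> 0\<close> by (simp add: cst_mult[symmetric])
  qed
  then have "card {0::'c mon} \<le> rank_mod P (mpow g) (MonL W J)"
    using assms(3) ideal_subspace[OF P(1)]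
    by (intro indep_mod_le_rank) (auto intro!: mp.span_base imageI, simp add: MonL_def)
  then show ?thesis by (simp add: growth_def)
qed

text \<open>A nonzero element of \<open>Q\<close> modulo \<open>P\<close> behaves like a new variable over any space that is
  independent modulo \<open>Q\<close>: a relation of powers is stripped of its constant term, which lies in
  \<open>Q\<close>, and then divided by \<open>z\<close>.\<close>
lemma growth_prime_step:
  assumes P: "primeideal P (poly_ring V)" and Q: "primeideal Q (poly_ring V)" and PQ: "P \<subseteq> Q"
    and z: "z \<in> Q" "z \<notin> P" "z \<in> PolL V e" and V: "finite V"
  shows "(m + 1) * growth Q X V J \<le> growth P X V (J + m * e)"
proof -
  note IP = prime_ideal[OF P] and IQ = prime_ideal[OF Q]
  obtain B where B: "B \<subseteq> MonL V J" "finite B" "card B = growth Q X V J" "indep_mod Q xpow B"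
    using growth_basis[OF IQ V, of J X] unfolding mpow_X by metis
  have Bz: "\<beta> = 0" if \<beta>: "\<beta> \<in> mp.span (xpow ` B)" "\<beta> \<in> Q" for \<beta>
  proof -
    obtain c where c: "\<beta> = (\<Sum>j\<in>B. cst (c j) * xpow j)" using span_family[OF B(2) \<beta>(1)] by metis
    then have "\<forall>j\<in>B. c j = 0" using \<beta>(2) indep_modD[OF B(4)] by blast
    then show ?thesis using c by simp
  qed
  have BPol: "\<beta> \<in> PolL V J" if \<beta>: "\<beta> \<in> mp.span (xpow ` B)" for \<beta>
  proof -
    obtain c where c: "\<beta> = (\<Sum>j\<in>B. cst (c j) * xpow j)" using span_family[OF B(2) \<beta>(1)] by metis
    have "Poly_Mapping.keys \<beta> \<subseteq> B"
    proof
      fix m assume "m \<in> Poly_Mapping.keys \<beta>"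
      then have "(\<Sum>j\<in>B. c j * lk (xpow j) m) \<noteq> 0" by (simp add: in_keys_iff c lookup_sum)
      then obtain j where "j \<in> B" "c j * lk (xpow j) m \<noteq> 0" by (meson sum.neutral)
      then show "m \<in> B" by (cases "j = m") (auto simp: lookup_single)
    qed
    then show ?thesis using B(1) by (auto simp: PolL_def)
  qed
  have key: "\<beta> i = 0" if "\<And>i. i \<le> m \<Longrightarrow> \<beta> i \<in> mp.span (xpow ` B)" "(\<Sum>i\<le>m. \<beta> i * z ^ i) \<in> P" "i \<le> m"
    for \<beta> i m
    using that
  proof (induction m arbitrary: \<beta> i)
    case 0
    then show ?case using Bz[of "\<beta> 0"] PQ by auto
  next
    case (Suc m)
    let ?t = "\<Sum>i\<le>m. \<beta> (Suc i) * z ^ i"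
    have s: "(\<Sum>i\<le>Suc m. \<beta> i * z ^ i) = \<beta> 0 + z * ?t"
      by (simp only: sum.atMost_Suc_shift sum_distrib_left) (simp add: mult_ac)
    have tP: "?t \<in> Pol V"
      using Suc.prems(1) z(3) BPol by (intro Pol_sum Pol_mult Pol_power) (auto intro: PolL_Pol)
    have "\<beta> 0 \<in> Q"
    proof -
      have "\<beta> 0 + z * ?t \<in> Q" using Suc.prems(2) PQ s by auto
      moreover have "z * ?t \<in> Q" using ideal_mult'[OF IQ z(1) tP] .
      ultimately show ?thesis using ideal_minus[OF IQ] by fastforce
    qed
    then have b0: "\<beta> 0 = 0" using Bz Suc.prems(1) by blast
    then have "z * ?t \<in> P" using Suc.prems(2) s by simp
    then have "?t \<in> P" using prime_mult[OF P] z(2,3) tP PolL_Pol by blast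
    then have "\<beta> (Suc i) = 0" if "i \<le> m" for i
      using that Suc.prems(1) by (intro Suc.IH[of "\<lambda>i. \<beta> (Suc i)"]) simp_all
    then show ?case using b0 Suc.prems(3) by (cases i) simp_all
  qed
  have ind: "indep_mod P (\<lambda>(j, i). xpow j * z ^ i) (B \<times> {..m})"
  proof (rule indep_mod_powers[OF B(2,4)])
    show "\<beta> i \<in> Q" if "\<And>i. i \<le> m \<Longrightarrow> \<beta> i \<in> mp.span (xpow ` B)" "(\<Sum>i\<le>m. \<beta> i * z ^ i) \<in> P" "i \<le> m" for \<beta> i
      using key[of m \<beta> i, OF that] ideal_zero[OF IQ] by simp
  qed
  have "card (B \<times> {..m}) \<le> rank_mod P (mpow X) (MonL V (J + m * e))"
  proof (rule indep_mod_le_rank[OF ideal_subspace[OF IP] _ _ ind])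
    fix x assume "x \<in> B \<times> {..m}"
    then obtain j i where x: "x = (j, i)" "j \<in> B" "i \<le> m" by auto
    have "xpow j * z ^ i \<in> PolL V (J + i * e)"
      using x B(1) z(3) by (intro PolL_mult PolL_power) auto
    then have "xpow j * z ^ i \<in> PolL V (J + m * e)"
      by (rule PolL_mono) (use x in simp)
    then show "(case x of (j, i) \<Rightarrow> xpow j * z ^ i) \<in> mp.span (mpow X ` MonL V (J + m * e) \<union> P)"
      using PolL_span_Un x(1) by fastforce
  qed (use V B in auto)
  then show ?thesis using B(3) by (simp add: growth_def card_cartesian_product mult.commute)
qed

text \<open>At \<open>m = J\<close> the factor \<open>m + 1\<close> of \<open>growth_prime_step\<close> takes one power of \<open>J\<close> off the growth
  modulo \<open>Q\<close>.\<close>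
lemma growth_le_prime_step:
  assumes P: "primeideal P (poly_ring V)" and Q: "primeideal Q (poly_ring V)" and PQ: "P \<subset> Q"
    and V: "finite V" and s: "growth_le P X V s"
  shows "s > 0 \<and> growth_le Q X V (s - 1)"
proof -
  obtain z where z: "z \<in> Q" "z \<notin> P" using PQ by auto
  obtain e where e: "z \<in> PolL V e" using PolL_obtain ideal_Pol[OF prime_ideal[OF Q] z(1)] by blast
  obtain C where C: "\<And>J. growth P X V J \<le> C * (J + 1) ^ s" using s by (auto simp: growth_le_def)
  have *: "(J + 1) * growth Q X V J \<le> C * (e + 1) ^ s * (J + 1) ^ s" for J
  proof -
    have "(J + 1) * growth Q X V J \<le> growth P X V (J + J * e)"
      using growth_prime_step[OF P Q _ z e V] PQ by blast
    also have "\<dots> \<le> C * (J + J * e + 1) ^ s" by (rule C)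
    also have "\<dots> \<le> C * ((e + 1) * (J + 1)) ^ s"
      by (intro mult_left_mono power_mono) (auto simp: algebra_simps)
    finally show ?thesis by (simp only: power_mult_distrib mult.assoc)
  qed
  show ?thesis
  proof (cases s)
    case 0
    have "1 \<le> growth Q X V C" by (rule growth_pos[OF prime_ideal[OF Q] prime_one[OF Q] V])
    then have "(C + 1) * 1 \<le> (C + 1) * growth Q X V C" by (rule mult_left_mono) simp
    also have "\<dots> \<le> C" using *[of C] 0 by simp
    finally show ?thesis by simp
  next
    case (Suc t)
    have "growth Q X V J \<le> C * (e + 1) ^ s * (J + 1) ^ t" for J
    proof -
      have "(J + 1) * growth Q X V J \<le> (J + 1) * (C * (e + 1) ^ s * (J + 1) ^ t)"
        using *[of J] Suc by (simp only: power_Suc mult_ac)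
      then show ?thesis by (subst (asm) mult_le_cancel1) auto
    qed
    then show ?thesis using Suc by (auto simp: growth_le_def)
  qed
qed

lemma prime_chain_length_le:
  assumes "\<And>i. i \<le> l \<Longrightarrow> primeideal (C i) (poly_ring V)" "\<And>i. i < l \<Longrightarrow> C i \<subset> C (Suc i)"
    and "finite V" "growth_le (C 0) X V s"
  shows "l \<le> s"
  using assms
proof (induction l arbitrary: C s)
  case (Suc l)
  have "s > 0 \<and> growth_le (C 1) X V (s - 1)"
    using Suc.prems(1)[of 0] Suc.prems(1)[of 1] Suc.prems(2)[of 0]
    by (intro growth_le_prime_step[of "C 0"] Suc.prems(3,4)) auto
  moreover from this have "l \<le> s - 1"
    using Suc.prems by (intro Suc.IH[of "\<lambda>i. C (Suc i)"]) auto
  ultimately show ?case by linarith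
qed simp

lemma growth_le_supset:
  assumes P: "ideal P (poly_ring V)" and Q: "ideal Q (poly_ring V)" "P \<subseteq> Q" and V: "finite V"
    and s: "growth_le P X V s"
  shows "growth_le Q X V s"
proof -
  have "growth Q X V J \<le> growth P X V J" for J
  proof -
    obtain B where B: "B \<subseteq> MonL V J" "finite B" "card B = growth Q X V J" "indep_mod Q xpow B"
      using growth_basis[OF Q(1) V, of J X] unfolding mpow_X by metis
    then have "card B \<le> rank_mod P xpow (MonL V J)"
      using V indep_mod_mono[OF B(4) Q(2)]
      by (intro indep_mod_le_rank[OF ideal_subspace[OF P]]) (auto intro!: mp.span_base)
    then show ?thesis using B(3) by (simp add: growth_def mpow_X_fun)
  qed
  then show ?thesis using s order_trans unfolding growth_le_def by blast
qed

section \<open>Growth and independent sets of variables\<close>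

definition indep_vars :: "('i, 'k::field) mpol set \<Rightarrow> 'i set \<Rightarrow> bool" where
  "indep_vars I Y \<longleftrightarrow> (\<forall>g\<in>Pol Y. g \<in> I \<longrightarrow> g = 0)"

text \<open>The order compares degrees first, so that replacing a monomial by smaller ones does not leave
  the polynomials of degree at most \<open>J\<close>.\<close>
definition mlt :: "'i::linorder mon \<Rightarrow> 'i mon \<Rightarrow> bool" where
  "mlt m m' \<longleftrightarrow> mon_degree m < mon_degree m' \<or> mon_degree m = mon_degree m' \<and> m < m'"

lemma mlt_trans: "mlt a b \<Longrightarrow> mlt b c \<Longrightarrow> mlt a c"
  by (auto simp: mlt_def)

lemma mlt_irrefl: "\<not> mlt a a"
  by (auto simp: mlt_def)

lemma mlt_add: "mlt a b \<Longrightarrow> mlt (u + a) (u + b)"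
  by (auto simp: mlt_def mon_degree_add)

lemma mlt_degree: "mlt a b \<Longrightarrow> mon_degree a \<le> mon_degree b"
  by (auto simp: mlt_def)

lemma leading_monomial_exists:
  fixes g :: "('i::linorder, 'k::field) mpol"
  assumes "g \<noteq> 0"
  shows "\<exists>m\<in>Poly_Mapping.keys g. \<forall>m'\<in>Poly_Mapping.keys g. m' \<noteq> m \<longrightarrow> mlt m' m"
proof -
  let ?K = "Poly_Mapping.keys g"
  let ?D = "Max (mon_degree ` ?K)"
  let ?T = "{m\<in>?K. mon_degree m = ?D}"
  have ne: "?K \<noteq> {}" using assms by simp
  then have "?D \<in> mon_degree ` ?K" by (intro Max_in) auto
  then have T: "?T \<noteq> {}" "finite ?T" by auto
  then have M: "Max ?T \<in> ?T" by (rule Max_in[rotated])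
  show ?thesis
  proof (intro bexI[of _ "Max ?T"] ballI impI)
    fix m' assume m': "m' \<in> ?K" "m' \<noteq> Max ?T"
    have "mon_degree m' \<le> ?D" using m'(1) by (intro Max_ge) auto
    moreover have "m' < Max ?T" if "mon_degree m' = ?D"
      using Max_ge[OF T(2), of m'] m' that by (auto simp: less_le)
    ultimately show "mlt m' (Max ?T)" using M by (auto simp: mlt_def less_le)
  qed (use M in auto)
qed

text \<open>Division with remainder: if \<open>m = u + L t\<close>, the multiple of \<open>G t\<close> by the monomial \<open>u\<close> expresses
  \<open>m\<close> modulo \<open>I\<close> by smaller monomials, to which induction applies.\<close>
lemma standard_monomials_span:
  fixes I :: "('i::linorder, 'k::field) mpol set"
  assumes I: "ideal I (poly_ring V)" and V: "finite V"
    and G: "\<And>t. t \<in> T \<Longrightarrow> G t \<in> I"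
    and L: "\<And>t. t \<in> T \<Longrightarrow> L t \<in> Poly_Mapping.keys (G t)"
      "\<And>t m. t \<in> T \<Longrightarrow> m \<in> Poly_Mapping.keys (G t) \<Longrightarrow> m \<noteq> L t \<Longrightarrow> mlt m (L t)"
    and m: "m \<in> MonL V J"
  shows "xpow m \<in> mp.span (xpow ` {m\<in>MonL V J. \<forall>t\<in>T. \<forall>u. m \<noteq> u + L t} \<union> I)"
    (is "_ \<in> mp.span (xpow ` ?S \<union> I)")
  using m
proof (induction "card {m'\<in>MonL V J. mlt m' m}" arbitrary: m rule: less_induct)
  case less
  show ?case
  proof (cases "m \<in> ?S")
    case True
    then show ?thesis by (intro mp.span_base) auto
  next
    case False
    then obtain t u where t: "t \<in> T" and mu: "m = u + L t" using less.prems by auto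
    have u: "u \<in> Mon V" using less.prems mu by (auto simp: MonL_def Mon_add)
    let ?c = "lk (G t) (L t)" and ?K = "Poly_Mapping.keys (G t)"
    have c: "?c \<noteq> 0" using L(1)[OF t] by (simp add: in_keys_iff)
    have exp: "xpow u * G t = (\<Sum>k\<in>?K. cst (lk (G t) k) * xpow (u + k))"
      by (subst (2) mpol_expand)
        (simp add: sum_distrib_left mult.left_commute[of "xpow u"] mult_single[of u 1])
    have "xpow u * G t = cst ?c * xpow m + (\<Sum>k\<in>?K - {L t}. cst (lk (G t) k) * xpow (u + k))"
      unfolding exp mu using sum.remove[OF _ L(1)[OF t]] by simp
    moreover have "xpow u * G t \<in> mp.span (xpow ` ?S \<union> I)"
      using ideal_mult[OF I _ G[OF t], of "xpow u"] u by (intro mp.span_base) auto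
    moreover have "(\<Sum>k\<in>?K - {L t}. cst (lk (G t) k) * xpow (u + k)) \<in> mp.span (xpow ` ?S \<union> I)"
    proof (intro mp.span_sum mp.span_scale)
      fix k assume k: "k \<in> ?K - {L t}"
      have lt: "mlt (u + k) m" unfolding mu using L(2)[OF t] k by (intro mlt_add) auto
      have "k \<in> Mon V" using ideal_Pol[OF I G[OF t]] k by (auto simp: Pol_iff)
      then have mem: "u + k \<in> MonL V J"
        using u less.prems mlt_degree[OF lt] by (auto simp: MonL_def Mon_add)
      have "{m'\<in>MonL V J. mlt m' (u + k)} \<subset> {m'\<in>MonL V J. mlt m' m}"
        using mem lt mlt_trans mlt_irrefl by blast
      then have "card {m'\<in>MonL V J. mlt m' (u + k)} < card {m'\<in>MonL V J. mlt m' m}"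
        using V by (intro psubset_card_mono) auto
      then show "xpow (u + k) \<in> mp.span (xpow ` ?S \<union> I)" using less.hyps mem by blast
    qed
    ultimately have "cst ?c * xpow m \<in> mp.span (xpow ` ?S \<union> I)"
      using mp.span_diff by fastforce
    then have "cst (inverse ?c) * (cst ?c * xpow m) \<in> mp.span (xpow ` ?S \<union> I)"
      by (rule mp.span_scale)
    then show ?thesis using c by simp
  qed
qed

text \<open>Every set of \<open>s + 1\<close> variables supports the leading monomial of an element of \<open>I\<close>. A
  monomial divisible by none of these has at most \<open>s\<close> large exponents, so that only
  \<open>O(J\<^sup>s)\<close> of them have degree at most \<open>J\<close>.\<close>
lemma growth_le_of_dependent:
  fixes I :: "('i::linorder, 'k::field) mpol set"
  assumes I: "ideal I (poly_ring V)" and V: "finite V"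
    and dep: "\<And>Y. Y \<subseteq> V \<Longrightarrow> card Y = Suc s \<Longrightarrow> \<not> indep_vars I Y"
  shows "growth_le I X V s"
proof -
  define T where "T = {Y. Y \<subseteq> V \<and> card Y = Suc s}"
  have "\<forall>Y\<in>T. \<exists>g L. g \<in> Pol Y \<and> g \<in> I \<and> L \<in> Poly_Mapping.keys g \<and>
          (\<forall>m\<in>Poly_Mapping.keys g. m \<noteq> L \<longrightarrow> mlt m L)"
  proof
    fix Y assume "Y \<in> T"
    then obtain g where g: "g \<in> Pol Y" "g \<in> I" "g \<noteq> 0"
      using dep by (auto simp: T_def indep_vars_def)
    then show "\<exists>g L. g \<in> Pol Y \<and> g \<in> I \<and> L \<in> Poly_Mapping.keys g \<and>
          (\<forall>m\<in>Poly_Mapping.keys g. m \<noteq> L \<longrightarrow> mlt m L)"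
      using leading_monomial_exists[OF g(3)] by blast
  qed
  then obtain G L where GL: "\<And>Y. Y \<in> T \<Longrightarrow> G Y \<in> Pol Y" "\<And>Y. Y \<in> T \<Longrightarrow> G Y \<in> I"
      "\<And>Y. Y \<in> T \<Longrightarrow> L Y \<in> Poly_Mapping.keys (G Y)"
      "\<And>Y m. Y \<in> T \<Longrightarrow> m \<in> Poly_Mapping.keys (G Y) \<Longrightarrow> m \<noteq> L Y \<Longrightarrow> mlt m (L Y)"
    by metis
  have finT: "finite T" using V by (simp add: T_def)
  define D where "D = (\<Sum>Y\<in>T. mon_degree (L Y))"
  have LD: "lk (L Y) i \<le> D" if "Y \<in> T" for Y i
  proof -
    have "lk (L Y) i \<le> mon_degree (L Y)" by (rule lookup_le_mon_degree)
    also have "\<dots> \<le> D" unfolding D_def using finT that by (intro member_le_sum) auto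
    finally show ?thesis .
  qed
  define S where "S J = {m\<in>MonL V J. \<forall>Y\<in>T. \<forall>u. m \<noteq> u + L Y}" for J
  define A where "A J Z = {m\<in>Mon V. \<forall>i\<in>V. lk m i \<le> (if i \<in> Z then J else D)}" for J Z
  let ?C = "card (Pow V) * (D + 1) ^ card V"
  have A_card: "card (A J Z) \<le> (D + 1) ^ card V * (J + 1) ^ s" if "Z \<subseteq> V" "card Z \<le> s" for J Z
  proof -
    have "card (A J Z) = (\<Prod>i\<in>V. (if i \<in> Z then J else D) + 1)"
      unfolding A_def by (rule finite_bounded_monomials(2)[OF V])
    also have "\<dots> \<le> (\<Prod>i\<in>V. (D + 1) * (if i \<in> Z then J + 1 else 1))"
      by (intro prod_mono) auto
    also have "\<dots> = (D + 1) ^ card V * (\<Prod>i\<in>V. if i \<in> Z then J + 1 else 1)"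
      by (simp only: prod.distrib prod_constant)
    also have "(\<Prod>i\<in>V. if i \<in> Z then J + 1 else 1) = (J + 1) ^ card Z"
      using V that(1) by (simp add: prod.If_cases Int_absorb1)
    also have "(D + 1) ^ card V * (J + 1) ^ card Z \<le> (D + 1) ^ card V * (J + 1) ^ s"
      using that(2) by (intro mult_left_mono power_increasing) auto
    finally show ?thesis .
  qed
  have S_sub: "S J \<subseteq> (\<Union>Z\<in>{Z. Z \<subseteq> V \<and> card Z \<le> s}. A J Z)" for J
  proof
    fix m assume m: "m \<in> S J"
    \<comment> \<open>the variables with a large exponent: were there more than \<open>s\<close> of them, \<open>m\<close> would be
      divisible by a leading monomial\<close>
    let ?Z = "{i\<in>V. D < lk m i}"
    have Z: "card ?Z \<le> s"
    proof (rule ccontr)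
      assume "\<not> card ?Z \<le> s"
      then obtain Y where Y: "Y \<subseteq> ?Z" "card Y = Suc s"
        using obtain_subset_with_card_n[of "Suc s" ?Z] by auto
      then have YT: "Y \<in> T" by (auto simp: T_def)
      have "L Y \<in> Mon Y" using GL(1,3)[OF YT] by (auto simp: Pol_iff)
      then have "lk (L Y) i = 0" if "i \<notin> Y" for i
        using that by (auto simp: Mon_def subset_iff not_in_keys_iff_lookup_eq_zero)
      moreover have "lk (L Y) i \<le> lk m i" if "i \<in> Y" for i
        using LD[OF YT, of i] Y(1) that by auto
      ultimately have "lk (L Y) i \<le> lk m i" for i
        by (cases "i \<in> Y") simp_all
      then have "m = (m - L Y) + L Y" by (intro poly_mapping_eqI) (simp add: lookup_add lookup_minus)
      then show False using m YT by (auto simp: S_def)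
    qed
    have "m \<in> A J ?Z"
    proof -
      have "lk m i \<le> J" for i
        using m lookup_le_mon_degree[of m i] by (auto simp: S_def MonL_def)
      then show ?thesis using m by (auto simp: A_def S_def MonL_def)
    qed
    then show "m \<in> (\<Union>Z\<in>{Z. Z \<subseteq> V \<and> card Z \<le> s}. A J Z)"
      by (intro UN_I[of ?Z] CollectI conjI Z) auto
  qed
  have "growth I X V J \<le> ?C * (J + 1) ^ s" for J
  proof -
    have "rank_mod I (mpow X) (MonL V J) \<le> card ((xpow :: 'i mon \<Rightarrow> ('i, 'k) mpol) ` S J)"
    proof (rule rank_mod_le[OF ideal_subspace[OF I]])
      show "finite (MonL V J)" "finite ((xpow :: 'i mon \<Rightarrow> ('i, 'k) mpol) ` S J)"
        using V by (simp_all add: S_def)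
      show "mpow X m \<in> mp.span (xpow ` S J \<union> I)" if "m \<in> MonL V J" for m
        using standard_monomials_span[OF I V, of T G L, OF GL(2,3,4) that]
        unfolding S_def mpow_X .
    qed
    also have "\<dots> \<le> card (S J)"
      using V by (intro card_image_le) (simp add: S_def)
    also have "\<dots> \<le> card (\<Union>Z\<in>{Z. Z \<subseteq> V \<and> card Z \<le> s}. A J Z)"
      using V finite_bounded_monomials(1)[OF V] by (intro card_mono S_sub) (auto simp: A_def)
    also have "\<dots> \<le> (\<Sum>Z\<in>{Z. Z \<subseteq> V \<and> card Z \<le> s}. card (A J Z))"
      using V by (intro card_UN_le) auto
    also have "\<dots> \<le> (\<Sum>Z\<in>{Z. Z \<subseteq> V \<and> card Z \<le> s}. (D + 1) ^ card V * (J + 1) ^ s)"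
      using A_card by (intro sum_mono) auto
    also have "\<dots> = card {Z. Z \<subseteq> V \<and> card Z \<le> s} * ((D + 1) ^ card V * (J + 1) ^ s)"
      by simp
    also have "\<dots> \<le> card (Pow V) * ((D + 1) ^ card V * (J + 1) ^ s)"
      using V by (intro mult_right_mono card_mono) auto
    finally show ?thesis by (simp only: growth_def mult.assoc)
  qed
  then show ?thesis by (auto simp: growth_le_def)
qed

lemma growth_ge_of_indep:
  assumes I: "ideal I (poly_ring V)" and V: "finite V" and Y: "Y \<subseteq> V" "indep_vars I Y"
    and J: "card Y * q \<le> J"
  shows "(q + 1) ^ card Y \<le> growth I X V J"
proof -
  let ?B = "{m\<in>Mon Y. \<forall>i\<in>Y. lk m i \<le> q}"
  have finY: "finite Y" using Y V finite_subset by blast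
  have B: "finite ?B" "card ?B = (q + 1) ^ card Y"
    using finite_bounded_monomials[OF finY, of "\<lambda>_. q"] by simp_all
  have "indep_mod I (mpow X) ?B"
    unfolding indep_mod_def
  proof (intro allI impI ballI)
    fix c j assume c: "(\<Sum>j\<in>?B. cst (c j) * mpow X j) \<in> I" and j: "j \<in> ?B"
    have "(\<Sum>j\<in>?B. cst (c j) * mpow X j) \<in> Pol Y"
      by (intro Pol_sum Pol_mult) auto
    then have "(\<Sum>j\<in>?B. cst (c j) * mpow X j) = 0" using Y(2) c by (auto simp: indep_vars_def)
    then have "(\<Sum>i\<in>?B. c i * lk (xpow i) j) = 0"
      by (metis (no_types, lifting) lookup_cst_times lookup_sum lookup_zero mpow_X sum.cong)
    moreover have "(\<Sum>i\<in>?B. c i * lk (xpow i) j) = (\<Sum>i\<in>?B. if i = j then c i else 0)"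
      by (intro sum.cong) (auto simp: lookup_single)
    ultimately show "c j = 0" using B(1) j by (simp add: sum.delta)
  qed
  moreover have "?B \<subseteq> MonL V J"
  proof
    fix m assume m: "m \<in> ?B"
    then have "mon_degree m = (\<Sum>i\<in>Y. lk m i)"
      using finY by (intro mon_degree_superset) (auto simp: Mon_def)
    also have "\<dots> \<le> card Y * q" using m sum_bounded_above[of Y "lk m" q] by auto
    finally show "m \<in> MonL V J" using m J Mon_mono[OF Y(1)] by (auto simp: MonL_def)
  qed
  ultimately have "card ?B \<le> growth I X V J"
    unfolding growth_def using B(1) V
    by (intro indep_mod_le_rank ideal_subspace[OF I]) (auto intro!: mp.span_base)
  then show ?thesis using B(2) by simp
qed

lemma card_indep_le_growth:
  assumes I: "ideal I (poly_ring V)" and V: "finite V" and Y: "Y \<subseteq> V" "indep_vars I Y"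
    and t: "growth_le I X V t"
  shows "card Y \<le> t"
proof (rule ccontr)
  assume "\<not> card Y \<le> t"
  then have s: "card Y \<ge> Suc t" by simp
  obtain C where C: "\<And>J. growth I X V J \<le> C * (J + 1) ^ t" using t by (auto simp: growth_le_def)
  define q where "q = C * card Y ^ t"
  have "(q + 1) * (q + 1) ^ t \<le> (q + 1) ^ card Y"
    using power_increasing[OF s, of "q + 1"] by simp
  also have "\<dots> \<le> growth I X V (card Y * q)" by (rule growth_ge_of_indep[OF I V Y]) simp
  also have "\<dots> \<le> C * (card Y * q + 1) ^ t" by (rule C)
  also have "\<dots> \<le> C * (card Y * (q + 1)) ^ t"
    using s by (intro mult_left_mono power_mono) auto
  also have "\<dots> = q * (q + 1) ^ t" by (simp only: q_def power_mult_distrib mult.assoc)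
  finally show False by simp
qed

section \<open>Homogeneous components\<close>

definition hcomp :: "nat \<Rightarrow> ('i, 'k::field) mpol \<Rightarrow> ('i, 'k) mpol" where
  "hcomp j f = Poly_Mapping.mapp (\<lambda>m c. if mon_degree m = j then c else 0) f"

definition graded :: "('i, 'k::field) mpol set \<Rightarrow> bool" where
  "graded I \<longleftrightarrow> (\<forall>f\<in>I. \<forall>j. hcomp j f \<in> I)"

lemma lookup_hcomp: "lk (hcomp j f) m = (if mon_degree m = j then lk f m else 0)"
  by (auto simp: hcomp_def lookup_mapp when_def in_keys_iff)

lemma keys_hcomp: "Poly_Mapping.keys (hcomp j f) = {m\<in>Poly_Mapping.keys f. mon_degree m = j}"
  by (auto simp: in_keys_iff lookup_hcomp split: if_splits)

lemma hcomp_Pol [intro]: "f \<in> Pol V \<Longrightarrow> hcomp j f \<in> Pol V"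
  by (auto simp: Pol_iff keys_hcomp)

lemma hcomp_add: "hcomp j (f + g) = hcomp j f + hcomp j g"
  by (rule poly_mapping_eqI) (simp add: lookup_hcomp lookup_add)

lemma hcomp_zero [simp]: "hcomp j 0 = 0"
  by (rule poly_mapping_eqI) (simp add: lookup_hcomp)

lemma hcomp_sum: "hcomp j (sum f A) = (\<Sum>i\<in>A. hcomp j (f i))"
  by (induction A rule: infinite_finite_induct) (simp_all add: hcomp_add)

lemma hcomp_single: "hcomp j (Poly_Mapping.single m c) = (if mon_degree m = j then Poly_Mapping.single m c else 0)"
  by (rule poly_mapping_eqI) (simp add: lookup_hcomp lookup_single when_def)

lemma hcomp_hcomp: "hcomp i (hcomp j f) = (if i = j then hcomp j f else 0)"
  by (rule poly_mapping_eqI) (simp add: lookup_hcomp)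

lemma hcomp_decomp:
  assumes "f \<in> PolL V J"
  shows "(\<Sum>j\<le>J. hcomp j f) = f"
proof (rule poly_mapping_eqI)
  fix m
  have "mon_degree m \<le> J" if "lk f m \<noteq> 0"
    using assms that by (auto simp: PolL_def MonL_def in_keys_iff)
  then show "lk (\<Sum>j\<le>J. hcomp j f) m = lk f m"
    by (cases "lk f m = 0") (simp_all add: lookup_sum lookup_hcomp)
qed

lemma hcomp_mult: "hcomp n (f * g) = (\<Sum>i\<le>n. hcomp i f * hcomp (n - i) g)"
proof -
  let ?F = "Poly_Mapping.keys f" and ?G = "Poly_Mapping.keys g"
  let ?s = "\<lambda>m m'. Poly_Mapping.single (m + m') (lk f m * lk g m')"
  have exp: "hcomp i f = (\<Sum>m\<in>?F. if mon_degree m = i then Poly_Mapping.single m (lk f m) else 0)" for i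
    by (subst sum_terms[of f, symmetric]) (simp add: hcomp_sum hcomp_single)
  have exp': "hcomp i g = (\<Sum>m\<in>?G. if mon_degree m = i then Poly_Mapping.single m (lk g m) else 0)" for i
    by (subst sum_terms[of g, symmetric]) (simp add: hcomp_sum hcomp_single)
  have "f * g = (\<Sum>m\<in>?F. \<Sum>m'\<in>?G. ?s m m')"
    by (subst (1 2) sum_terms[symmetric]) (simp add: sum_product mult_single)
  then have "hcomp n (f * g) = (\<Sum>m\<in>?F. \<Sum>m'\<in>?G. if mon_degree m + mon_degree m' = n then ?s m m' else 0)"
    by (simp add: hcomp_sum hcomp_single mon_degree_add)
  also have "\<dots> = (\<Sum>m\<in>?F. \<Sum>m'\<in>?G. \<Sum>i\<le>n.
      if mon_degree m = i \<and> mon_degree m' = n - i then ?s m m' else 0)"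
  proof (intro sum.cong refl)
    fix m m'
    have "(\<Sum>i\<le>n. if mon_degree m = i \<and> mon_degree m' = n - i then ?s m m' else 0) =
        (\<Sum>i\<le>n. if mon_degree m = i then (if mon_degree m + mon_degree m' = n then ?s m m' else 0) else 0)"
      by (intro sum.cong) auto
    also have "\<dots> = (if mon_degree m + mon_degree m' = n then ?s m m' else 0)"
      by (auto simp: sum.delta')
    finally show "(if mon_degree m + mon_degree m' = n then ?s m m' else 0) =
      (\<Sum>i\<le>n. if mon_degree m = i \<and> mon_degree m' = n - i then ?s m m' else 0)" by simp
  qed
  also have "\<dots> = (\<Sum>m\<in>?F. \<Sum>i\<le>n. \<Sum>m'\<in>?G.
      if mon_degree m = i \<and> mon_degree m' = n - i then ?s m m' else 0)"
    by (intro sum.cong refl sum.swap)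
  also have "\<dots> = (\<Sum>i\<le>n. \<Sum>m\<in>?F. \<Sum>m'\<in>?G.
      if mon_degree m = i \<and> mon_degree m' = n - i then ?s m m' else 0)"
    by (rule sum.swap)
  also have "\<dots> = (\<Sum>i\<le>n. hcomp i f * hcomp (n - i) g)"
    unfolding exp exp' sum_product by (intro sum.cong refl) (auto simp: mult_single)
  finally show ?thesis .
qed

lemma hcomp_mult_homogeneous:
  assumes "hcomp i a = a"
  shows "hcomp n (a * h) = (if i \<le> n then a * hcomp (n - i) h else 0)"
proof -
  have a: "hcomp k a = (if k = i then a else 0)" for k
    using hcomp_hcomp[of k i a] assms by simp
  show ?thesis unfolding hcomp_mult a by (simp add: if_distrib[of "\<lambda>x. x * _"] sum.delta cong: if_cong)
qed

lemma hcomp_X: "hcomp 1 (X i) = X i"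
  by (simp add: X_def hcomp_single)

lemma homogeneous_hcomp: "homogeneous f \<Longrightarrow> hcomp j f = f \<or> hcomp j f = 0"
proof -
  assume "homogeneous f"
  then obtain e where e: "\<And>m. m \<in> Poly_Mapping.keys f \<Longrightarrow> mon_degree m = e"
    by (auto simp: homogeneous_def)
  then have "lk (hcomp j f) m = (if e = j then lk f m else 0)" for m
    by (cases "m \<in> Poly_Mapping.keys f") (auto simp: lookup_hcomp in_keys_iff)
  then show ?thesis by (cases "e = j") (auto intro!: poly_mapping_eqI)
qed

lemma graded_of_homogeneous_ideal:
  fixes P :: "('i, 'k::field) mpol set"
  assumes "homogeneous_ideal V P"
  shows "graded P"
proof -
  obtain F where F: "F \<subseteq> Pol V" "\<And>f. f \<in> F \<Longrightarrow> homogeneous f" and P: "P = genideal (poly_ring V) F"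
    using assms by (auto simp: homogeneous_ideal_def)
  interpret cring "poly_ring V" by (rule poly_ring_cring)
  have IP: "ideal P (poly_ring V)" unfolding P by (rule genideal_ideal[OF F(1)])
  let ?I = "{f\<in>Pol V. \<forall>j. hcomp j f \<in> P}"
  have "ideal ?I (poly_ring V)"
    unfolding poly_ideal_iff
  proof (intro conjI ballI)
    fix f g :: "('i, 'k) mpol" assume f: "f \<in> Pol V" and g: "g \<in> ?I"
    then show "f * g \<in> ?I"
      by (auto simp: hcomp_mult intro!: ideal_sum[OF IP] ideal_mult[OF IP])
  qed (auto simp: hcomp_add intro: ideal_zero[OF IP] ideal_add[OF IP])
  moreover have "F \<subseteq> ?I"
  proof
    fix f assume f: "f \<in> F"
    then have "f \<in> P" unfolding P using genideal_self[OF F(1)] by auto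
    then have "hcomp j f \<in> P" for j
      using homogeneous_hcomp[OF F(2)[OF f], of j] ideal_zero[OF IP] by auto
    then show "f \<in> ?I" using f F(1) by auto
  qed
  ultimately have "P \<subseteq> ?I" unfolding P by (rule genideal_minimal)
  then show ?thesis by (auto simp: graded_def)
qed

section \<open>Chains of homogeneous primes\<close>

definition adjoin :: "'i set \<Rightarrow> ('i, 'k::field) mpol set \<Rightarrow> ('i, 'k) mpol \<Rightarrow> ('i, 'k) mpol set" where
  "adjoin V Q a = {q + a * h | q h. q \<in> Q \<and> h \<in> Pol V}"

lemma adjoin_ideal:
  fixes Q :: "('i, 'k::field) mpol set"
  assumes Q: "ideal Q (poly_ring V)" and a: "a \<in> Pol V"
  shows "ideal (adjoin V Q a) (poly_ring V)"
  unfolding poly_ideal_iff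
proof (intro conjI ballI)
  show "adjoin V Q a \<subseteq> Pol V"
    using ideal_Pol[OF Q] a by (auto simp: adjoin_def)
  show "0 \<in> adjoin V Q a"
    unfolding adjoin_def using ideal_zero[OF Q] by (force intro: exI[of _ 0])
next
  fix f g assume "f \<in> adjoin V Q a" "g \<in> adjoin V Q a"
  then obtain q h q' h' where fg: "f = q + a * h" "g = q' + a * h'" "q \<in> Q" "q' \<in> Q" "h \<in> Pol V" "h' \<in> Pol V"
    unfolding adjoin_def by blast
  then have "f + g = (q + q') + a * (h + h')" by (simp add: algebra_simps)
  moreover have "q + q' \<in> Q" "h + h' \<in> Pol V" using fg ideal_add[OF Q] by auto
  ultimately show "f + g \<in> adjoin V Q a" unfolding adjoin_def by blast
next
  fix f g :: "('i, 'k) mpol" assume f: "f \<in> Pol V" and "g \<in> adjoin V Q a"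
  then obtain q h where g: "g = q + a * h" "q \<in> Q" "h \<in> Pol V" unfolding adjoin_def by blast
  then have "f * g = f * q + a * (f * h)" by (simp add: algebra_simps)
  moreover have "f * q \<in> Q" "f * h \<in> Pol V" using f g ideal_mult[OF Q] by auto
  ultimately show "f * g \<in> adjoin V Q a" unfolding adjoin_def by blast
qed

lemma adjoin_supset: "Q \<subseteq> adjoin V Q a"
proof
  fix q assume "q \<in> Q"
  then show "q \<in> adjoin V Q a" unfolding adjoin_def by (force intro: exI[of _ q] exI[of _ 0])
qed

lemma adjoin_self: "ideal Q (poly_ring V) \<Longrightarrow> a \<in> adjoin V Q a"
  unfolding adjoin_def using ideal_zero[of Q V] by (force intro: exI[of _ 0] exI[of _ 1])

lemma adjoin_graded:
  assumes Q: "ideal Q (poly_ring V)" "graded Q" and a: "a \<in> Pol V" "hcomp i a = a"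
  shows "graded (adjoin V Q a)"
  unfolding graded_def
proof (intro ballI allI)
  fix f j assume "f \<in> adjoin V Q a"
  then obtain q h where f: "f = q + a * h" "q \<in> Q" "h \<in> Pol V" unfolding adjoin_def by blast
  have "hcomp j f = hcomp j q + a * (if i \<le> j then hcomp (j - i) h else 0)"
    by (simp add: f(1) hcomp_add hcomp_mult_homogeneous[OF a(2)])
  moreover have "hcomp j q \<in> Q" using Q(2) f(2) by (auto simp: graded_def)
  moreover have "(if i \<le> j then hcomp (j - i) h else 0) \<in> Pol V" using f(3) by auto
  ultimately show "hcomp j f \<in> adjoin V Q a" unfolding adjoin_def by blast
qed

text \<open>A homogeneous ideal is prime as soon as it is prime for homogeneous elements: look at the
  lowest components of \<open>a\<close> and \<open>b\<close> that are not in \<open>Q\<close>.\<close>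
lemma graded_primeI:
  assumes Q: "ideal Q (poly_ring V)" "graded Q" "1 \<notin> Q"
    and hp: "\<And>i j a b. a \<in> Pol V \<Longrightarrow> b \<in> Pol V \<Longrightarrow> hcomp i a = a \<Longrightarrow> hcomp j b = b \<Longrightarrow> a * b \<in> Q \<Longrightarrow>
      a \<in> Q \<or> b \<in> Q"
  shows "primeideal Q (poly_ring V)"
  unfolding poly_primeideal_iff
proof (intro conjI ballI impI Q(1,3))
  fix a b assume ab: "a \<in> Pol V" "b \<in> Pol V" "a * b \<in> Q"
  show "a \<in> Q \<or> b \<in> Q"
  proof (rule ccontr)
    assume "\<not> (a \<in> Q \<or> b \<in> Q)"
    then have nQ: "a \<notin> Q" "b \<notin> Q" by auto
    have ex: "\<exists>i. hcomp i f \<notin> Q" if f: "f \<in> Pol V" "f \<notin> Q" for f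
    proof (rule ccontr)
      assume "\<nexists>i. hcomp i f \<notin> Q"
      moreover obtain J where "f \<in> PolL V J" using PolL_obtain[OF f(1)] by blast
      ultimately show False using f(2) hcomp_decomp[of f V J] ideal_sum[OF Q(1), of "{..J}" "\<lambda>j. hcomp j f"] by auto
    qed
    define i where "i = (LEAST i. hcomp i a \<notin> Q)"
    define j where "j = (LEAST j. hcomp j b \<notin> Q)"
    have i: "hcomp i a \<notin> Q" "\<And>l. l < i \<Longrightarrow> hcomp l a \<in> Q"
      unfolding i_def using LeastI_ex[OF ex[OF ab(1) nQ(1)]] not_less_Least by blast+
    have j: "hcomp j b \<notin> Q" "\<And>l. l < j \<Longrightarrow> hcomp l b \<in> Q"
      unfolding j_def using LeastI_ex[OF ex[OF ab(2) nQ(2)]] not_less_Least by blast+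
    have "hcomp (i + j) (a * b) = hcomp i a * hcomp j b +
        (\<Sum>l\<in>{..i + j} - {i}. hcomp l a * hcomp (i + j - l) b)"
      unfolding hcomp_mult by (subst sum.remove[of _ i]) auto
    moreover have "(\<Sum>l\<in>{..i + j} - {i}. hcomp l a * hcomp (i + j - l) b) \<in> Q"
    proof (rule ideal_sum[OF Q(1)])
      fix l assume l: "l \<in> {..i + j} - {i}"
      show "hcomp l a * hcomp (i + j - l) b \<in> Q"
      proof (cases "l < i")
        case True
        then show ?thesis using i(2) ab(2) by (intro ideal_mult'[OF Q(1)]) auto
      next
        case False
        then have "i + j - l < j" using l by auto
        then show ?thesis using j(2) ab(1) by (intro ideal_mult[OF Q(1)]) auto
      qed
    qed
    moreover have "hcomp (i + j) (a * b) \<in> Q" using ab(3) Q(2) by (auto simp: graded_def)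
    ultimately have "hcomp i a * hcomp j b \<in> Q" using ideal_minus[OF Q(1)] by fastforce
    then have "hcomp i a \<in> Q \<or> hcomp j b \<in> Q"
      using ab(1,2) by (intro hp) (auto simp: hcomp_hcomp)
    then show False using i(1) j(1) by blast
  qed
qed

text \<open>A homogeneous ideal \<open>Q\<close> that is maximal among those meeting the domain \<open>k[Y]\<close> only in \<open>0\<close> is
  prime: if \<open>a b \<in> Q\<close>, the product of nonzero elements of \<open>k[Y]\<close> from \<open>Q + (a)\<close> and \<open>Q + (b)\<close> would
  be a nonzero element of \<open>k[Y]\<close> in \<open>Q\<close>.\<close>
lemma graded_prime_above_exists:
  fixes I :: "(nat, 'k::field) mpol set"
  assumes I: "ideal I (poly_ring V)" "graded I" and Y: "Y \<subseteq> V" "indep_vars I Y"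
  shows "\<exists>Q. primeideal Q (poly_ring V) \<and> graded Q \<and> I \<subseteq> Q \<and> indep_vars Q Y"
proof -
  define A where "A = {Q. ideal Q (poly_ring V) \<and> graded Q \<and> I \<subseteq> Q \<and> indep_vars Q Y}"
  have "\<exists>Q\<in>A. \<forall>Q'\<in>A. Q \<subseteq> Q' \<longrightarrow> Q' = Q"
  proof (rule subset_Zorn_nonempty)
    show "A \<noteq> {}" using assms by (auto simp: A_def)
    fix \<C> assume \<C>: "\<C> \<noteq> {}" "subset.chain A \<C>"
    then have sub: "\<And>Q. Q \<in> \<C> \<Longrightarrow> Q \<in> A" and lin: "\<And>Q Q'. Q \<in> \<C> \<Longrightarrow> Q' \<in> \<C> \<Longrightarrow> Q \<subseteq> Q' \<or> Q' \<subseteq> Q"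
      by (auto simp: subset_chain_def)
    have IQ: "ideal Q (poly_ring V)" if "Q \<in> \<C>" for Q using sub[OF that] by (simp add: A_def)
    have "ideal (\<Union>\<C>) (poly_ring V)"
      unfolding poly_ideal_iff
    proof (intro conjI ballI)
      show "\<Union>\<C> \<subseteq> Pol V" using ideal_Pol[OF IQ] by blast
      show "0 \<in> \<Union>\<C>" using \<C>(1) ideal_zero[OF IQ] by blast
      fix f g assume fg: "f \<in> \<Union>\<C>" "g \<in> \<Union>\<C>"
      then obtain Q where "Q \<in> \<C>" "f \<in> Q" "g \<in> Q" using lin by (meson UnionE subset_iff)
      then show "f + g \<in> \<Union>\<C>" using ideal_add[OF IQ] by blast
    next
      fix f g :: "(nat, 'k) mpol" assume "f \<in> Pol V" "g \<in> \<Union>\<C>"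
      then show "f * g \<in> \<Union>\<C>" using ideal_mult[OF IQ] by blast
    qed
    moreover have "graded (\<Union>\<C>)" "indep_vars (\<Union>\<C>) Y" "I \<subseteq> \<Union>\<C>"
      using sub \<C>(1) unfolding A_def graded_def indep_vars_def by blast+
    ultimately show "\<Union>\<C> \<in> A" by (simp add: A_def)
  qed
  then obtain Q where Q: "ideal Q (poly_ring V)" "graded Q" "I \<subseteq> Q" "indep_vars Q Y"
    and max: "\<And>Q'. Q' \<in> A \<Longrightarrow> Q \<subseteq> Q' \<Longrightarrow> Q' = Q"
    by (auto simp: A_def)
  have meet: "\<exists>q h g. q \<in> Q \<and> h \<in> Pol V \<and> g = q + a * h \<and> g \<in> Pol Y \<and> g \<noteq> 0"
    if a: "a \<in> Pol V" "hcomp i a = a" "a \<notin> Q" for a i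
  proof -
    have "adjoin V Q a \<noteq> Q" using adjoin_self[OF Q(1)] a(3) by blast
    then have "adjoin V Q a \<notin> A" using max adjoin_supset by blast
    then have "\<not> indep_vars (adjoin V Q a) Y"
      using adjoin_ideal[OF Q(1) a(1)] adjoin_graded[OF Q(1,2) a(1,2)] adjoin_supset[of Q V a] Q(3)
      unfolding A_def by blast
    then show ?thesis unfolding indep_vars_def adjoin_def by blast
  qed
  have "primeideal Q (poly_ring V)"
  proof (rule graded_primeI[OF Q(1,2)])
    show "1 \<notin> Q" using Q(4) unfolding indep_vars_def by (metis Pol_intros(2) zero_neq_one)
    fix i j a b assume ab: "a \<in> Pol V" "b \<in> Pol V" "hcomp i a = a" "hcomp j b = b" "a * b \<in> Q"
    show "a \<in> Q \<or> b \<in> Q"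
    proof (rule ccontr)
      assume "\<not> (a \<in> Q \<or> b \<in> Q)"
      then have "a \<notin> Q" "b \<notin> Q" by auto
      obtain q h g where 1: "q \<in> Q" "h \<in> Pol V" "g = q + a * h" "g \<in> Pol Y" "g \<noteq> 0"
        using meet[OF ab(1,3) \<open>a \<notin> Q\<close>] by blast
      obtain q' h' g' where 2: "q' \<in> Q" "h' \<in> Pol V" "g' = q' + b * h'" "g' \<in> Pol Y" "g' \<noteq> 0"
        using meet[OF ab(2,4) \<open>b \<notin> Q\<close>] by blast
      have "g * g' = q * g' + ((a * h) * q' + (a * b) * (h * h'))"
        using 1(3) 2(3) by (simp add: algebra_simps)
      moreover have "q * g' \<in> Q"
        using 2(4) Pol_subset[OF Y(1)] by (intro ideal_mult'[OF Q(1) 1(1)]) blast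
      moreover have "(a * h) * q' \<in> Q" using ab(1) 1(2) by (intro ideal_mult[OF Q(1) _ 2(1)]) auto
      moreover have "(a * b) * (h * h') \<in> Q" using 1(2) 2(2) by (intro ideal_mult'[OF Q(1) ab(5)]) auto
      ultimately have "g * g' \<in> Q" by (simp only: ideal_add[OF Q(1)])
      moreover have "g * g' \<in> Pol Y" using 1(4) 2(4) by auto
      ultimately have "g * g' = 0" using Q(4) by (auto simp: indep_vars_def)
      then show False using 1(5) 2(5) by simp
    qed
  qed
  then show ?thesis using Q by blast
qed

lemma span_mult_image:
  assumes "h \<in> mp.span A"
  shows "y * h \<in> mp.span ((*) y ` A)"
proof -
  have "mp.subspace {h. y * h \<in> mp.span ((*) y ` A)}"
    unfolding mp.subspace_def
    by (auto simp: distrib_left mult.left_commute[of y] intro: mp.span_add mp.span_scale mp.span_zero)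
  moreover have "A \<subseteq> {h. y * h \<in> mp.span ((*) y ` A)}" by (auto intro: mp.span_base)
  ultimately show ?thesis using mp.span_minimal assms by blast
qed

text \<open>Truncating a representation \<open>p + y h\<close> of a polynomial of degree at most \<open>J + 1\<close> makes
  \<open>h\<close> have degree at most \<open>J\<close>.\<close>
lemma growth_adjoin_variable:
  assumes P: "ideal P (poly_ring V)" "graded P" and V: "finite V" and y: "y \<in> V"
  shows "growth P X V (Suc J) \<le> growth P X V J + growth (adjoin V P (X y)) X V (Suc J)"
proof -
  let ?y = "X y :: ('a, 'b) mpol"
  let ?I = "adjoin V P ?y"
  have I: "ideal ?I (poly_ring V)" using adjoin_ideal[OF P(1)] y by simp
  obtain B where B: "B \<subseteq> MonL V J" "finite B" "card B = growth P X V J"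
    "\<And>m. m \<in> MonL V J \<Longrightarrow> xpow m \<in> mp.span (xpow ` B \<union> P)"
    using growth_basis[OF P(1) V, of J X] unfolding mpow_X by metis
  obtain B' where B': "B' \<subseteq> MonL V (Suc J)" "finite B'" "card B' = growth ?I X V (Suc J)"
    "\<And>m. m \<in> MonL V (Suc J) \<Longrightarrow> xpow m \<in> mp.span (xpow ` B' \<union> ?I)"
    using growth_basis[OF I V, of "Suc J" X] unfolding mpow_X by metis
  let ?C = "(*) ?y ` xpow ` B \<union> xpow ` B'"
  have "growth P X V (Suc J) \<le> card ?C"
    unfolding growth_def
  proof (rule rank_mod_le[OF ideal_subspace[OF P(1)]])
    fix m assume m: "m \<in> MonL V (Suc J)"
    obtain s where s: "s \<in> mp.span (xpow ` B')" "xpow m - s \<in> ?I"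
      using span_Un_subspaceE[OF ideal_subspace[OF I] B'(4)[OF m]] by blast
    obtain c where c: "s = (\<Sum>j\<in>B'. cst (c j) * xpow j)" using span_family[OF B'(2) s(1)] by metis
    define u where "u = xpow m - s"
    have udeg: "lk u k = 0" if "k \<notin> MonL V (Suc J)" for k
    proof -
      have "lk (xpow m) k = (0::'b)" using that m by (auto simp: lookup_single when_def)
      moreover have "lk (xpow j) k = (0::'b)" if "j \<in> B'" for j
        using that B'(1) \<open>k \<notin> MonL V (Suc J)\<close> by (auto simp: lookup_single when_def)
      ultimately show ?thesis by (simp add: u_def c lookup_minus lookup_sum)
    qed
    then have uL: "u \<in> PolL V (Suc J)" by (auto simp: PolL_def in_keys_iff)
    obtain p h where ph: "u = p + ?y * h" "p \<in> P" "h \<in> Pol V"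
      using s(2) unfolding u_def[symmetric] adjoin_def by blast
    let ?h = "\<Sum>j\<le>J. hcomp j h"
    have "u = (\<Sum>j\<le>Suc J. hcomp j p) + (\<Sum>j\<le>Suc J. hcomp j (?y * h))"
      using hcomp_decomp[OF uL] ph(1) by (simp add: hcomp_add sum.distrib)
    also have "(\<Sum>j\<le>Suc J. hcomp j (?y * h)) = ?y * ?h"
      by (subst sum.atMost_Suc_shift) (simp add: hcomp_mult_homogeneous[OF hcomp_X] sum_distrib_left)
    finally have u2: "u = (\<Sum>j\<le>Suc J. hcomp j p) + ?y * ?h" .
    have "(\<Sum>j\<le>Suc J. hcomp j p) \<in> P"
      using P(2) ph(2) by (intro ideal_sum[OF P(1)]) (auto simp: graded_def)
    then have 1: "(\<Sum>j\<le>Suc J. hcomp j p) \<in> mp.span (?C \<union> P)" by (intro mp.span_base) blast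
    have "?h \<in> PolL V J"
    proof -
      have "lk ?h k = 0" if "k \<notin> MonL V J" for k
        using that ph(3) by (auto simp: lookup_sum lookup_hcomp MonL_def Pol_iff in_keys_iff intro!: sum.neutral)
      then show ?thesis by (auto simp: PolL_def in_keys_iff)
    qed
    then have "?h \<in> mp.span (xpow ` MonL V J)" by (rule PolL_span)
    moreover have "mp.span (xpow ` MonL V J) \<subseteq> mp.span (xpow ` B \<union> P)"
      using B(4) by (intro mp.span_minimal mp.subspace_span) auto
    ultimately have "?y * ?h \<in> mp.span ((*) ?y ` (xpow ` B \<union> P))" by (intro span_mult_image) blast
    moreover have "(*) ?y ` (xpow ` B \<union> P) \<subseteq> ?C \<union> P"
      using ideal_mult[OF P(1), of ?y] y by auto
    ultimately have 2: "?y * ?h \<in> mp.span (?C \<union> P)" using mp.span_mono by blast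
    have 3: "s \<in> mp.span (?C \<union> P)"
      using s(1) mp.span_mono[of "xpow ` B'" "?C \<union> P"] by blast
    have "xpow m = u + s" by (simp add: u_def)
    then show "mpow X m \<in> mp.span (?C \<union> P)"
      using 1 2 3 u2 by (simp add: mp.span_add)
  qed (use V B(2) B'(2) in auto)
  also have "\<dots> \<le> card ((*) ?y ` (xpow :: 'a mon \<Rightarrow> ('a, 'b) mpol) ` B) + card ((xpow :: 'a mon \<Rightarrow> ('a, 'b) mpol) ` B')"
    by (rule card_Un_le)
  also have "\<dots> \<le> card B + card B'"
    using B(2) B'(2) by (intro add_mono) (auto simp: image_image intro!: card_image_le)
  finally show ?thesis using B(3) B'(3) by simp
qed

lemma growth_le_of_adjoin:
  assumes P: "ideal P (poly_ring V)" "graded P" and V: "finite V" and y: "y \<in> V"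
    and t: "growth_le (adjoin V P (X y)) X V t"
  shows "growth_le P X V (Suc t)"
proof -
  obtain C where C: "\<And>J. growth (adjoin V P (X y)) X V J \<le> C * (J + 1) ^ t"
    using t by (auto simp: growth_le_def)
  let ?K = "growth P X V 0 + C"
  have "growth P X V J \<le> ?K * (J + 1) ^ Suc t" for J
  proof (induction J)
    case (Suc J)
    have "growth P X V (Suc J) \<le> growth P X V J + growth (adjoin V P (X y)) X V (Suc J)"
      by (rule growth_adjoin_variable[OF P V y])
    also have "\<dots> \<le> ?K * (J + 1) ^ Suc t + C * (Suc J + 1) ^ t"
      by (intro add_mono Suc.IH C)
    also have "\<dots> \<le> ?K * ((J + 1) * (Suc J + 1) ^ t) + ?K * (Suc J + 1) ^ t"
      unfolding power_Suc by (intro add_mono mult_left_mono power_mono mult_right_mono) auto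
    also have "\<dots> = ?K * (Suc J + 1) ^ Suc t" by (simp add: algebra_simps)
    finally show ?case .
  qed simp
  then show ?thesis by (auto simp: growth_le_def)
qed

text \<open>Dividing out one variable \<open>y\<close> of \<open>Y\<close> lowers the growth by at most one power, so that by
  \<open>growth_le_of_dependent\<close> some set with one variable less is still independent; a prime above
  \<open>P + (y)\<close> that keeps it independent is the next member of the chain.\<close>
lemma graded_prime_chain_exists:
  fixes P :: "(nat, 'k::field) mpol set"
  assumes "primeideal P (poly_ring V)" "graded P" "finite V" "Y \<subseteq> V" "indep_vars P Y"
  shows "\<exists>C. C 0 = P \<and> (\<forall>i\<le>card Y. primeideal (C i) (poly_ring V)) \<and> (\<forall>i<card Y. C i \<subset> C (Suc i))"
  using assms
proof (induction "card Y" arbitrary: P Y)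
  case 0
  then show ?case by (intro exI[of _ "\<lambda>_. P"]) auto
next
  case (Suc t)
  note P = prime_ideal[OF Suc.prems(1)]
  obtain y where y: "y \<in> Y" using Suc.hyps(2) by fastforce
  then have yV: "y \<in> V" using Suc.prems(4) by auto
  have yP: "X y \<notin> P"
    using Suc.prems(5) y unfolding indep_vars_def by (metis X_def X_in_Pol lookup_single_eq lookup_zero zero_neq_one)
  let ?I = "adjoin V P (X y)"
  have I: "ideal ?I (poly_ring V)" "graded ?I"
    using adjoin_ideal[OF P] adjoin_graded[OF P Suc.prems(2) _ hcomp_X] yV by simp_all
  have "\<exists>Y'\<subseteq>V. card Y' = t \<and> indep_vars ?I Y'"
  proof (cases t)
    case 0
    have "indep_vars ?I {}"
      unfolding indep_vars_def
    proof (intro ballI impI)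
      fix g assume g: "g \<in> Pol {}" "g \<in> ?I"
      then obtain p h where ph: "g = p + X y * h" "p \<in> P" unfolding adjoin_def by blast
      have "hcomp 0 g = hcomp 0 p"
        by (simp add: ph(1) hcomp_add hcomp_mult_homogeneous[OF hcomp_X])
      moreover have "hcomp 0 p \<in> P" using ph(2) Suc.prems(2) by (auto simp: graded_def)
      moreover have "hcomp 0 g = g"
        using g(1) by (intro poly_mapping_eqI) (auto simp: lookup_hcomp Pol_iff Mon_def mon_degree_eq_0 in_keys_iff)
      ultimately have "g \<in> P" by simp
      then show "g = 0" using g(1) Suc.prems(5) Pol_subset[of "{}" Y] by (auto simp: indep_vars_def)
    qed
    then show ?thesis using 0 by (intro exI[of _ "{}"]) auto
  next
    case (Suc u)
    show ?thesis
    proof (rule ccontr)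
      assume "\<not> ?thesis"
      then have "growth_le ?I X V u"
        using Suc by (intro growth_le_of_dependent[OF I(1) Suc.prems(3)]) auto
      then have "growth_le P X V t"
        using growth_le_of_adjoin[OF P Suc.prems(2,3) yV] Suc by simp
      then have "card Y \<le> t" by (rule card_indep_le_growth[OF P Suc.prems(3-5)])
      then show False using Suc.hyps(2) by simp
    qed
  qed
  then obtain Y' where Y': "Y' \<subseteq> V" "card Y' = t" "indep_vars ?I Y'" by blast
  obtain Q where Q: "primeideal Q (poly_ring V)" "graded Q" "?I \<subseteq> Q" "indep_vars Q Y'"
    using graded_prime_above_exists[OF I Y'(1,3)] by blast
  obtain C where C: "C 0 = Q" "\<And>i. i \<le> t \<Longrightarrow> primeideal (C i) (poly_ring V)" "\<And>i. i < t \<Longrightarrow> C i \<subset> C (Suc i)"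
    using Suc.hyps(1)[of Y' Q] Y' Q Suc.prems(3) by auto
  have PQ: "P \<subset> Q" using adjoin_supset[of P V "X y"] adjoin_self[OF P, of "X y"] Q(3) yP by blast
  show ?case
  proof (intro exI[of _ "\<lambda>i. case i of 0 \<Rightarrow> P | Suc j \<Rightarrow> C j"] conjI allI impI)
    show "primeideal (case i of 0 \<Rightarrow> P | Suc j \<Rightarrow> C j) (poly_ring V)" if "i \<le> card Y" for i
      using that C(2) Suc.prems(1) Suc.hyps(2) by (cases i) auto
    show "(case i of 0 \<Rightarrow> P | Suc j \<Rightarrow> C j) \<subset> (case Suc i of 0 \<Rightarrow> P | Suc j \<Rightarrow> C j)" if "i < card Y" for i
      using that C(1,3) PQ Suc.hyps(2) by (cases i) auto
  qed simp
qed

text \<open>For a homogeneous prime \<open>P\<close> this is the Krull dimension of the quotient by \<open>P\<close>, and for every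
  prime it is the exact exponent of the growth.\<close>
definition vdim :: "'i set \<Rightarrow> ('i, 'k::field) mpol set \<Rightarrow> nat" where
  "vdim V P = Max (card ` {Y. Y \<subseteq> V \<and> indep_vars P Y})"

context
  fixes P :: "(nat, 'k::field) mpol set" and V :: "nat set"
  assumes P: "primeideal P (poly_ring V)" and V: "finite V"
begin

lemma vdim_obtain: obtains Y where "Y \<subseteq> V" "indep_vars P Y" "card Y = vdim V P"
proof -
  let ?A = "{Y. Y \<subseteq> V \<and> indep_vars P Y}"
  have "indep_vars P {}"
    unfolding indep_vars_def
  proof (intro ballI impI, rule ccontr)
    fix g assume g: "g \<in> Pol {}" "g \<in> P" "g \<noteq> 0"
    have g0: "g = cst (lk g 0)"
      using g(1) by (intro poly_mapping_eqI) (auto simp: cst_def lookup_single when_def Pol_iff Mon_def in_keys_iff)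
    then have "cst (inverse (lk g 0)) * cst (lk g 0) \<in> P"
      using ideal_mult[OF prime_ideal[OF P] Pol_intros(3) g(2)] by metis
    moreover have "lk g 0 \<noteq> 0" using g0 g(3) by (metis cst_simps(1))
    ultimately show False using prime_one[OF P] by (simp add: cst_mult[symmetric])
  qed
  then have "vdim V P \<in> card ` ?A" unfolding vdim_def using V by (intro Max_in) auto
  then show ?thesis using that by auto
qed

lemma growth_le_vdim: "growth_le P X V (vdim V P)"
proof (rule growth_le_of_dependent[OF prime_ideal[OF P] V])
  fix Y assume Y: "Y \<subseteq> V" "card Y = Suc (vdim V P)"
  show "\<not> indep_vars P Y"
  proof
    assume "indep_vars P Y"
    then have "card Y \<le> vdim V P" unfolding vdim_def using V Y(1) by (intro Max_ge) auto
    then show False using Y(2) by simp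
  qed
qed

lemma vdim_le_growth: "growth_le P X V t \<Longrightarrow> vdim V P \<le> t"
  using vdim_obtain card_indep_le_growth[OF prime_ideal[OF P] V] by metis

end

section \<open>Algebraic and transcendental elements\<close>

text \<open>A filtration of the subalgebra generated by \<open>g\<close>.\<close>
definition alg_upto :: "('j \<Rightarrow> ('i, 'k::field) mpol) \<Rightarrow> 'j set \<Rightarrow> nat \<Rightarrow> ('i, 'k) mpol set" where
  "alg_upto g W J = mp.span (mpow g ` MonL W J)"

lemma mpow_reindex:
  assumes "\<And>i. i \<in> W \<Longrightarrow> g i = h (\<phi> i)" "\<phi> ` W \<subseteq> W'" "m \<in> MonL W J"
  shows "mpow g m \<in> mpow h ` MonL W' J"
proof -
  let ?K = "Poly_Mapping.keys m"
  let ?m = "\<Sum>i\<in>?K. Poly_Mapping.single (\<phi> i) (lk m i)"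
  have K: "?K \<subseteq> W" using assms(3) by (auto simp: MonL_def Mon_def)
  have "mpow h (\<Sum>i\<in>A. Poly_Mapping.single (\<phi> i) (lk m i)) = (\<Prod>i\<in>A. h (\<phi> i) ^ lk m i)" if "finite A" for A
    using that by (induction A rule: finite_induct) (simp_all add: mpow_add)
  then have "mpow h ?m = (\<Prod>i\<in>?K. h (\<phi> i) ^ lk m i)" by simp
  also have "\<dots> = mpow g m" unfolding mpow_def using K assms(1) by (intro prod.cong) auto
  finally have 1: "mpow g m = mpow h ?m" by simp
  have "(\<Sum>i\<in>A. Poly_Mapping.single (\<phi> i) (lk m i)) \<in> Mon W' \<and>
      mon_degree (\<Sum>i\<in>A. Poly_Mapping.single (\<phi> i) (lk m i)) = (\<Sum>i\<in>A. lk m i)" if "finite A" "A \<subseteq> W" for A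
    using that
  proof (induction A rule: finite_induct)
    case (insert x A)
    have "Poly_Mapping.single (\<phi> x) (lk m x) \<in> Mon W'"
      using insert.prems assms(2) by (auto simp: Mon_def)
    then show ?case using insert by (simp add: Mon_add mon_degree_add)
  qed simp
  from this[of ?K] have "?m \<in> MonL W' J"
    using K assms(3) by (simp add: MonL_def mon_degree_def)
  then show ?thesis using 1 by blast
qed

lemma growth_reindex_le:
  assumes P: "ideal P (poly_ring V)" and W: "finite W" "finite W'"
    and "\<And>i. i \<in> W \<Longrightarrow> g i = h (\<phi> i)" "\<phi> ` W \<subseteq> W'"
  shows "growth P g W J \<le> growth P h W' J"
  unfolding growth_def
proof (rule rank_mod_mono[OF ideal_subspace[OF P]])
  show "mpow g m \<in> mp.span (mpow h ` MonL W' J \<union> P)" if "m \<in> MonL W J" for m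
    using mpow_reindex[of W g h \<phi> W' m J] assms(4,5) that by (intro mp.span_base) auto
qed (use W in auto)

lemma alg_upto_reindex:
  assumes "\<And>i. i \<in> W \<Longrightarrow> g i = h (\<phi> i)" "\<phi> ` W \<subseteq> W'"
  shows "alg_upto g W J \<subseteq> alg_upto h W' J"
  unfolding alg_upto_def using mpow_reindex[of W g h \<phi> W', OF assms] by (intro mp.span_mono) blast

lemma alg_upto_base: "m \<in> MonL W J \<Longrightarrow> mpow g m \<in> alg_upto g W J"
  unfolding alg_upto_def by (intro mp.span_base) auto

lemma alg_upto_one: "1 \<in> alg_upto g W J"
  using alg_upto_base[of 0 W J g] by (simp add: MonL_def)

lemma alg_upto_zero: "0 \<in> alg_upto g W J"
  and alg_upto_diff: "x \<in> alg_upto g W J \<Longrightarrow> y \<in> alg_upto g W J \<Longrightarrow> x - y \<in> alg_upto g W J"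
  unfolding alg_upto_def by (auto intro: mp.span_zero mp.span_diff)

lemma alg_upto_mult:
  assumes "a \<in> alg_upto g W I" "b \<in> alg_upto g W J"
  shows "a * b \<in> alg_upto g W (I + J)"
proof -
  let ?S = "{a. a * b \<in> alg_upto g W (I + J)}"
  have "mp.subspace ?S"
    unfolding mp.subspace_def alg_upto_def
    by (auto simp: distrib_right mult.assoc intro: mp.span_add mp.span_scale mp.span_zero)
  moreover have "mpow g m * b \<in> alg_upto g W (I + J)" if m: "m \<in> MonL W I" for m
  proof -
    have "mpow g m * b \<in> mp.span ((*) (mpow g m) ` mpow g ` MonL W J)"
      using assms(2) unfolding alg_upto_def by (rule span_mult_image)
    moreover have "(*) (mpow g m) ` mpow g ` MonL W J \<subseteq> mpow g ` MonL W (I + J)"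
      using MonL_add[OF m] by (auto simp: mpow_add[symmetric])
    ultimately show ?thesis unfolding alg_upto_def using mp.span_mono by blast
  qed
  then have "mpow g ` MonL W I \<subseteq> ?S" by auto
  ultimately have "mp.span (mpow g ` MonL W I) \<subseteq> ?S" by (rule mp.span_minimal[rotated])
  then show ?thesis using assms(1) by (auto simp: alg_upto_def)
qed

lemma alg_upto_power: "a \<in> alg_upto g W I \<Longrightarrow> a ^ i \<in> alg_upto g W (I * i)"
  by (induction i) (auto simp: alg_upto_one dest: alg_upto_mult)

lemma alg_upto_Pol:
  assumes "\<And>i. i \<in> W \<Longrightarrow> g i \<in> Pol V" "a \<in> alg_upto g W J"
  shows "a \<in> Pol V"
proof -
  have "mp.subspace (Pol V)" unfolding mp.subspace_def by auto
  moreover have "mpow g ` MonL W J \<subseteq> Pol V"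
    using mpow_Pol[of W g V] assms(1) by (auto simp: MonL_def)
  ultimately show ?thesis using assms(2) mp.span_minimal unfolding alg_upto_def by blast
qed

text \<open>Equations are read modulo \<open>P\<close>: all coefficients of a relation that holds modulo \<open>P\<close> have to
  lie in \<open>P\<close>.\<close>
definition transcendental :: "('i, 'k::field) mpol set \<Rightarrow> ('j \<Rightarrow> ('i, 'k) mpol) \<Rightarrow> 'j set \<Rightarrow> ('i, 'k) mpol \<Rightarrow> bool" where
  "transcendental P g W z \<longleftrightarrow> (\<forall>J m \<beta>. (\<forall>i\<le>m. \<beta> i \<in> alg_upto g W J) \<longrightarrow>
     (\<Sum>i\<le>m. \<beta> i * z ^ i) \<in> P \<longrightarrow> (\<forall>i\<le>m. \<beta> i \<in> P))"

lemma mpow_PolL: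
  assumes "\<And>i. i \<in> W \<Longrightarrow> g i \<in> PolL V d" "m \<in> Mon W"
  shows "mpow g m \<in> PolL V (mon_degree m * d)"
proof -
  have "(\<Prod>i\<in>A. g i ^ lk m i) \<in> PolL V ((\<Sum>i\<in>A. lk m i) * d)" if "finite A" "A \<subseteq> W" for A
    using that
  proof (induction A rule: finite_induct)
    case (insert x A)
    then show ?case using PolL_mult[OF PolL_power[OF assms(1)[of x]]] by (simp add: distrib_right)
  qed (simp add: PolL_one)
  from this[of "Poly_Mapping.keys m"] assms(2) show ?thesis
    by (simp add: mpow_def mon_degree_def Mon_def)
qed

text \<open>The powers of a transcendental variable times a basis of the products of the \<open>g i\<close> are
  independent.\<close>
lemma growth_transcendental:
  assumes P: "ideal P (poly_ring V)" and V: "finite V" and W: "finite W"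
    and g: "\<And>i. i \<in> W \<Longrightarrow> g i \<in> PolL V d" and v: "v \<in> V" and tr: "transcendental P g W (X v)"
  shows "(m + 1) * growth P g W J \<le> growth P X V (J * d + m)"
proof -
  obtain B where B: "B \<subseteq> MonL W J" "finite B" "card B = growth P g W J" "indep_mod P (mpow g) B"
    using growth_basis[OF P W] by metis
  have "indep_mod P (\<lambda>(j, i). mpow g j * X v ^ i) (B \<times> {..m})"
  proof (rule indep_mod_powers[OF B(2,4)])
    fix \<beta> i assume \<beta>: "\<And>i. i \<le> m \<Longrightarrow> \<beta> i \<in> mp.span (mpow g ` B)" "(\<Sum>i\<le>m. \<beta> i * X v ^ i) \<in> P" "i \<le> m"
    have "mp.span (mpow g ` B) \<subseteq> alg_upto g W J"
      unfolding alg_upto_def using B(1) by (intro mp.span_mono) auto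
    then show "\<beta> i \<in> P" using tr \<beta> unfolding transcendental_def by blast
  qed
  then have "card (B \<times> {..m}) \<le> rank_mod P (mpow X) (MonL V (J * d + m))"
  proof (rule indep_mod_le_rank[OF ideal_subspace[OF P], rotated 2])
    fix x assume "x \<in> B \<times> {..m}"
    then obtain j i where x: "x = (j, i)" "j \<in> B" "i \<le> m" by auto
    have X1: "X v \<in> PolL V 1" using v by (simp add: X_def MonL_def Mon_def)
    have j: "j \<in> Mon W" "mon_degree j \<le> J" using x B(1) by (auto simp: MonL_def)
    have "mpow g j * X v ^ i \<in> PolL V (mon_degree j * d + i * 1)"
      using mpow_PolL[OF g j(1)] PolL_power[OF X1] by (intro PolL_mult) auto
    then have "mpow g j * X v ^ i \<in> PolL V (J * d + m)"
      by (rule PolL_mono) (use x(3) j(2) in \<open>auto intro!: add_mono mult_right_mono\<close>)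
    then show "(case x of (j, i) \<Rightarrow> mpow g j * X v ^ i) \<in> mp.span (mpow X ` MonL V (J * d + m) \<union> P)"
      using PolL_span_Un x(1) by fastforce
  qed (use V B in auto)
  then show ?thesis using B(3) by (simp add: growth_def card_cartesian_product mult.commute)
qed

text \<open>An algebraic element \<open>z = g w\<close> with leading coefficient \<open>c\<close> of degree at most \<open>e\<close>: multiplied by
  \<open>c\<close> to the power \<open>J\<close>, every power of \<open>z\<close> up to \<open>J\<close> is a combination of the powers below \<open>m\<close>
  with coefficients of degree linear in \<open>J\<close>.\<close>
lemma growth_algebraic:
  assumes P: "primeideal P (poly_ring V)" and W: "finite W" "w \<notin> W"
    and g: "\<And>i. i \<in> insert w W \<Longrightarrow> g i \<in> Pol V" and alg: "\<not> transcendental P g W (g w)"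
  shows "\<exists>m e. \<forall>J. growth P g (insert w W) J \<le> m * growth P g W ((e + 1) * J)"
proof -
  note IP = prime_ideal[OF P]
  let ?z = "g w" and ?A = "alg_upto g W"
  have gW: "g i \<in> Pol V" if "i \<in> W" for i using g that by blast
  have zP: "?z \<in> Pol V" using g by blast
  obtain e m0 \<beta> i0 where \<beta>0: "\<And>i. i \<le> m0 \<Longrightarrow> \<beta> i \<in> ?A e" "(\<Sum>i\<le>m0. \<beta> i * ?z ^ i) \<in> P" "i0 \<le> m0" "\<beta> i0 \<notin> P"
    using alg unfolding transcendental_def by blast
  define m where "m = Max {i. i \<le> m0 \<and> \<beta> i \<notin> P}"
  have "m \<in> {i. i \<le> m0 \<and> \<beta> i \<notin> P}" unfolding m_def using \<beta>0(3,4) by (intro Max_in) auto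
  then have m: "m \<le> m0" "\<beta> m \<notin> P" by auto
  have mmax: "\<beta> i \<in> P" if "m < i" "i \<le> m0" for i
  proof (rule ccontr)
    assume "\<beta> i \<notin> P"
    then have "i \<le> m" unfolding m_def using that by (intro Max_ge) auto
    then show False using that by simp
  qed
  have "{..m0} = {..m} \<union> {m<..m0}" using m(1) by auto
  then have "(\<Sum>i\<le>m0. \<beta> i * ?z ^ i) = (\<Sum>i\<le>m. \<beta> i * ?z ^ i) + (\<Sum>i\<in>{m<..m0}. \<beta> i * ?z ^ i)"
    by (simp only:) (rule sum.union_disjoint, auto)
  moreover have "(\<Sum>i\<in>{m<..m0}. \<beta> i * ?z ^ i) \<in> P"
    using mmax zP by (intro ideal_sum[OF IP] ideal_mult'[OF IP]) auto
  ultimately have r: "(\<Sum>i\<le>m. \<beta> i * ?z ^ i) \<in> P" (is "?r \<in> P")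
    using \<beta>0(2) ideal_minus[OF IP] by fastforce
  have "m \<noteq> 0" using r m(2) by (cases m) auto
  then obtain m' where m': "m = Suc m'" by (cases m) auto
  define c where "c = \<beta> m"
  have \<beta>A: "\<beta> i \<in> ?A e" if "i \<le> m" for i using \<beta>0(1) that m(1) by simp
  have cA: "c \<in> ?A e" unfolding c_def using \<beta>A by simp
  have cP: "c \<notin> P" "c \<in> Pol V" using m(2) alg_upto_Pol[OF gW cA] by (auto simp: c_def)
  \<comment> \<open>combinations of the powers below \<open>m\<close>; by the relation, multiplication by \<open>c z\<close> costs only
    \<open>e\<close> in the degree of the coefficients\<close>
  define T where "T N = {(\<Sum>l<m. b l * ?z ^ l) + p | b p. (\<forall>l<m. b l \<in> ?A N) \<and> p \<in> P}" for N
  have T_mult: "a * x \<in> T (N + M)" if "a \<in> ?A N" "x \<in> T M" for a x N M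
  proof -
    obtain b p where x: "x = (\<Sum>l<m. b l * ?z ^ l) + p" "\<forall>l<m. b l \<in> ?A M" "p \<in> P"
      using \<open>x \<in> T M\<close> unfolding T_def by blast
    have "a * x = (\<Sum>l<m. (a * b l) * ?z ^ l) + a * p"
      by (simp add: x(1) distrib_left sum_distrib_left mult.assoc)
    moreover have "\<forall>l<m. a * b l \<in> ?A (N + M)" using x(2) alg_upto_mult[OF that(1)] by blast
    moreover have "a * p \<in> P" using ideal_mult[OF IP alg_upto_Pol[OF gW that(1)] x(3)] .
    ultimately show ?thesis unfolding T_def by (intro CollectI exI conjI)
  qed
  have T_z: "c * ?z * x \<in> T (N + e)" if "x \<in> T N" for x N
  proof -
    obtain b p where x: "x = (\<Sum>l<m. b l * ?z ^ l) + p" "\<forall>l<m. b l \<in> ?A N" "p \<in> P"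
      using \<open>x \<in> T N\<close> unfolding T_def by blast
    let ?b = "\<lambda>l. (if l = 0 then 0 else c * b (l - 1)) - b m' * \<beta> l"
    let ?p = "c * ?z * p + b m' * ?r"
    have s1: "(\<Sum>l<m. (if l = 0 then 0 else c * b (l - 1)) * ?z ^ l) = (\<Sum>l<m'. c * b l * ?z ^ Suc l)"
      unfolding m' by (subst sum.lessThan_Suc_shift) simp
    have s2: "?r = (\<Sum>l<m. \<beta> l * ?z ^ l) + c * ?z ^ m"
      by (simp add: lessThan_Suc_atMost[symmetric] c_def)
    have "(\<Sum>l<m. ?b l * ?z ^ l) = (\<Sum>l<m'. c * b l * ?z ^ Suc l) - b m' * (\<Sum>l<m. \<beta> l * ?z ^ l)"
      by (simp only: left_diff_distrib sum_subtractf s1 sum_distrib_left mult.assoc)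
    then have "(\<Sum>l<m. ?b l * ?z ^ l) + ?p = (\<Sum>l<m'. c * b l * ?z ^ Suc l) + b m' * (c * ?z ^ m) + c * ?z * p"
      by (simp add: s2 algebra_simps)
    also have "\<dots> = c * ?z * x"
      by (simp add: x(1) m' algebra_simps sum_distrib_left)
    finally have "c * ?z * x = (\<Sum>l<m. ?b l * ?z ^ l) + ?p" by simp
    moreover have "\<forall>l<m. ?b l \<in> ?A (N + e)"
    proof (intro allI impI)
      fix l assume l: "l < m"
      have "c * b (l - 1) \<in> ?A (N + e)"
        using alg_upto_mult[OF cA, of "b (l - 1)" N] x(2) l by (simp add: add.commute)
      moreover have "b m' * \<beta> l \<in> ?A (N + e)"
        using x(2) m' \<beta>A[of l] l by (intro alg_upto_mult) auto
      ultimately show "?b l \<in> ?A (N + e)" by (intro alg_upto_diff) (auto simp: alg_upto_zero)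
    qed
    moreover have "?p \<in> P"
    proof (rule ideal_add[OF IP])
      show "c * ?z * p \<in> P" using cP(2) zP x(3) by (intro ideal_mult[OF IP]) auto
      show "b m' * ?r \<in> P"
        using x(2) m' r by (intro ideal_mult[OF IP] alg_upto_Pol[of W g V "b m'" N] gW) auto
    qed
    ultimately show ?thesis unfolding T_def by (intro CollectI exI conjI)
  qed
  have T_pow: "c ^ i * ?z ^ i \<in> T (e * i)" for i
  proof (induction i)
    case 0
    let ?b = "\<lambda>l::nat. if l = 0 then 1 else 0 :: ('a, 'b) mpol"
    have "1 = (\<Sum>l<m. ?b l * ?z ^ l) + 0"
      unfolding m' by (subst sum.lessThan_Suc_shift) simp
    moreover have "\<forall>l<m. ?b l \<in> ?A (e * 0)" by (auto simp: alg_upto_one alg_upto_zero)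
    ultimately have "1 \<in> T (e * 0)" unfolding T_def using ideal_zero[OF IP] by (intro CollectI exI conjI)
    then show ?case by simp
  next
    case (Suc i)
    have *: "c ^ Suc i * ?z ^ Suc i = c * ?z * (c ^ i * ?z ^ i)" by (simp add: mult_ac)
    show ?case unfolding * using T_z[OF Suc] by (simp only: mult_Suc_right add.commute[of e])
  qed
  have T_mono_elem: "c ^ J * mpow g M \<in> T ((e + 1) * J)" if M: "M \<in> MonL (insert w W) J" for M J
  proof -
    let ?i = "lk M w"
    define u where "u = M - Poly_Mapping.single w ?i"
    have Mu: "M = u + Poly_Mapping.single w ?i"
      by (intro poly_mapping_eqI) (auto simp: u_def lookup_add lookup_minus lookup_single when_def)
    have iJ: "?i \<le> J" using M lookup_le_mon_degree[of M w] by (auto simp: MonL_def)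
    have "lk u w = 0" by (simp add: u_def lookup_minus)
    then have "u \<in> Mon W"
      using M Mu by (auto simp: MonL_def Mon_def keys_add_nat) (metis Mu in_keys_iff insertE subsetD keys_add_nat UnI1)
    moreover have "mon_degree u \<le> J" using M by (subst (asm) Mu) (simp add: MonL_def mon_degree_add)
    ultimately have u: "u \<in> MonL W J" by (simp add: MonL_def)
    have "c ^ J * mpow g M = (c ^ (J - ?i) * mpow g u) * (c ^ ?i * ?z ^ ?i)"
    proof -
      have "c ^ J = c ^ (J - ?i) * c ^ ?i" using iJ by (simp add: power_add[symmetric])
      moreover have "mpow g M = mpow g u * ?z ^ ?i" by (subst Mu) (simp add: mpow_add)
      ultimately show ?thesis by (simp add: mult_ac)
    qed
    moreover have "c ^ (J - ?i) * mpow g u \<in> ?A (e * (J - ?i) + J)"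
      by (intro alg_upto_mult alg_upto_power cA alg_upto_base u)
    ultimately have "c ^ J * mpow g M \<in> T ((e * (J - ?i) + J) + e * ?i)"
      using T_mult T_pow by simp
    moreover have "(e * (J - ?i) + J) + e * ?i = (e + 1) * J"
    proof -
      have "e * (J - ?i) + e * ?i = e * J" using iJ by (simp add: distrib_left[symmetric])
      then show ?thesis by simp
    qed
    ultimately show ?thesis by simp
  qed
  have "growth P g (insert w W) J \<le> m * growth P g W ((e + 1) * J)" for J
  proof -
    let ?N = "(e + 1) * J"
    obtain B where B: "B \<subseteq> MonL (insert w W) J" "finite B" "card B = growth P g (insert w W) J" "indep_mod P (mpow g) B"
      using growth_basis[OF IP finite.insertI[OF W(1)], of w J g] by metis
    obtain B' where B': "finite B'" "card B' = growth P g W ?N"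
      "\<And>M. M \<in> MonL W ?N \<Longrightarrow> mpow g M \<in> mp.span (mpow g ` B' \<union> P)"
      using growth_basis[OF IP W(1), of ?N g] by metis
    let ?C = "(\<lambda>(M, l). ?z ^ l * mpow g M) ` (B' \<times> {..<m})"
    have "indep_mod P (\<lambda>M. c ^ J * mpow g M) B"
      unfolding indep_mod_def
    proof (intro allI impI ballI)
      fix a M assume a: "(\<Sum>M\<in>B. cst (a M) * (c ^ J * mpow g M)) \<in> P" and M: "M \<in> B"
      have "(\<Sum>M\<in>B. cst (a M) * (c ^ J * mpow g M)) = c ^ J * (\<Sum>M\<in>B. cst (a M) * mpow g M)"
        by (simp add: sum_distrib_left mult.left_commute)
      moreover have "(\<Sum>M\<in>B. cst (a M) * mpow g M) \<in> Pol V"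
        using mpow_Pol[of "insert w W" g V] g B(1) by (intro Pol_sum Pol_mult) (auto simp: MonL_def)
      ultimately have "c ^ J \<in> P \<or> (\<Sum>M\<in>B. cst (a M) * mpow g M) \<in> P"
        using a prime_mult[OF P, of "c ^ J"] cP(2) by (simp only: Pol_power)
      then have "(\<Sum>M\<in>B. cst (a M) * mpow g M) \<in> P" using prime_power[OF P cP(2)] cP(1) by blast
      then show "a M = 0" using indep_modD[OF B(4)] M by blast
    qed
    then have "card B \<le> card ?C"
    proof (rule indep_mod_card_le[OF ideal_subspace[OF IP], rotated 2])
      fix M assume M: "M \<in> B"
      then obtain b p where bp: "c ^ J * mpow g M = (\<Sum>l<m. b l * ?z ^ l) + p" "\<forall>l<m. b l \<in> ?A ?N" "p \<in> P"
        using T_mono_elem[of M J] B(1) unfolding T_def by blast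
      have A_sub: "?A ?N \<subseteq> mp.span (mpow g ` B' \<union> P)"
        unfolding alg_upto_def using B'(3) by (intro mp.span_minimal mp.subspace_span) auto
      have bz: "b l * ?z ^ l \<in> mp.span (?C \<union> P)" if l: "l < m" for l
      proof -
        have "?z ^ l * b l \<in> mp.span ((*) (?z ^ l) ` (mpow g ` B' \<union> P))"
          using bp(2) l A_sub by (intro span_mult_image) blast
        moreover have "(*) (?z ^ l) ` (mpow g ` B' \<union> P) \<subseteq> ?C \<union> P"
          using l ideal_mult[OF IP Pol_power[OF zP]] by force
        ultimately have "?z ^ l * b l \<in> mp.span (?C \<union> P)" using mp.span_mono by blast
        then show ?thesis by (simp only: mult.commute[of "b l"])
      qed
      then show "c ^ J * mpow g M \<in> mp.span (?C \<union> P)"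
        unfolding bp(1)
      proof (intro mp.span_add mp.span_sum)
        show "p \<in> mp.span (?C \<union> P)" using bp(3) by (intro mp.span_base) simp
        show "b l * ?z ^ l \<in> mp.span (?C \<union> P)" if "l \<in> {..<m}" for l using that bz by simp
      qed
    qed (use B B' in auto)
    also have "card ?C \<le> card (B' \<times> {..<m})" using B'(1) by (intro card_image_le) auto
    finally show ?thesis using B(3) B'(2) by (simp add: card_cartesian_product mult.commute)
  qed
  then show ?thesis by blast
qed

lemma growth_le_algebraic:
  assumes P: "primeideal P (poly_ring V)" and W: "finite W" "finite Z"
    and g: "\<And>i. i \<in> Z \<union> W \<Longrightarrow> g i \<in> Pol V" and alg: "\<And>z. z \<in> Z \<Longrightarrow> \<not> transcendental P g W (g z)"
    and s: "growth_le P g W s"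
  shows "growth_le P g (Z \<union> W) s"
  using W(2) g alg
proof (induction Z rule: finite_induct)
  case empty
  then show ?case using s by simp
next
  case (insert z Z)
  then have IH: "growth_le P g (Z \<union> W) s" by auto
  show ?case
  proof (cases "z \<in> W")
    case True
    then show ?thesis using IH by (simp add: insert_absorb)
  next
    case False
    have "alg_upto g W J \<subseteq> alg_upto g (Z \<union> W) J" for J
      by (rule alg_upto_reindex[of _ _ _ id]) auto
    then have "\<not> transcendental P g (Z \<union> W) (g z)"
      using insert.prems(2)[of z] unfolding transcendental_def by blast
    then obtain m e where me: "\<And>J. growth P g (insert z (Z \<union> W)) J \<le> m * growth P g (Z \<union> W) ((e + 1) * J)"
      using growth_algebraic[OF P, of "Z \<union> W" z g] insert False W(1) by auto
    obtain C where C: "\<And>J. growth P g (Z \<union> W) J \<le> C * (J + 1) ^ s" using IH by (auto simp: growth_le_def)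
    have "growth P g (insert z (Z \<union> W)) J \<le> (m * C * (e + 1) ^ s) * (J + 1) ^ s" for J
    proof -
      have "growth P g (insert z (Z \<union> W)) J \<le> m * (C * ((e + 1) * J + 1) ^ s)"
        using me[of J] C[of "(e + 1) * J"] by (meson le_trans mult_le_mono2)
      also have "\<dots> \<le> m * (C * ((e + 1) * (J + 1)) ^ s)"
        by (intro mult_left_mono power_mono) auto
      finally show ?thesis by (simp only: power_mult_distrib mult.assoc)
    qed
    then show ?thesis by (auto simp: growth_le_def)
  qed
qed

text \<open>Both families are put into one family over a sum type; the variables are then adjoined to the
  \<open>f i\<close> one at a time.\<close>
lemma growth_le_variables_algebraic:
  assumes P: "primeideal P (poly_ring V)" and V: "finite V" and W: "finite W"
    and f: "\<And>i. i \<in> W \<Longrightarrow> f i \<in> Pol V" and alg: "\<And>v. v \<in> V \<Longrightarrow> \<not> transcendental P f W (X v)"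
    and s: "growth_le P f W s"
  shows "growth_le P X V s"
proof -
  let ?g = "case_sum f X"
  have "growth P ?g (Inl ` W) J \<le> growth P f W J" for J
    by (rule growth_reindex_le[OF prime_ideal[OF P], of _ _ _ _ projl]) (use W in auto)
  then have "growth_le P ?g (Inl ` W) s" using s le_trans unfolding growth_le_def by blast
  moreover have "alg_upto f W J \<subseteq> alg_upto ?g (Inl ` W) J" for J
    by (rule alg_upto_reindex[of _ _ _ Inl]) auto
  then have "\<not> transcendental P ?g (Inl ` W) (X v)" if "v \<in> V" for v
    using alg[OF that] unfolding transcendental_def by blast
  ultimately have "growth_le P ?g (Inr ` V \<union> Inl ` W) s"
    using V W f by (intro growth_le_algebraic[OF P]) auto
  moreover have "growth P X V J \<le> growth P ?g (Inr ` V \<union> Inl ` W) J" for J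
    by (rule growth_reindex_le[OF prime_ideal[OF P], of _ _ _ _ Inr]) (use V W in auto)
  ultimately show ?thesis using le_trans unfolding growth_le_def by blast
qed

section \<open>The ideal of relations among a family of forms\<close>

text \<open>The kernel of the map from \<open>k[W]\<close> to \<open>k[V] / P\<close> that sends the variables to the residues of
  the \<open>f i\<close>; the subalgebra generated by these residues is the quotient by it.\<close>
definition rel_ideal :: "'j set \<Rightarrow> ('i, 'k::field) mpol set \<Rightarrow> ('j \<Rightarrow> ('i, 'k) mpol) \<Rightarrow> ('j, 'k) mpol set" where
  "rel_ideal W P f = {h\<in>Pol W. psubst f h \<in> P}"

context
  fixes P :: "('i, 'k::field) mpol set" and V and f :: "'j \<Rightarrow> ('i, 'k) mpol" and W
  assumes f: "\<And>i. i \<in> W \<Longrightarrow> f i \<in> Pol V"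
begin

lemma rel_ideal_ideal:
  assumes "ideal P (poly_ring V)"
  shows "ideal (rel_ideal W P f) (poly_ring W)"
  unfolding poly_ideal_iff rel_ideal_def
  using psubst_Pol[of W f V, OF f]
  by (auto simp: psubst_add psubst_mult psubst_zero
      intro: ideal_zero[OF assms] ideal_add[OF assms] ideal_mult[OF assms])

lemma rel_ideal_prime:
  assumes "primeideal P (poly_ring V)"
  shows "primeideal (rel_ideal W P f) (poly_ring W)"
  unfolding poly_primeideal_iff
  using rel_ideal_ideal[OF prime_ideal[OF assms]] psubst_Pol[of W f V, OF f]
    prime_mult[OF assms] prime_one[OF assms]
  by (auto simp: rel_ideal_def psubst_mult psubst_one)

lemma growth_rel_ideal: "growth (rel_ideal W P f) X W J = growth P f W J"
proof -
  have "indep_mod (rel_ideal W P f) xpow B \<longleftrightarrow> indep_mod P (mpow f) B" if B: "B \<subseteq> MonL W J" for B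
  proof -
    have "(\<Sum>j\<in>B. cst (c j) * xpow j) \<in> rel_ideal W P f \<longleftrightarrow> (\<Sum>j\<in>B. cst (c j) * mpow f j) \<in> P" for c
    proof -
      have "(\<Sum>j\<in>B. cst (c j) * xpow j) \<in> Pol W"
        using B by (intro Pol_sum Pol_mult) (auto simp: MonL_def)
      then show ?thesis
        by (simp add: rel_ideal_def psubst_sum psubst_mult psubst_single psubst_cst)
    qed
    then show ?thesis by (simp add: indep_mod_def)
  qed
  then have "{B. B \<subseteq> MonL W J \<and> indep_mod (rel_ideal W P f) xpow B} = {B. B \<subseteq> MonL W J \<and> indep_mod P (mpow f) B}"
    by auto
  then show ?thesis by (simp add: growth_def rank_mod_def mpow_X_fun)
qed

end

lemma hcomp_mpow:
  fixes f :: "'j \<Rightarrow> ('i, 'k::field) mpol"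
  assumes "\<And>i. i \<in> W \<Longrightarrow> hcomp d (f i) = f i" "m \<in> Mon W"
  shows "hcomp (mon_degree m * d) (mpow f m) = mpow f m"
proof -
  have pow: "hcomp (e * d) (a ^ e) = a ^ e" if "hcomp d a = a" for a :: "('i, 'k) mpol" and e
  proof (induction e)
    case 0
    have "hcomp 0 1 = (1 :: ('i, 'k) mpol)"
      using hcomp_single[of 0 0 "1::'k"] by simp
    then show ?case by simp
  next
    case (Suc e)
    then show ?case using hcomp_mult_homogeneous[OF that, of "Suc e * d" "a ^ e"] by simp
  qed
  have "hcomp ((\<Sum>i\<in>A. lk m i) * d) (\<Prod>i\<in>A. f i ^ lk m i) = (\<Prod>i\<in>A. f i ^ lk m i)" if "finite A" "A \<subseteq> W" for A
    using that
  proof (induction A rule: finite_induct)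
    case empty
    then show ?case using hcomp_single[of 0 0 "1::'k"] by simp
  next
    case (insert x A)
    have "hcomp (lk m x * d) (f x ^ lk m x) = f x ^ lk m x" using insert.prems by (intro pow assms(1)) auto
    from hcomp_mult_homogeneous[OF this] insert show ?case by (simp add: distrib_right)
  qed
  from this[of "Poly_Mapping.keys m"] assms(2) show ?thesis
    by (simp add: mpow_def mon_degree_def Mon_def)
qed

lemma psubst_hcomp:
  fixes f :: "'j \<Rightarrow> ('i, 'k::field) mpol"
  assumes f: "\<And>i. i \<in> W \<Longrightarrow> hcomp d (f i) = f i" and d: "d > 0" and h: "h \<in> Pol W"
  shows "psubst f (hcomp j h) = hcomp (j * d) (psubst f h)"
proof -
  have "hcomp (j * d) (psubst f h) = (\<Sum>m\<in>Poly_Mapping.keys h. hcomp (j * d) (cst (lk h m) * mpow f m))"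
    by (simp add: subst_def hcomp_sum)
  also have "\<dots> = (\<Sum>m\<in>Poly_Mapping.keys h. if mon_degree m = j then cst (lk h m) * mpow f m else 0)"
  proof (rule sum.cong[OF refl])
    fix m assume "m \<in> Poly_Mapping.keys h"
    then have m: "m \<in> Mon W" using h by (auto simp: Pol_iff)
    have "hcomp 0 (cst (lk h m)) = (cst (lk h m) :: ('i, 'k) mpol)" by (simp add: cst_def hcomp_single)
    then have "hcomp (j * d) (cst (lk h m) * mpow f m) = cst (lk h m) * hcomp (j * d) (mpow f m)"
      using hcomp_mult_homogeneous[of 0 "cst (lk h m)"] by simp
    also have "hcomp (j * d) (mpow f m) = (if mon_degree m = j then mpow f m else 0)"
    proof -
      have mp: "hcomp (mon_degree m * d) (mpow f m) = mpow f m"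
        by (rule hcomp_mpow[of W]) (use f m in auto)
      then have "hcomp (j * d) (mpow f m) = hcomp (j * d) (hcomp (mon_degree m * d) (mpow f m))"
        by (simp only: mp)
      also have "\<dots> = (if j * d = mon_degree m * d then hcomp (mon_degree m * d) (mpow f m) else 0)"
        by (rule hcomp_hcomp)
      also note mp
      also have "j * d = mon_degree m * d \<longleftrightarrow> mon_degree m = j" using d by auto
      finally show ?thesis .
    qed
    finally show "hcomp (j * d) (cst (lk h m) * mpow f m) = (if mon_degree m = j then cst (lk h m) * mpow f m else 0)"
      by simp
  qed
  also have "\<dots> = psubst f (hcomp j h)"
  proof -
    have "Poly_Mapping.keys h \<inter> {m. mon_degree m = j} = Poly_Mapping.keys (hcomp j h)"
      by (auto simp: keys_hcomp)
    then show ?thesis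
      unfolding subst_def by (simp add: sum.If_cases) (intro sum.cong refl, auto simp: keys_hcomp lookup_hcomp)
  qed
  finally show ?thesis by simp
qed

lemma rel_ideal_graded:
  assumes "\<And>i. i \<in> W \<Longrightarrow> hcomp d (f i) = f i" "d > 0" "graded P"
  shows "graded (rel_ideal W P f)"
  using assms psubst_hcomp[of W d f] by (auto simp: graded_def rel_ideal_def)

lemma vdim_rel_ideal_le:
  fixes P :: "(nat, 'k::field) mpol set" and f :: "nat \<Rightarrow> (nat, 'k) mpol"
  assumes P: "primeideal P (poly_ring V)" and V: "finite V" and W: "finite W"
    and f: "\<And>i. i \<in> W \<Longrightarrow> f i \<in> PolL V d"
  shows "vdim W (rel_ideal W P f) \<le> vdim V P"
proof -
  have f': "f i \<in> Pol V" if "i \<in> W" for i using f[OF that] by (rule PolL_Pol)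
  obtain C where C: "\<And>J. growth P X V J \<le> C * (J + 1) ^ vdim V P"
    using growth_le_vdim[OF P V] by (auto simp: growth_le_def)
  have "growth P f W J \<le> C * (d + 1) ^ vdim V P * (J + 1) ^ vdim V P" for J
  proof -
    have "growth P f W J \<le> growth P X V (J * d)"
      unfolding growth_def
    proof (rule rank_mod_mono[OF ideal_subspace[OF prime_ideal[OF P]]])
      fix m assume m: "m \<in> MonL W J"
      then have "mpow f m \<in> PolL V (J * d)"
        by (intro PolL_mono[OF mpow_PolL[OF f]]) (auto simp: MonL_def)
      then show "mpow f m \<in> mp.span (mpow X ` MonL V (J * d) \<union> P)" using PolL_span_Un by (simp add: mpow_X_fun)
    qed (use V W in auto)
    also have "\<dots> \<le> C * (J * d + 1) ^ vdim V P" by (rule C)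
    also have "\<dots> \<le> C * ((d + 1) * (J + 1)) ^ vdim V P"
      by (intro mult_left_mono power_mono) (auto simp: algebra_simps)
    finally show ?thesis by (simp only: power_mult_distrib mult.assoc)
  qed
  then have "growth_le (rel_ideal W P f) X W (vdim V P)"
    unfolding growth_le_def growth_rel_ideal[of W f V, OF f', simplified] by blast
  moreover have "primeideal (rel_ideal W P f) (poly_ring W)"
    by (rule rel_ideal_prime[of W f V, OF f' P])
  ultimately show ?thesis using vdim_le_growth W by blast
qed

text \<open>The uniform bound behind openness. If the \<open>f i\<close> generate a subalgebra of smaller dimension,
  some variable is transcendental over them, and its powers take up a factor \<open>J + 1\<close> of the growth
  of the variables; what remains is too small already at one place \<open>J\<close> that depends only on \<open>P\<close>,
  \<open>W\<close> and \<open>d\<close>.\<close>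
lemma vdim_rel_ideal_threshold:
  fixes P :: "(nat, 'k::field) mpol set" and W :: "nat set"
  assumes P: "primeideal P (poly_ring V)" and V: "finite V" and W: "finite W"
  shows "\<exists>J h. \<forall>f. (\<forall>i\<in>W. f i \<in> PolL V d) \<longrightarrow> (vdim V P \<le> vdim W (rel_ideal W P f) \<longleftrightarrow> h \<le> growth P f W J)"
proof -
  let ?r = "vdim V P"
  obtain C where C: "\<And>J. growth P X V J \<le> C * (J + 1) ^ ?r"
    using growth_le_vdim[OF P V] by (auto simp: growth_le_def)
  \<comment> \<open>\<open>q\<close> is so large that \<open>(J + 1) (q + 1)\<^sup>r\<close>, where \<open>r\<close> is the dimension, exceeds the bound on
    the growth of the variables at \<open>J d + J\<close>\<close>
  define K where "K = (card W + 1) * (d + 1)"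
  define q where "q = C * K ^ ?r"
  define J where "J = (card W + 1) * q"
  have "?r \<le> vdim W (rel_ideal W P f) \<longleftrightarrow> (q + 1) ^ ?r \<le> growth P f W J" if f: "\<forall>i\<in>W. f i \<in> PolL V d" for f
  proof -
    have f': "f i \<in> Pol V" if "i \<in> W" for i using f that PolL_Pol by blast
    have R: "primeideal (rel_ideal W P f) (poly_ring W)" by (rule rel_ideal_prime[of W f V, OF f' P])
    show ?thesis
    proof
      assume r: "?r \<le> vdim W (rel_ideal W P f)"
      obtain Y where Y: "Y \<subseteq> W" "indep_vars (rel_ideal W P f) Y" "card Y = vdim W (rel_ideal W P f)"
        using vdim_obtain[OF R W] by blast
      have "(q + 1) ^ ?r \<le> (q + 1) ^ card Y" using r Y(3) by (intro power_increasing) auto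
      also have "card Y * q \<le> J"
        unfolding J_def using card_mono[OF W Y(1)] by (intro mult_right_mono) auto
      then have "(q + 1) ^ card Y \<le> growth (rel_ideal W P f) X W J"
        by (rule growth_ge_of_indep[OF prime_ideal[OF R] W Y(1,2)])
      finally show "(q + 1) ^ ?r \<le> growth P f W J"
        using growth_rel_ideal[of W f V P J, OF f'] by simp
    next
      assume g: "(q + 1) ^ ?r \<le> growth P f W J"
      show "?r \<le> vdim W (rel_ideal W P f)"
      proof (cases "\<exists>v\<in>V. transcendental P f W (X v)")
        case True
        then obtain v where v: "v \<in> V" "transcendental P f W (X v)" by blast
        have "(J + 1) * (q + 1) ^ ?r \<le> (J + 1) * growth P f W J"
          using g by (intro mult_left_mono) auto
        also have "\<dots> \<le> growth P X V (J * d + J)"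
          using f v by (intro growth_transcendental[OF prime_ideal[OF P] V W]) auto
        also have "\<dots> \<le> C * (J * d + J + 1) ^ ?r" by (rule C)
        also have "\<dots> \<le> C * (K * (q + 1)) ^ ?r"
          by (intro mult_left_mono power_mono) (auto simp: J_def K_def algebra_simps)
        also have "\<dots> = q * (q + 1) ^ ?r" by (simp only: q_def power_mult_distrib mult.assoc)
        finally have "J + 1 \<le> q" by (subst (asm) mult_le_cancel2) auto
        then show ?thesis by (simp add: J_def)
      next
        case False
        have "growth_le P f W (vdim W (rel_ideal W P f))"
          using growth_le_vdim[OF R W] unfolding growth_le_def growth_rel_ideal[of W f V, OF f', simplified] .
        then have "growth_le P X V (vdim W (rel_ideal W P f))"
          using False by (intro growth_le_variables_algebraic[OF P V W f']) auto
        then show ?thesis by (rule vdim_le_growth[OF P V])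
      qed
    qed
  qed
  then show ?thesis by blast
qed

text \<open>Every variable is a root of \<open>z\<^sup>d - f v\<close>, hence algebraic over the \<open>f i\<close>.\<close>
lemma vdim_rel_ideal_powers:
  fixes P :: "(nat, 'k::field) mpol set"
  assumes P: "primeideal P (poly_ring V)" and V: "finite V" and d: "d > 0"
  shows "vdim V P \<le> vdim V (rel_ideal V P (\<lambda>i. X i ^ d))"
proof -
  let ?f = "\<lambda>i. X i ^ d :: (nat, 'k) mpol"
  have f: "?f i \<in> Pol V" if "i \<in> V" for i using that by auto
  have R: "primeideal (rel_ideal V P ?f) (poly_ring V)" by (rule rel_ideal_prime[of V ?f V, OF f P])
  have alg: "\<not> transcendental P ?f V (X v)" if v: "v \<in> V" for v
  proof
    assume t: "transcendental P ?f V (X v)"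
    let ?\<beta> = "\<lambda>i. if i = d then 1 else if i = 0 then - ?f v else 0"
    have "(\<Sum>i\<le>d. ?\<beta> i * X v ^ i) = (\<Sum>i\<in>{0, d}. ?\<beta> i * X v ^ i)"
      by (intro sum.mono_neutral_right) auto
    then have "(\<Sum>i\<le>d. ?\<beta> i * X v ^ i) = 0" using d by simp
    then have "(\<Sum>i\<le>d. ?\<beta> i * X v ^ i) \<in> P" using ideal_zero[OF prime_ideal[OF P]] by simp
    moreover have "\<forall>i\<le>d. ?\<beta> i \<in> alg_upto ?f V 1"
    proof (intro allI impI)
      fix i
      have "?f v = mpow ?f (Poly_Mapping.single v 1)" by simp
      also have "\<dots> \<in> alg_upto ?f V 1" using v by (intro alg_upto_base) (auto simp: MonL_def Mon_def)
      finally have "0 - ?f v \<in> alg_upto ?f V 1" by (intro alg_upto_diff alg_upto_zero)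
      then show "?\<beta> i \<in> alg_upto ?f V 1" by (auto simp: alg_upto_one alg_upto_zero)
    qed
    ultimately have "\<forall>i\<le>d. ?\<beta> i \<in> P"
      using t[unfolded transcendental_def, THEN spec[of _ 1], THEN spec[of _ d], THEN spec[of _ ?\<beta>]]
      by blast
    then have "?\<beta> d \<in> P" by blast
    then show False using prime_one[OF P] by simp
  qed
  have g: "growth_le P ?f V (vdim V (rel_ideal V P ?f))"
    using growth_le_vdim[OF R V] unfolding growth_le_def growth_rel_ideal[of V ?f V, OF f, simplified] .
  have "growth_le P X V (vdim V (rel_ideal V P ?f))"
    by (rule growth_le_variables_algebraic[OF P V V _ _ g]) (use f alg in blast)+
  then show ?thesis by (rule vdim_le_growth[OF P V])
qed

section \<open>Forms as functions and Zariski-open conditions\<close>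

definition form_fun :: "'a set \<Rightarrow> nat \<Rightarrow> (('a \<Rightarrow> 'k::field) \<Rightarrow> 'k) \<Rightarrow> bool" where
  "form_fun V e g \<longleftrightarrow> (\<exists>F\<in>Pol V. (\<forall>m\<in>Poly_Mapping.keys F. mon_degree m = e) \<and> (\<forall>v. mpol_eval F v = g v))"

lemma mpol_eval_simps:
  "mpol_eval 0 v = 0" "mpol_eval 1 v = 1"
  "mpol_eval (f + g) v = mpol_eval f v + mpol_eval g v"
  "mpol_eval (f * g) v = mpol_eval f v * mpol_eval g v"
  "mpol_eval (cst c) v = c" "mpol_eval (X i) v = v i"
  using subst_single[of id v 0 c] subst_single[of id v "Poly_Mapping.single i 1" 1]
  by (simp_all add: mpol_eval_subst subst_zero subst_one subst_add subst_mult cst_def X_def)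

lemma form_fun_zero: "form_fun V e (\<lambda>v. 0)"
  unfolding form_fun_def by (rule bexI[of _ 0]) (auto simp: mpol_eval_simps)

lemma keys_cst: "m \<in> Poly_Mapping.keys (cst c) \<Longrightarrow> m = 0"
  by (auto simp: cst_def split: if_splits)

lemma keys_X: "m \<in> Poly_Mapping.keys (X i :: ('i, 'k::field) mpol) \<Longrightarrow> mon_degree m = 1"
  by (simp add: X_def)

lemma form_fun_const: "form_fun V 0 (\<lambda>v. c)"
  unfolding form_fun_def by (rule bexI[of _ "cst c"]) (auto simp: mpol_eval_simps dest: keys_cst)

lemma form_fun_coord: "i \<in> V \<Longrightarrow> form_fun V 1 (\<lambda>v. v i)"
  unfolding form_fun_def by (rule bexI[of _ "X i"]) (auto simp: mpol_eval_simps dest: keys_X)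

lemma form_fun_add:
  assumes "form_fun V e g" "form_fun V e g'"
  shows "form_fun V e (\<lambda>v. g v + g' v)"
proof -
  obtain F G where "F \<in> Pol V" "\<forall>m\<in>Poly_Mapping.keys F. mon_degree m = e" "\<forall>v. mpol_eval F v = g v"
    "G \<in> Pol V" "\<forall>m\<in>Poly_Mapping.keys G. mon_degree m = e" "\<forall>v. mpol_eval G v = g' v"
    using assms by (auto simp: form_fun_def)
  then show ?thesis unfolding form_fun_def
    using Poly_Mapping.keys_add[of F G] by (intro bexI[of _ "F + G"]) (auto simp: mpol_eval_simps)
qed

lemma form_fun_mult:
  assumes "form_fun V e g" "form_fun V e' g'"
  shows "form_fun V (e + e') (\<lambda>v. g v * g' v)"
proof -
  obtain F G where FG: "F \<in> Pol V" "\<forall>m\<in>Poly_Mapping.keys F. mon_degree m = e" "\<forall>v. mpol_eval F v = g v"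
    "G \<in> Pol V" "\<forall>m\<in>Poly_Mapping.keys G. mon_degree m = e'" "\<forall>v. mpol_eval G v = g' v"
    using assms by (auto simp: form_fun_def)
  have "mon_degree m = e + e'" if "m \<in> Poly_Mapping.keys (F * G)" for m
    using keys_mult[of F G] that FG(2,5) by (fastforce simp: mon_degree_add)
  then show ?thesis unfolding form_fun_def
    using FG by (intro bexI[of _ "F * G"]) (auto simp: mpol_eval_simps)
qed

lemma form_fun_cmult: "form_fun V e g \<Longrightarrow> form_fun V e (\<lambda>v. g v * c)"
  using form_fun_mult[of V e g 0 "\<lambda>_. c"] form_fun_const by auto

lemma form_fun_sum: "(\<And>x. x \<in> A \<Longrightarrow> form_fun V e (g x)) \<Longrightarrow> form_fun V e (\<lambda>v. \<Sum>x\<in>A. g x v)"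
  by (induction A rule: infinite_finite_induct) (auto intro: form_fun_zero form_fun_add)

lemma form_fun_prod:
  "finite A \<Longrightarrow> (\<And>x. x \<in> A \<Longrightarrow> form_fun V (e x) (g x)) \<Longrightarrow>
    form_fun V (\<Sum>x\<in>A. e x) (\<lambda>v. \<Prod>x\<in>A. g x v)"
  by (induction A rule: finite_induct) (auto intro: form_fun_const form_fun_mult)

lemma mpol_eval_scale:
  assumes F: "F \<in> Pol V" "\<And>m. m \<in> Poly_Mapping.keys F \<Longrightarrow> mon_degree m = e"
    and w: "\<And>i. i \<in> V \<Longrightarrow> w i = c * v i"
  shows "mpol_eval F w = c ^ e * mpol_eval F v"
proof -
  have "mpow w m = c ^ e * mpow v m" if m: "m \<in> Poly_Mapping.keys F" for m
  proof -
    have "Poly_Mapping.keys m \<subseteq> V" using F(1) m by (auto simp: Pol_iff Mon_def)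
    then have "mpow w m = (\<Prod>i\<in>Poly_Mapping.keys m. c ^ lk m i * v i ^ lk m i)"
      unfolding mpow_def using w by (intro prod.cong) (auto simp: power_mult_distrib)
    also have "\<dots> = c ^ mon_degree m * mpow v m"
      by (simp add: prod.distrib mpow_def mon_degree_def power_sum)
    finally show ?thesis using F(2)[OF m] by simp
  qed
  then show ?thesis
    by (simp add: mpol_eval_subst subst_def sum_distrib_left mult.left_commute)
qed

text \<open>The members of \<open>D\<close> may have different degrees and may be infinitely many: each is homogeneous,
  so that its vanishing depends only on the point.\<close>
lemma zariski_open_nonvanishing:
  assumes D: "\<And>g. g \<in> D \<Longrightarrow> \<exists>e. form_fun V e g"
  shows "zariski_open V {proj_point V v | v. v \<in> proj_vectors V \<and> (\<exists>g\<in>D. g v \<noteq> 0)}"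
    (is "zariski_open V ?U")
proof -
  let ?F = "{F\<in>Pol V. homogeneous F \<and> (\<exists>g\<in>D. \<forall>v. mpol_eval F v = g v)}"
  have "proj_space V - ?U = {proj_point V v | v. v \<in> proj_vectors V \<and> (\<forall>f\<in>?F. mpol_eval f v = 0)}"
    (is "_ = ?Z")
  proof (intro equalityI subsetI)
    fix p assume p: "p \<in> proj_space V - ?U"
    then obtain v where v: "p = proj_point V v" "v \<in> proj_vectors V" by (auto simp: proj_space_def)
    then have "\<forall>g\<in>D. g v = 0" using p by blast
    then show "p \<in> ?Z" using v by auto
  next
    fix p assume "p \<in> ?Z"
    then obtain v where v: "p = proj_point V v" "v \<in> proj_vectors V" "\<And>f. f \<in> ?F \<Longrightarrow> mpol_eval f v = 0"
      by blast
    have "p \<notin> ?U"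
    proof
      assume "p \<in> ?U"
      then obtain w g where w: "p = proj_point V w" "w \<in> proj_vectors V" "g \<in> D" "g w \<noteq> 0" by blast
      obtain e F where F: "F \<in> Pol V" "\<forall>m\<in>Poly_Mapping.keys F. mon_degree m = e" "\<forall>v. mpol_eval F v = g v"
        using D[OF w(3)] by (auto simp: form_fun_def)
      have "w = (\<lambda>i\<in>V. 1 * w i)" using w(2) by (auto simp: proj_vectors_def extensional_def)
      then have "w \<in> proj_point V w" unfolding proj_point_def by (intro CollectI exI[of _ 1]) simp
      then obtain c where c: "w = (\<lambda>i\<in>V. c * v i)" using v(1) w(1) by (auto simp: proj_point_def)
      have "mpol_eval F w = c ^ e * mpol_eval F v"
        using F by (intro mpol_eval_scale) (auto simp: c)
      moreover have "F \<in> ?F" using F w(3) by (auto simp: homogeneous_def)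
      ultimately show False using v(3)[of F] F(3) w(4) by (metis mult_zero_right)
    qed
    then show "p \<in> proj_space V - ?U" using v by (auto simp: proj_space_def)
  qed
  then have "zariski_closed V (proj_space V - ?U)"
    unfolding zariski_closed_def by (intro exI[of _ ?F]) auto
  moreover have "?U \<subseteq> proj_space V" by (auto simp: proj_space_def)
  ultimately show ?thesis by (simp add: zariski_open_def)
qed

text \<open>Polynomials whose coefficients are forms of degree \<open>e\<close> in the parameter \<open>v\<close>. Generating
  them by sums makes the closure under products an induction on both factors.\<close>
inductive form_family :: "'a set \<Rightarrow> nat \<Rightarrow> (('a \<Rightarrow> 'k::field) \<Rightarrow> ('i, 'k) mpol) \<Rightarrow> bool" for V where
  base: "form_fun V e q \<Longrightarrow> form_family V e (\<lambda>v. cst (q v) * b)"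
| zero: "form_family V e (\<lambda>v. 0)"
| add: "form_family V e F \<Longrightarrow> form_family V e G \<Longrightarrow> form_family V e (\<lambda>v. F v + G v)"

lemma form_family_mult:
  assumes "form_family V e F" "form_family V e' G"
  shows "form_family V (e + e') (\<lambda>v. F v * G v)"
  using assms(1)
proof induction
  case (base e q b)
  from assms(2) show ?case
  proof induction
    case (base e' q' b')
    have "form_family V (e + e') (\<lambda>v. cst (q v * q' v) * (b * b'))"
      using \<open>form_fun V e q\<close> base by (intro form_family.base form_fun_mult)
    then show ?case by (simp add: cst_mult mult_ac)
  next
    case (zero e')
    then show ?case by (simp add: form_family.zero)
  next
    case (add e' F G)
    then show ?case by (simp add: distrib_left form_family.add)
  qed
next
  case (zero e)
  then show ?case by (simp add: form_family.zero)
next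
  case (add e F G)
  then show ?case by (simp add: distrib_right form_family.add)
qed

lemma form_family_sum:
  "(\<And>x. x \<in> A \<Longrightarrow> form_family V e (F x)) \<Longrightarrow> form_family V e (\<lambda>v. \<Sum>x\<in>A. F x v)"
  by (induction A rule: infinite_finite_induct) (auto intro: form_family.intros)

lemma form_family_one: "form_family V 0 (\<lambda>v. 1)"
  using form_family.base[OF form_fun_const[of V 1], of 1] by simp

lemma form_family_power: "form_family V 1 F \<Longrightarrow> form_family V e (\<lambda>v. F v ^ e)"
proof (induction e)
  case (Suc e)
  then show ?case using form_family_mult[of V 1 F e "\<lambda>v. F v ^ e"] by simp
qed (simp add: form_family_one)

lemma form_family_mpow:
  assumes "\<And>i. i \<in> W \<Longrightarrow> form_family V 1 (\<lambda>v. f v i)" "m \<in> Mon W"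
  shows "form_family V (mon_degree m) (\<lambda>v. mpow (f v) m)"
proof -
  have "form_family V (\<Sum>i\<in>A. lk m i) (\<lambda>v. \<Prod>i\<in>A. f v i ^ lk m i)" if "finite A" "A \<subseteq> W" for A
    using that
  proof (induction A rule: finite_induct)
    case (insert x A)
    have "form_family V (lk m x) (\<lambda>v. f v x ^ lk m x)"
      using insert.prems by (intro form_family_power assms(1)) auto
    from form_family_mult[OF this] insert show ?case by simp
  qed (simp add: form_family_one)
  from this[of "Poly_Mapping.keys m"] assms(2) show ?thesis
    by (simp add: mpow_def mon_degree_def Mon_def)
qed

lemma form_family_form:
  assumes "i \<in> I"
  shows "form_family (I \<times> {1..N}) 1 (\<lambda>v. form N M (\<lambda>j. v (i, j)))"
proof -
  have "form_family (I \<times> {1..N}) 1 (\<lambda>v. \<Sum>j=1..N. cst (v (i, j)) * xpow (M j))"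
    using assms by (intro form_family_sum form_family.base form_fun_coord) auto
  then show ?thesis by (simp add: form_def cst_times_xpow)
qed

interpretation mpk: vector_space_pair "\<lambda>c f. cst c * f :: ('i, 'k::field) mpol" "(*) :: 'k \<Rightarrow> 'k \<Rightarrow> 'k"
  by unfold_locales (simp_all add: algebra_simps)

abbreviation functional :: "(('i, 'k::field) mpol \<Rightarrow> 'k) \<Rightarrow> bool" where
  "functional \<equiv> Vector_Spaces.linear (\<lambda>c f. cst c * f) (*)"

lemma functional_simps:
  assumes "functional \<phi>"
  shows "\<phi> (x + y) = \<phi> x + \<phi> y" "\<phi> (cst c * x) = c * \<phi> x" "\<phi> 0 = 0"
    "\<phi> (sum g A) = (\<Sum>a\<in>A. \<phi> (g a))"
proof -
  interpret Vector_Spaces.linear "\<lambda>c f. cst c * f" "(*)" \<phi> by (rule assms)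
  show "\<phi> (x + y) = \<phi> x + \<phi> y" "\<phi> (cst c * x) = c * \<phi> x" "\<phi> 0 = 0"
    "\<phi> (sum g A) = (\<Sum>a\<in>A. \<phi> (g a))"
    by (simp_all add: add scale zero sum)
qed

lemma form_fun_functional:
  assumes "form_family V e F" "functional \<phi>"
  shows "form_fun V e (\<lambda>v. \<phi> (F v))"
  using assms(1)
  by induction (simp_all add: functional_simps[OF assms(2)] form_fun_cmult form_fun_zero form_fun_add)

definition pairing_mat :: "nat \<Rightarrow> (nat \<Rightarrow> ('i, 'k::field) mpol \<Rightarrow> 'k) \<Rightarrow> (nat \<Rightarrow> ('i, 'k) mpol) \<Rightarrow> 'k mat" where
  "pairing_mat h \<phi> b = mat h h (\<lambda>(i, j). \<phi> i (b j))"

lemma form_fun_det_pairing: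
  assumes "\<And>j. j < h \<Longrightarrow> form_family V (e j) (\<lambda>v. b v j)" "\<And>i. i < h \<Longrightarrow> functional (\<phi> i)"
  shows "form_fun V (\<Sum>j<h. e j) (\<lambda>v. det (pairing_mat h \<phi> (b v)))"
proof -
  let ?P = "{p. p permutes {0..<h}}"
  have "form_fun V (\<Sum>j<h. e j) (\<lambda>v. \<Sum>p\<in>?P. (\<Prod>i\<in>{0..<h}. \<phi> i (b v (p i))) * signof p)"
  proof (intro form_fun_sum form_fun_cmult)
    fix p assume p: "p \<in> ?P"
    have "form_fun V (\<Sum>i\<in>{0..<h}. e (p i)) (\<lambda>v. \<Prod>i\<in>{0..<h}. \<phi> i (b v (p i)))"
    proof (rule form_fun_prod)
      fix i assume i: "i \<in> {0..<h}"
      then have "p i < h" using p permutes_in_image[of p "{0..<h}" i] by auto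
      then show "form_fun V (e (p i)) (\<lambda>v. \<phi> i (b v (p i)))"
        using i assms by (intro form_fun_functional) auto
    qed simp
    also have "(\<Sum>i\<in>{0..<h}. e (p i)) = (\<Sum>j<h. e j)"
      using sum.permute[of p "{0..<h}" e] p by (simp add: o_def atLeast0LessThan)
    finally show "form_fun V (\<Sum>j<h. e j) (\<lambda>v. \<Prod>i\<in>{0..<h}. \<phi> i (b v (p i)))" .
  qed
  moreover have "det (pairing_mat h \<phi> (b v)) = (\<Sum>p\<in>?P. (\<Prod>i\<in>{0..<h}. \<phi> i (b v (p i))) * signof p)" for v
  proof -
    have "det (pairing_mat h \<phi> (b v)) = (\<Sum>p\<in>?P. signof p * (\<Prod>i\<in>{0..<h}. pairing_mat h \<phi> (b v) $$ (i, p i)))"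
      by (rule det_def') (simp add: pairing_mat_def)
    also have "\<dots> = (\<Sum>p\<in>?P. (\<Prod>i\<in>{0..<h}. \<phi> i (b v (p i))) * signof p)"
    proof (rule sum.cong[OF refl])
      fix p assume p: "p \<in> ?P"
      have "(\<Prod>i\<in>{0..<h}. pairing_mat h \<phi> (b v) $$ (i, p i)) = (\<Prod>i\<in>{0..<h}. \<phi> i (b v (p i)))"
      proof (rule prod.cong[OF refl])
        fix i assume i: "i \<in> {0..<h}"
        then have "p i < h" using p permutes_in_image[of p "{0..<h}" i] by auto
        then show "pairing_mat h \<phi> (b v) $$ (i, p i) = \<phi> i (b v (p i))" using i by (simp add: pairing_mat_def)
      qed
      then show "signof p * (\<Prod>i\<in>{0..<h}. pairing_mat h \<phi> (b v) $$ (i, p i)) = (\<Prod>i\<in>{0..<h}. \<phi> i (b v (p i))) * signof p"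
        by (simp add: mult.commute)
    qed
    finally show ?thesis .
  qed
  ultimately show ?thesis by simp
qed

text \<open>Together with a basis of \<open>P\<close> the family is linearly independent, and a linear functional may
  be prescribed on an independent set.\<close>
lemma indep_mod_dual_functionals:
  fixes b :: "nat \<Rightarrow> ('i, 'k::field) mpol"
  assumes P: "mp.subspace P" and ind: "indep_mod P b {..<h}"
  shows "\<exists>\<phi>. \<forall>i<h. functional (\<phi> i) \<and> (\<forall>x\<in>P. \<phi> i x = 0) \<and> (\<forall>j<h. \<phi> i (b j) = (if i = j then 1 else 0))"
proof -
  obtain B where B: "B \<subseteq> P" "mp.independent B" "P \<subseteq> mp.span B" using mp.basis_exists[of P] by metis
  have notin: "b k \<notin> mp.span (B \<union> b ` {..<k})" if k: "k < h" for k
  proof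
    assume "b k \<in> mp.span (B \<union> b ` {..<k})"
    moreover have "mp.span (B \<union> b ` {..<k}) \<subseteq> mp.span (b ` {..<k} \<union> P)"
      using B(1) by (intro mp.span_mono) auto
    ultimately have "b k \<in> mp.span (b ` {..<k} \<union> P)" by blast
    then obtain a where a: "a \<in> mp.span (b ` {..<k})" "b k - a \<in> P" by (rule span_Un_subspaceE[OF P])
    obtain c where c: "a = (\<Sum>j<k. cst (c j) * b j)" using span_family[OF _ a(1)] by auto
    have ik: "indep_mod P b {..<Suc k}" using indep_mod_subset[OF ind, of "{..<Suc k}"] k by auto
    have "(\<Sum>j<Suc k. cst (if j = k then 1 else - c j) * b j) = b k - a"
      by (simp add: c cst_uminus sum_negf)
    then have "(if k = k then 1 else - c k) = 0"
      using a(2) indep_modD[OF ik, of "\<lambda>j. if j = k then 1 else - c j" k] by simp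
    then show False by simp
  qed
  have indB: "mp.independent (B \<union> b ` {..<k})" if "k \<le> h" for k
    using that
  proof (induction k)
    case (Suc k)
    have "B \<union> b ` {..<Suc k} = insert (b k) (B \<union> b ` {..<k})" by (auto simp: lessThan_Suc)
    then show ?case using Suc notin[of k] by (simp add: mp.independent_insertI)
  qed (use B(2) in simp)
  have b_ne: "b j \<noteq> b i" if "i < j" "j < h" for i j
    using notin[OF that(2)] that(1) by (metis Un_iff imageI lessThan_iff mp.span_base)
  have b_B: "b j \<notin> B" if "j < h" for j
    using notin[OF that] mp.span_base[of "b j" "B \<union> b ` {..<j}"] by blast
  have "\<exists>g. functional g \<and> (\<forall>x\<in>P. g x = 0) \<and> (\<forall>j<h. g (b j) = (if i = j then 1 else 0))" if i: "i < h" for i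
  proof -
    obtain g where g: "functional g" "\<forall>x\<in>B \<union> b ` {..<h}. g x = (if x = b i then 1 else 0)"
      using mpk.linear_independent_extend[OF indB[OF order_refl], of "\<lambda>x. if x = b i then 1 else 0"] by blast
    have "mp.subspace {x. g x = 0}"
      unfolding mp.subspace_def by (simp add: functional_simps[OF g(1)])
    moreover have "B \<subseteq> {x. g x = 0}" using g(2) b_B[OF i] by auto
    ultimately have "mp.span B \<subseteq> {x. g x = 0}" by (rule mp.span_minimal[rotated])
    then have "\<forall>x\<in>P. g x = 0" using B(3) by blast
    moreover have "g (b j) = (if i = j then 1 else 0)" if "j < h" for j
      using g(2) that i b_ne[of i j] b_ne[of j i] by (cases i j rule: linorder_cases) auto
    ultimately show ?thesis using g(1) by blast
  qed
  then show ?thesis by metis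
qed

text \<open>Functionals that vanish on \<open>P\<close> turn independence modulo \<open>P\<close>, in a space of infinite
  dimension, into the non-vanishing of a determinant.\<close>
lemma indep_mod_iff_det:
  fixes b :: "nat \<Rightarrow> ('i, 'k::field) mpol"
  assumes P: "mp.subspace P"
  shows "indep_mod P b {..<h} \<longleftrightarrow>
    (\<exists>\<phi>. (\<forall>i<h. functional (\<phi> i) \<and> (\<forall>x\<in>P. \<phi> i x = 0)) \<and> det (pairing_mat h \<phi> b) \<noteq> 0)"
proof
  assume "indep_mod P b {..<h}"
  then obtain \<phi> where \<phi>: "\<forall>i<h. functional (\<phi> i) \<and> (\<forall>x\<in>P. \<phi> i x = 0) \<and> (\<forall>j<h. \<phi> i (b j) = (if i = j then 1 else 0))"
    using indep_mod_dual_functionals[OF P] by metis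
  then have "pairing_mat h \<phi> b = 1\<^sub>m h" by (intro eq_matI) (auto simp: pairing_mat_def)
  then have "det (pairing_mat h \<phi> b) \<noteq> 0" by simp
  then show "\<exists>\<phi>. (\<forall>i<h. functional (\<phi> i) \<and> (\<forall>x\<in>P. \<phi> i x = 0)) \<and> det (pairing_mat h \<phi> b) \<noteq> 0"
    using \<phi> by blast
next
  assume "\<exists>\<phi>. (\<forall>i<h. functional (\<phi> i) \<and> (\<forall>x\<in>P. \<phi> i x = 0)) \<and> det (pairing_mat h \<phi> b) \<noteq> 0"
  then obtain \<phi> where \<phi>: "\<And>i. i < h \<Longrightarrow> functional (\<phi> i)" "\<And>i x. i < h \<Longrightarrow> x \<in> P \<Longrightarrow> \<phi> i x = 0"
    "det (pairing_mat h \<phi> b) \<noteq> 0" by blast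
  have G: "pairing_mat h \<phi> b \<in> carrier_mat h h" by (simp add: pairing_mat_def)
  show "indep_mod P b {..<h}"
    unfolding indep_mod_def
  proof (intro allI impI ballI)
    fix c j assume c: "(\<Sum>j<h. cst (c j) * b j) \<in> P" and j: "j \<in> {..<h}"
    have "pairing_mat h \<phi> b *\<^sub>v vec h c = 0\<^sub>v h"
    proof (rule eq_vecI)
      fix i assume i: "i < dim_vec (0\<^sub>v h :: 'k vec)"
      then have "(pairing_mat h \<phi> b *\<^sub>v vec h c) $ i = (\<Sum>j<h. \<phi> i (b j) * c j)"
        by (simp add: pairing_mat_def scalar_prod_def atLeast0LessThan)
      also have "\<dots> = (\<Sum>j<h. c j * \<phi> i (b j))"
        by (simp add: mult.commute)
      also have "\<dots> = \<phi> i (\<Sum>j<h. cst (c j) * b j)"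
        using i \<phi>(1)[of i] by (simp add: functional_simps)
      also have "\<dots> = 0" using \<phi>(2)[of i] c i by simp
      finally show "(pairing_mat h \<phi> b *\<^sub>v vec h c) $ i = 0\<^sub>v h $ i" using i by simp
    qed (simp add: pairing_mat_def)
    then have "vec h c = 0\<^sub>v h"
      using det_0_iff_vec_prod_zero_field[OF G] \<phi>(3) vec_carrier[of h c] by blast
    then have "vec h c $ j = 0\<^sub>v h $ j" by simp
    then show "c j = 0" using j by simp
  qed
qed

lemma growth_ge_iff:
  assumes P: "ideal P (poly_ring V)" and W: "finite W"
  shows "h \<le> growth P g W J \<longleftrightarrow>
    (\<exists>\<mu>. (\<forall>j<h. \<mu> j \<in> MonL W J) \<and> indep_mod P (\<lambda>j. mpow g (\<mu> j)) {..<h})"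
proof
  assume h: "h \<le> growth P g W J"
  obtain B where B: "B \<subseteq> MonL W J" "finite B" "card B = growth P g W J" "indep_mod P (mpow g) B"
    using growth_basis[OF P W] by metis
  obtain \<mu> where \<mu>: "bij_betw \<mu> {0..<card B} B" using ex_bij_betw_nat_finite[OF B(2)] by blast
  have inj: "inj_on \<mu> {..<h}"
    using \<mu> h B(3) by (auto simp: bij_betw_def intro: inj_on_subset)
  have sub: "\<mu> ` {..<h} \<subseteq> B" using \<mu> h B(3) by (auto simp: bij_betw_def)
  have "indep_mod P (\<lambda>j. mpow g (\<mu> j)) {..<h}"
    unfolding indep_mod_def
  proof (intro allI impI ballI)
    fix c j assume c: "(\<Sum>j<h. cst (c j) * mpow g (\<mu> j)) \<in> P" and j: "j \<in> {..<h}"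
    let ?c = "\<lambda>m. c (the_inv_into {..<h} \<mu> m)"
    have "(\<Sum>m\<in>\<mu> ` {..<h}. cst (?c m) * mpow g m) = (\<Sum>j<h. cst (c j) * mpow g (\<mu> j))"
      by (subst sum.reindex[OF inj]) (auto simp: the_inv_into_f_f[OF inj] intro!: sum.cong)
    then have "?c (\<mu> j) = 0"
      using indep_modD[OF indep_mod_subset[OF B(4) sub B(2)], of ?c "\<mu> j"] c j by simp
    then show "c j = 0" using j by (simp add: the_inv_into_f_f[OF inj])
  qed
  then show "\<exists>\<mu>. (\<forall>j<h. \<mu> j \<in> MonL W J) \<and> indep_mod P (\<lambda>j. mpow g (\<mu> j)) {..<h}"
    using sub B(1) by (intro exI[of _ \<mu>]) auto
next
  assume "\<exists>\<mu>. (\<forall>j<h. \<mu> j \<in> MonL W J) \<and> indep_mod P (\<lambda>j. mpow g (\<mu> j)) {..<h}"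
  then obtain \<mu> where \<mu>: "\<And>j. j < h \<Longrightarrow> \<mu> j \<in> MonL W J" "indep_mod P (\<lambda>j. mpow g (\<mu> j)) {..<h}" by blast
  have "card {..<h} \<le> growth P g W J"
    unfolding growth_def
    by (rule indep_mod_le_rank[OF ideal_subspace[OF P] _ _ \<mu>(2)]) (use W \<mu>(1) in \<open>auto intro!: mp.span_base\<close>)
  then show "h \<le> growth P g W J" by simp
qed

lemma zariski_open_growth:
  assumes P: "ideal P (poly_ring V)" and W: "finite W"
    and f: "\<And>i. i \<in> W \<Longrightarrow> form_family A 1 (\<lambda>v. f v i)"
  shows "zariski_open A {proj_point A v | v. v \<in> proj_vectors A \<and> h \<le> growth P (f v) W J}"
proof -
  let ?D = "{\<lambda>v. det (pairing_mat h \<phi> (\<lambda>j. mpow (f v) (\<mu> j))) | \<phi> \<mu>.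
      (\<forall>i<h. functional (\<phi> i) \<and> (\<forall>x\<in>P. \<phi> i x = 0)) \<and> (\<forall>j<h. \<mu> j \<in> MonL W J)}"
  have "\<exists>e. form_fun A e g" if gD: "g \<in> ?D" for g
  proof -
    obtain \<phi> \<mu> where g: "g = (\<lambda>v. det (pairing_mat h \<phi> (\<lambda>j. mpow (f v) (\<mu> j))))"
      "\<forall>i<h. functional (\<phi> i)" "\<forall>j<h. \<mu> j \<in> MonL W J"
      using gD by blast
    have "form_fun A (\<Sum>j<h. mon_degree (\<mu> j)) g"
      unfolding g(1)
    proof (rule form_fun_det_pairing)
      show "form_family A (mon_degree (\<mu> j)) (\<lambda>v. mpow (f v) (\<mu> j))" if "j < h" for j
        by (rule form_family_mpow[OF f]) (use g(3) that in \<open>auto simp: MonL_def\<close>)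
    qed (use g(2) in auto)
    then show ?thesis by blast
  qed
  then have "zariski_open A {proj_point A v | v. v \<in> proj_vectors A \<and> (\<exists>g\<in>?D. g v \<noteq> 0)}"
    by (rule zariski_open_nonvanishing)
  moreover have "(\<exists>g\<in>?D. g v \<noteq> 0) \<longleftrightarrow> h \<le> growth P (f v) W J" for v
  proof
    assume "\<exists>g\<in>?D. g v \<noteq> 0"
    then obtain \<phi> \<mu> where *: "\<forall>i<h. functional (\<phi> i) \<and> (\<forall>x\<in>P. \<phi> i x = 0)" "\<forall>j<h. \<mu> j \<in> MonL W J"
      "det (pairing_mat h \<phi> (\<lambda>j. mpow (f v) (\<mu> j))) \<noteq> 0" by auto
    have "indep_mod P (\<lambda>j. mpow (f v) (\<mu> j)) {..<h}"
      unfolding indep_mod_iff_det[OF ideal_subspace[OF P]] using *(1,3) by (intro exI[of _ \<phi>] conjI)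
    then show "h \<le> growth P (f v) W J"
      unfolding growth_ge_iff[OF P W] using *(2) by (intro exI[of _ \<mu>] conjI)
  next
    assume "h \<le> growth P (f v) W J"
    then obtain \<mu> where \<mu>: "\<forall>j<h. \<mu> j \<in> MonL W J" "indep_mod P (\<lambda>j. mpow (f v) (\<mu> j)) {..<h}"
      unfolding growth_ge_iff[OF P W] by (elim exE conjE)
    then obtain \<phi> where \<phi>: "\<forall>i<h. functional (\<phi> i) \<and> (\<forall>x\<in>P. \<phi> i x = 0)"
      "det (pairing_mat h \<phi> (\<lambda>j. mpow (f v) (\<mu> j))) \<noteq> 0"
      unfolding indep_mod_iff_det[OF ideal_subspace[OF P]] by (elim exE conjE)
    let ?g = "\<lambda>v. det (pairing_mat h \<phi> (\<lambda>j. mpow (f v) (\<mu> j)))"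
    have "?g \<in> ?D" using \<phi>(1) \<mu>(1) by (intro CollectI exI[of _ \<phi>] exI[of _ \<mu>] conjI refl)
    then show "\<exists>g\<in>?D. g v \<noteq> 0" using \<phi>(2) by (intro bexI[of _ ?g])
  qed
  ultimately show ?thesis by simp
qed

section \<open>Krull dimension of a quotient of a polynomial ring\<close>

lemma ideal_of_closed:
  assumes "cring R" "I \<subseteq> carrier R" "\<zero>\<^bsub>R\<^esub> \<in> I"
    and add: "\<And>x y. x \<in> I \<Longrightarrow> y \<in> I \<Longrightarrow> x \<oplus>\<^bsub>R\<^esub> y \<in> I"
    and mult: "\<And>a x. a \<in> carrier R \<Longrightarrow> x \<in> I \<Longrightarrow> a \<otimes>\<^bsub>R\<^esub> x \<in> I"
  shows "ideal I R"
proof -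
  interpret cring R by (rule assms(1))
  have neg: "\<ominus>\<^bsub>R\<^esub> x \<in> I" if "x \<in> I" for x
  proof -
    have "x \<in> carrier R" using that assms(2) by blast
    then have "\<ominus>\<^bsub>R\<^esub> x = (\<ominus>\<^bsub>R\<^esub> \<one>\<^bsub>R\<^esub>) \<otimes>\<^bsub>R\<^esub> x" by (simp add: l_minus)
    then show ?thesis using mult[OF _ that, of "\<ominus>\<^bsub>R\<^esub> \<one>\<^bsub>R\<^esub>"] by simp
  qed
  show ?thesis
  proof (rule idealI)
    show "ring R" by (rule ring_axioms)
    show "subgroup I (add_monoid R)"
    proof
      show "inv\<^bsub>add_monoid R\<^esub> x \<in> I" if "x \<in> I" for x
        using neg[OF that] by (simp add: a_inv_def)
    qed (use assms in auto)
    show "a \<otimes>\<^bsub>R\<^esub> x \<in> I" "x \<otimes>\<^bsub>R\<^esub> a \<in> I" if "x \<in> I" "a \<in> carrier R" for x a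
      using mult[OF that(2,1)] that assms(2) m_comm[of x a] by auto
  qed
qed

context
  fixes V :: "'i set" and B :: "('b, 'c) ring_scheme" and h :: "('i, 'k::field) mpol \<Rightarrow> 'b"
  assumes h: "ring_hom_cring (poly_ring V) B h" and surj: "h ` Pol V = carrier B"
begin

interpretation ring_hom_cring "poly_ring V" B h by (rule h)

lemma hom_Pol_simps:
  "f \<in> Pol V \<Longrightarrow> g \<in> Pol V \<Longrightarrow> h (f + g) = h f \<oplus>\<^bsub>B\<^esub> h g"
  "f \<in> Pol V \<Longrightarrow> g \<in> Pol V \<Longrightarrow> h (f * g) = h f \<otimes>\<^bsub>B\<^esub> h g"
  "h 0 = \<zero>\<^bsub>B\<^esub>"
  using hom_add[of f g] hom_mult[of f g] hom_zero by simp_all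

lemma hom_vimage_prime:
  assumes "primeideal Q B"
  shows "primeideal {f\<in>Pol V. h f \<in> Q} (poly_ring V)"
proof -
  interpret Q: primeideal Q B by (rule assms)
  show ?thesis
    unfolding poly_primeideal_iff poly_ideal_iff
  proof (intro conjI ballI impI)
    show "1 \<notin> {f\<in>Pol V. h f \<in> Q}"
      using hom_one Q.one_imp_carrier Q.I_notcarr by auto
    show "0 \<in> {f\<in>Pol V. h f \<in> Q}"
      using hom_zero Q.additive_subgroup_axioms additive_subgroup.zero_closed by fastforce
    show "f + g \<in> {f\<in>Pol V. h f \<in> Q}" if "f \<in> {f\<in>Pol V. h f \<in> Q}" "g \<in> {f\<in>Pol V. h f \<in> Q}" for f g
      using that hom_add[of f g] additive_subgroup.a_closed[OF Q.additive_subgroup_axioms] by auto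
    show "f * g \<in> {f\<in>Pol V. h f \<in> Q}" if "f \<in> Pol V" "g \<in> {f\<in>Pol V. h f \<in> Q}" for f g
      using that hom_mult[of f g] Q.I_l_closed[of "h g" "h f"] by auto
    show "f \<in> {f\<in>Pol V. h f \<in> Q} \<or> g \<in> {f\<in>Pol V. h f \<in> Q}"
      if "f \<in> Pol V" "g \<in> Pol V" "f * g \<in> {f\<in>Pol V. h f \<in> Q}" for f g
      using that hom_mult[of f g] Q.I_prime[of "h f" "h g"] by auto
  qed auto
qed

lemma hom_image_mem_iff:
  assumes P: "ideal P (poly_ring V)" and K: "\<And>f. f \<in> Pol V \<Longrightarrow> h f = \<zero>\<^bsub>B\<^esub> \<Longrightarrow> f \<in> P" and f: "f \<in> Pol V"
  shows "h f \<in> h ` P \<longleftrightarrow> f \<in> P"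
proof
  assume "h f \<in> h ` P"
  then obtain p where p: "p \<in> P" "h f = h p" by blast
  have pV: "p \<in> Pol V" using ideal_Pol[OF P p(1)] .
  have "h (f + (- p)) = h f \<oplus>\<^bsub>B\<^esub> h (- p)" by (rule hom_Pol_simps(1)[OF f Pol_uminus[OF pV]])
  also have "\<dots> = h p \<oplus>\<^bsub>B\<^esub> h (- p)" by (simp add: p(2))
  also have "\<dots> = h (p + (- p))" by (rule hom_Pol_simps(1)[OF pV Pol_uminus[OF pV], symmetric])
  finally have "h (f - p) = \<zero>\<^bsub>B\<^esub>" by (simp add: hom_Pol_simps(3))
  then have "f - p \<in> P" using K[OF Pol_minus[OF f pV]] by blast
  then show "f \<in> P" using ideal_diff_iff[OF P] p(1) by blast
qed auto

lemma hom_image_prime: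
  assumes P: "primeideal P (poly_ring V)" and K: "\<And>f. f \<in> Pol V \<Longrightarrow> h f = \<zero>\<^bsub>B\<^esub> \<Longrightarrow> f \<in> P"
  shows "primeideal (h ` P) B"
proof (rule primeidealI)
  note IP = prime_ideal[OF P]
  have mem: "h f \<in> h ` P \<longleftrightarrow> f \<in> P" if "f \<in> Pol V" for f
    by (rule hom_image_mem_iff[OF IP K that])
  have PV: "P \<subseteq> Pol V" using ideal_Pol[OF IP] by blast
  show "cring B" by (rule S.is_cring)
  then show "ideal (h ` P) B"
  proof (rule ideal_of_closed)
    show "h ` P \<subseteq> carrier B" using PV surj by blast
    have "h 0 = \<zero>\<^bsub>B\<^esub>" using hom_zero by simp
    then show "\<zero>\<^bsub>B\<^esub> \<in> h ` P" using ideal_zero[OF IP] by (metis imageI)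
    show "x \<oplus>\<^bsub>B\<^esub> y \<in> h ` P" if "x \<in> h ` P" "y \<in> h ` P" for x y
    proof -
      obtain p q where pq: "p \<in> P" "q \<in> P" "x = h p" "y = h q" using \<open>x \<in> h ` P\<close> \<open>y \<in> h ` P\<close> by blast
      then have pV: "p \<in> Pol V" "q \<in> Pol V" using PV by auto
      have "x \<oplus>\<^bsub>B\<^esub> y = h (p + q)" by (simp only: pq(3,4) hom_Pol_simps(1)[OF pV])
      then show ?thesis using imageI[OF ideal_add[OF IP pq(1,2)], of h] by (simp only:)
    qed
    show "a \<otimes>\<^bsub>B\<^esub> x \<in> h ` P" if "a \<in> carrier B" "x \<in> h ` P" for a x
    proof -
      obtain f where f: "f \<in> Pol V" "a = h f" using \<open>a \<in> carrier B\<close> surj by blast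
      obtain p where p: "p \<in> P" "x = h p" using \<open>x \<in> h ` P\<close> by blast
      have pV: "p \<in> Pol V" using PV p(1) by auto
      have "a \<otimes>\<^bsub>B\<^esub> x = h (f * p)" by (simp only: f(2) p(2) hom_Pol_simps(2)[OF f(1) pV])
      then show ?thesis using imageI[OF ideal_mult[OF IP f(1) p(1)], of h] by (simp only:)
    qed
  qed
  show "carrier B \<noteq> h ` P"
  proof
    assume "carrier B = h ` P"
    then have "h 1 \<in> h ` P" using surj by blast
    then show False using mem[OF Pol_intros(2)] prime_one[OF P] by blast
  qed
  show "a \<in> h ` P \<or> b \<in> h ` P" if ab: "a \<in> carrier B" "b \<in> carrier B" "a \<otimes>\<^bsub>B\<^esub> b \<in> h ` P" for a b
  proof -
    obtain f g where fg: "f \<in> Pol V" "a = h f" "g \<in> Pol V" "b = h g" using ab(1,2) surj by blast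
    then have "h (f * g) \<in> h ` P" using ab(3) hom_Pol_simps(2)[of f g] by simp
    then have "f * g \<in> P" using mem[of "f * g"] Pol_mult[OF fg(1,3)] by blast
    then show ?thesis using prime_mult[OF P] fg by blast
  qed
qed

end

text \<open>The primes of the image are the primes above the kernel \<open>P\<close>. The growth modulo \<open>P\<close> bounds
  the length of their chains, and an independent set of variables produces a chain of that length.\<close>
theorem krull_dim_hom_image:
  fixes V :: "nat set" and h :: "(nat, 'k::field) mpol \<Rightarrow> 'b"
  assumes h: "ring_hom_cring (poly_ring V) B h" and surj: "h ` Pol V = carrier B"
    and K: "\<And>f. f \<in> Pol V \<Longrightarrow> h f = \<zero>\<^bsub>B\<^esub> \<longleftrightarrow> f \<in> P"
    and P: "primeideal P (poly_ring V)" "graded P" and V: "finite V"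
  shows "krull_dim B = enat (vdim V P)"
proof (rule antisym)
  show "krull_dim B \<le> enat (vdim V P)"
    unfolding krull_dim_def
  proof (rule SUP_least)
    fix l assume "l \<in> {l. \<exists>C. (\<forall>i\<le>l. primeideal (C i) B) \<and> (\<forall>i<l. C i \<subset> C (Suc i))}"
    then obtain C where C: "\<And>i. i \<le> l \<Longrightarrow> primeideal (C i) B" "\<And>i. i < l \<Longrightarrow> C i \<subset> C (Suc i)" by blast
    let ?C = "\<lambda>i. {f\<in>Pol V. h f \<in> C i}"
    have pr: "primeideal (?C i) (poly_ring V)" if "i \<le> l" for i
      by (rule hom_vimage_prime[OF h surj C(1)[OF that]])
    have "?C i \<subset> ?C (Suc i)" if i: "i < l" for i
    proof -
      have "C (Suc i) \<subseteq> h ` Pol V"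
        using primeideal.axioms(1)[OF C(1)[of "Suc i"]] i surj
        by (metis Suc_leI additive_subgroup.a_subset ideal.axioms(1))
      then show ?thesis using C(2)[OF i] by blast
    qed
    moreover have "P \<subseteq> ?C 0"
    proof
      fix f assume f: "f \<in> P"
      then have fV: "f \<in> Pol V" using ideal_Pol[OF prime_ideal[OF P(1)]] by blast
      then have "h f = \<zero>\<^bsub>B\<^esub>" using K f by blast
      moreover have "\<zero>\<^bsub>B\<^esub> \<in> C 0"
        using primeideal.axioms(1)[OF C(1)[of 0]] additive_subgroup.zero_closed ideal.axioms(1) by fastforce
      ultimately show "f \<in> ?C 0" using fV by simp
    qed
    then have g: "growth_le (?C 0) X V (vdim V P)"
      using growth_le_vdim[OF P(1) V]
      by (rule growth_le_supset[OF prime_ideal[OF P(1)] prime_ideal[OF pr[OF le0]] _ V])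
    ultimately have "l \<le> vdim V P"
      using prime_chain_length_le[of l ?C V, OF pr _ V g] by blast
    then show "enat l \<le> enat (vdim V P)" by simp
  qed
  obtain Y where Y: "Y \<subseteq> V" "indep_vars P Y" "card Y = vdim V P"
    using vdim_obtain[OF P(1) V] by blast
  obtain C where C: "C 0 = P" "\<And>i. i \<le> vdim V P \<Longrightarrow> primeideal (C i) (poly_ring V)"
    "\<And>i. i < vdim V P \<Longrightarrow> C i \<subset> C (Suc i)"
    using graded_prime_chain_exists[OF P V Y(1,2)] Y(3) by auto
  have PC: "P \<subseteq> C i" if "i \<le> vdim V P" for i
    using that
  proof (induction i)
    case (Suc i)
    then show ?case using C(3)[of i] by auto
  qed (simp add: C(1))
  have KC: "f \<in> C i" if "i \<le> vdim V P" "f \<in> Pol V" "h f = \<zero>\<^bsub>B\<^esub>" for i f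
    using PC[OF that(1)] K[OF that(2)] that(3) by blast
  have "primeideal (h ` C i) B" if "i \<le> vdim V P" for i
    by (rule hom_image_prime[OF h surj C(2)[OF that] KC[OF that]])
  moreover have "h ` C i \<subset> h ` C (Suc i)" if i: "i < vdim V P" for i
  proof -
    obtain f where f: "f \<in> C (Suc i)" "f \<notin> C i" using C(3)[OF i] by blast
    have fV: "f \<in> Pol V" using ideal_Pol[OF prime_ideal[OF C(2)[of "Suc i"]] f(1)] i by simp
    have "h f \<notin> h ` C i"
      using hom_image_mem_iff[OF h surj prime_ideal[OF C(2)[OF less_imp_le[OF i]]] KC[OF less_imp_le[OF i]] fV] f(2)
      by blast
    then show ?thesis using C(3)[OF i] f(1) by blast
  qed
  ultimately show "enat (vdim V P) \<le> krull_dim B"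
    unfolding krull_dim_def by (intro SUP_upper CollectI exI[of _ "\<lambda>i. h ` C i"]) auto
qed

section \<open>Residues modulo a prime ideal\<close>

context
  fixes V :: "'i set" and P :: "('i, 'k::field) mpol set"
  assumes P: "primeideal P (poly_ring V)"
begin

interpretation primeideal P "poly_ring V" by (rule P)

lemma residue_hom: "ring_hom_cring (poly_ring V) (poly_ring V Quot P) (residue V P)"
  using rcos_ring_hom_cring by (simp add: residue_def[abs_def])

lemma quot_cring: "cring (poly_ring V Quot P)"
  using residue_hom by (simp add: ring_hom_cring_def)

lemma residue_surj: "residue V P ` Pol V = carrier (poly_ring V Quot P)"
  by (auto simp: FactRing_def A_RCOSETS_def' residue_def)

lemma residue_eq_iff: "f \<in> Pol V \<Longrightarrow> g \<in> Pol V \<Longrightarrow> residue V P f = residue V P g \<longleftrightarrow> f - g \<in> P"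
  using quotient_eq_iff_same_a_r_cos[OF is_ideal, of f g] poly_ring_a_inv[of g V]
  by (simp add: residue_def a_minus_def)

lemma residue_simps:
  "f \<in> Pol V \<Longrightarrow> residue V P f \<in> carrier (poly_ring V Quot P)"
  "f \<in> Pol V \<Longrightarrow> g \<in> Pol V \<Longrightarrow> residue V P (f + g) = residue V P f \<oplus>\<^bsub>poly_ring V Quot P\<^esub> residue V P g"
  "f \<in> Pol V \<Longrightarrow> g \<in> Pol V \<Longrightarrow> residue V P (f * g) = residue V P f \<otimes>\<^bsub>poly_ring V Quot P\<^esub> residue V P g"
  "residue V P 1 = \<one>\<^bsub>poly_ring V Quot P\<^esub>" "residue V P 0 = \<zero>\<^bsub>poly_ring V Quot P\<^esub>"
proof -
  interpret h: ring_hom_cring "poly_ring V" "poly_ring V Quot P" "residue V P" by (rule residue_hom)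
  show "f \<in> Pol V \<Longrightarrow> residue V P f \<in> carrier (poly_ring V Quot P)" by (rule h.hom_closed)
  show "f \<in> Pol V \<Longrightarrow> g \<in> Pol V \<Longrightarrow> residue V P (f + g) = residue V P f \<oplus>\<^bsub>poly_ring V Quot P\<^esub> residue V P g"
    using h.hom_add[of f g] by simp
  show "f \<in> Pol V \<Longrightarrow> g \<in> Pol V \<Longrightarrow> residue V P (f * g) = residue V P f \<otimes>\<^bsub>poly_ring V Quot P\<^esub> residue V P g"
    using h.hom_mult[of f g] by simp
  show "residue V P 1 = \<one>\<^bsub>poly_ring V Quot P\<^esub>" using h.hom_one by simp
  show "residue V P 0 = \<zero>\<^bsub>poly_ring V Quot P\<^esub>" using h.hom_zero by simp
qed

lemma residue_zero_iff: "f \<in> Pol V \<Longrightarrow> residue V P f = \<zero>\<^bsub>poly_ring V Quot P\<^esub> \<longleftrightarrow> f \<in> P"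
  using residue_eq_iff[of f 0] residue_simps(5) by simp

lemma residue_sum:
  assumes "finite S" "\<And>i. i \<in> S \<Longrightarrow> a i \<in> Pol V"
  shows "residue V P (\<Sum>i\<in>S. a i) = finsum (poly_ring V Quot P) (\<lambda>i. residue V P (a i)) S"
proof -
  interpret A: cring "poly_ring V Quot P" by (rule quot_cring)
  show ?thesis
    using assms
  proof (induction S rule: finite_induct)
    case (insert x S)
    then have "sum a S \<in> Pol V" by auto
    then show ?case using insert by (subst A.finsum_insert) (auto simp: residue_simps)
  qed (simp add: residue_simps)
qed

end

theorem krull_dim_quotient:
  fixes P :: "(nat, 'k::field) mpol set"
  assumes P: "primeideal P (poly_ring V)" "graded P" and V: "finite V"
  shows "krull_dim (poly_ring V Quot P) = enat (vdim V P)"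
  by (rule krull_dim_hom_image[OF residue_hom[OF P(1)] residue_surj[OF P(1)] residue_zero_iff[OF P(1)] P V])

section \<open>The special fiber\<close>

definition order_ge :: "'i set \<Rightarrow> nat \<Rightarrow> ('i, 'k::field) mpol set" where
  "order_ge V e = {h\<in>Pol V. \<forall>m\<in>Poly_Mapping.keys h. e \<le> mon_degree m}"

lemma order_ge_ideal: "ideal (order_ge V e) (poly_ring V)"
  unfolding poly_ideal_iff
proof (intro conjI ballI)
  show "f + g \<in> order_ge V e" if "f \<in> order_ge V e" "g \<in> order_ge V e" for f g :: "('a, 'b) mpol"
    using that Poly_Mapping.keys_add[of f g] by (auto simp: order_ge_def)
  show "f * g \<in> order_ge V e" if "f \<in> Pol V" "g \<in> order_ge V e" for f g :: "('a, 'b) mpol"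
    using that keys_mult[of f g] by (fastforce simp: order_ge_def mon_degree_add)
qed (auto simp: order_ge_def)

lemma order_ge_mult: "f \<in> order_ge V a \<Longrightarrow> g \<in> order_ge V b \<Longrightarrow> f * g \<in> order_ge V (a + b)"
  using keys_mult[of f g] by (fastforce simp: order_ge_def mon_degree_add)

lemma order_ge_Pol: "f \<in> order_ge V e \<Longrightarrow> f \<in> Pol V"
  by (simp add: order_ge_def)

lemma order_ge_hcomp: "f \<in> Pol V \<Longrightarrow> hcomp e f \<in> order_ge V e"
  by (auto simp: order_ge_def keys_hcomp)

lemma hcomp_order_ge: "f \<in> order_ge V (Suc e) \<Longrightarrow> hcomp e f = 0"
proof (rule poly_mapping_eqI)
  fix k assume "f \<in> order_ge V (Suc e)"
  then have "k \<notin> Poly_Mapping.keys f" if "mon_degree k = e" using that by (auto simp: order_ge_def)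
  then show "lk (hcomp e f) k = lk 0 k" by (auto simp: lookup_hcomp in_keys_iff)
qed

lemma Pol_induct [consumes 1, case_names cst var add mult]:
  assumes f: "f \<in> Pol W" and "\<And>c. Q (cst c)" "\<And>i. i \<in> W \<Longrightarrow> Q (X i)"
    and add: "\<And>f g. f \<in> Pol W \<Longrightarrow> g \<in> Pol W \<Longrightarrow> Q f \<Longrightarrow> Q g \<Longrightarrow> Q (f + g)"
    and mult: "\<And>f g. f \<in> Pol W \<Longrightarrow> g \<in> Pol W \<Longrightarrow> Q f \<Longrightarrow> Q g \<Longrightarrow> Q (f * g)"
  shows "Q f"
proof -
  have Q01: "Q 0" "Q 1" using assms(2)[of 0] assms(2)[of 1] by simp_all
  have pow: "Q (X i ^ e)" if "i \<in> W" for i e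
    using that by (induction e) (auto intro!: mult simp: Q01 assms(3))
  have mon: "Q (xpow m)" if m: "m \<in> Mon W" for m
  proof -
    have "Q (\<Prod>i\<in>A. X i ^ lk m i)" if "finite A" "A \<subseteq> W" for A
      using that
    proof (induction A rule: finite_induct)
      case (insert x A)
      then have "(\<Prod>i\<in>A. X i ^ lk m i) \<in> Pol W" by (intro Pol_prod Pol_power) auto
      then show ?case using insert by (auto intro!: mult pow)
    qed (simp add: Q01)
    from this[of "Poly_Mapping.keys m"] m show ?thesis
      unfolding mpow_X[symmetric] mpow_def by (simp add: Mon_def)
  qed
  have "Q (\<Sum>m\<in>A. cst (lk f m) * xpow m)" if "finite A" "A \<subseteq> Mon W" for A
    using that
  proof (induction A rule: finite_induct)
    case (insert x A)
    then have "(\<Sum>m\<in>A. cst (lk f m) * xpow m) \<in> Pol W" by (intro Pol_sum Pol_mult) auto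
    then show ?case using insert by (auto intro!: add mult mon assms(2))
  qed (simp add: Q01)
  from this[of "Poly_Mapping.keys f"] f show ?thesis
    using mpol_expand[of f] by (simp add: Pol_iff)
qed

text \<open>Forms \<open>f i\<close> of the same degree \<open>d\<close> in a standard graded domain \<open>A\<close>. Below, \<open>II\<close> is the ideal
  that they generate, \<open>RR\<close> its Rees algebra, \<open>mm\<close> the irrelevant ideal of \<open>A\<close>, \<open>JJ\<close> its extension
  to \<open>RR\<close> and \<open>F\<close> the special fiber.\<close>
locale fiber =
  fixes V :: "nat set" and P :: "(nat, 'k::field) mpol set"
    and W :: "nat set" and f :: "nat \<Rightarrow> (nat, 'k) mpol" and d :: nat
  assumes P: "primeideal P (poly_ring V)" "graded P"
    and f: "\<And>i. i \<in> W \<Longrightarrow> f i \<in> Pol V" "\<And>i. i \<in> W \<Longrightarrow> hcomp d (f i) = f i" and d: "d > 0"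
begin

abbreviation "A \<equiv> poly_ring V Quot P"
abbreviation "U \<equiv> UP A"
abbreviation "\<rho> \<equiv> residue V P"
abbreviation "II \<equiv> genideal A (\<rho> ` f ` W)"
abbreviation "RR \<equiv> rees_algebra A II"
abbreviation "mm \<equiv> irrelevant_ideal V P"
abbreviation "JJ \<equiv> genideal RR ((\<lambda>a. monom U a 0) ` mm)"

sublocale UP_cring A U
  by (simp_all add: UP_cring_def quot_cring[OF P(1)])

lemmas \<rho>_simps = residue_simps[OF P(1)]

lemma \<rho>_obtain: assumes "a \<in> carrier A" obtains g where "g \<in> Pol V" "a = \<rho> g"
  using assms residue_surj[OF P(1)] by blast

lemma \<rho>_image_ideal:
  assumes "ideal L (poly_ring V)"
  shows "ideal (\<rho> ` L) A"
proof (rule ideal_of_closed[OF quot_cring[OF P(1)]])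
  note L = ideal_Pol[OF assms]
  show "\<rho> ` L \<subseteq> carrier A" using L \<rho>_simps(1) by blast
  show "\<zero>\<^bsub>A\<^esub> \<in> \<rho> ` L" using ideal_zero[OF assms] \<rho>_simps(5) by (metis imageI)
  show "x \<oplus>\<^bsub>A\<^esub> y \<in> \<rho> ` L" if xy: "x \<in> \<rho> ` L" "y \<in> \<rho> ` L" for x y
  proof -
    obtain p q where pq: "p \<in> L" "q \<in> L" "x = \<rho> p" "y = \<rho> q" using xy by blast
    then show ?thesis using imageI[OF ideal_add[OF assms pq(1,2)], of \<rho>] \<rho>_simps(2)[OF L L] by simp
  qed
  show "a \<otimes>\<^bsub>A\<^esub> x \<in> \<rho> ` L" if ax: "a \<in> carrier A" "x \<in> \<rho> ` L" for a x
  proof -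
    obtain g where g: "g \<in> Pol V" "a = \<rho> g" using \<rho>_obtain[OF ax(1)] by blast
    obtain p where p: "p \<in> L" "x = \<rho> p" using ax(2) by blast
    then show ?thesis using imageI[OF ideal_mult[OF assms g(1) p(1)], of \<rho>] \<rho>_simps(3)[OF g(1) L] g(2) by simp
  qed
qed

lemma \<rho>_f_carrier: "\<rho> ` f ` W \<subseteq> carrier A"
  using f(1) \<rho>_simps(1) by blast

lemma II_ideal: "ideal II A"
  by (rule R.genideal_ideal[OF \<rho>_f_carrier])

lemma II_minimal: "ideal K A \<Longrightarrow> (\<And>i. i \<in> W \<Longrightarrow> \<rho> (f i) \<in> K) \<Longrightarrow> II \<subseteq> K"
  by (rule R.genideal_minimal) auto

lemma II_f: "i \<in> W \<Longrightarrow> \<rho> (f i) \<in> II"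
  using R.genideal_self[OF \<rho>_f_carrier] by blast

lemma II_carrier: "a \<in> II \<Longrightarrow> a \<in> carrier A"
  using ideal.Icarr[OF II_ideal] by blast

lemma coeff_U: "p \<in> carrier U \<Longrightarrow> coeff U p = p"
  by (auto simp: UP_def)

lemma RR_simps [simp]:
  "mult RR = mult U" "add RR = add U" "one RR = one U" "zero RR = zero U"
  by (simp_all add: rees_algebra_def)

lemma gens_carrier:
  "(\<lambda>a. monom U a 0) ` carrier A \<union> (\<lambda>a. monom U a 1) ` II \<subseteq> carrier U"
  using II_carrier by auto

lemma carrier_RR: "carrier RR = generate_ring U ((\<lambda>a. monom U a 0) ` carrier A \<union> (\<lambda>a. monom U a 1) ` II)"
  by (simp add: rees_algebra_def)

lemma RR_sub: "p \<in> carrier RR \<Longrightarrow> p \<in> carrier U"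
  unfolding carrier_RR by (rule P.generate_ring_in_carrier[OF gens_carrier])

lemma RR_ring: "ring RR"
  unfolding rees_algebra_def by (rule P.generate_ring_is_ring[OF gens_carrier])

lemma RR_cring: "cring RR"
proof -
  interpret r: ring RR by (rule RR_ring)
  show ?thesis
  proof (intro cring.intro RR_ring comm_monoid.intro comm_monoid_axioms.intro)
    show "Group.monoid RR" by (rule r.monoid_axioms)
    show "x \<otimes>\<^bsub>RR\<^esub> y = y \<otimes>\<^bsub>RR\<^esub> x" if "x \<in> carrier RR" "y \<in> carrier RR" for x y
      using P.m_comm[OF RR_sub RR_sub, OF that] by simp
  qed
qed

lemma RR_monom0: "a \<in> carrier A \<Longrightarrow> monom U a 0 \<in> carrier RR"
  and RR_monom1: "a \<in> II \<Longrightarrow> monom U a 1 \<in> carrier RR"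
  and RR_add: "p \<in> carrier RR \<Longrightarrow> q \<in> carrier RR \<Longrightarrow> p \<oplus>\<^bsub>U\<^esub> q \<in> carrier RR"
  and RR_mult: "p \<in> carrier RR \<Longrightarrow> q \<in> carrier RR \<Longrightarrow> p \<otimes>\<^bsub>U\<^esub> q \<in> carrier RR"
  unfolding carrier_RR by (auto intro: generate_ring.intros)

lemma mm_eq: "mm = \<rho> ` {g\<in>Pol V. lk g 0 = 0}"
  by (simp add: irrelevant_ideal_def)

lemma JJ_gens: "(\<lambda>a. monom U a 0) ` mm \<subseteq> carrier RR"
  using RR_monom0 \<rho>_simps(1) by (auto simp: mm_eq)

lemma JJ_ideal: "ideal JJ RR"
  by (rule ring.genideal_ideal[OF RR_ring JJ_gens])

text \<open>The substitution of \<open>f i\<close> times the variable of \<open>U\<close> for the variable \<open>i\<close>: the component of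
  degree \<open>j\<close> becomes the coefficient of index \<open>j\<close>.\<close>
definition E :: "(nat, 'k) mpol \<Rightarrow> nat \<Rightarrow> (nat, 'k) mpol set" where
  "E g = (\<lambda>j. \<rho> (psubst f (hcomp j g)))"

lemma psubst_f_Pol: "g \<in> Pol W \<Longrightarrow> psubst f g \<in> Pol V"
  by (rule psubst_Pol[of W f V, OF f(1)])

lemma E_carrier:
  assumes g: "g \<in> Pol W"
  shows "E g \<in> carrier U"
proof -
  obtain J where J: "g \<in> PolL W J" using PolL_obtain[OF g] by blast
  have "hcomp j g = 0" if "J < j" for j
    using J that by (intro poly_mapping_eqI) (auto simp: lookup_hcomp PolL_def MonL_def in_keys_iff)
  then have "bound \<zero>\<^bsub>A\<^esub> J (E g)"
    by (intro bound.intro) (simp add: E_def psubst_zero \<rho>_simps(5))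
  moreover have "E g j \<in> carrier A" for j
    unfolding E_def by (intro \<rho>_simps(1) psubst_f_Pol hcomp_Pol g)
  ultimately have "E g \<in> up A" by (intro mem_upI) auto
  then show ?thesis by (simp add: UP_def)
qed

lemma coeff_E: "g \<in> Pol W \<Longrightarrow> coeff U (E g) j = \<rho> (psubst f (hcomp j g))"
  using coeff_U[OF E_carrier] by (simp add: E_def)

lemma E_add:
  assumes "g \<in> Pol W" "g' \<in> Pol W"
  shows "E (g + g') = E g \<oplus>\<^bsub>U\<^esub> E g'"
proof (rule up_eqI)
  have s: "g + g' \<in> Pol W" using assms by auto
  show "coeff U (E (g + g')) n = coeff U (E g \<oplus>\<^bsub>U\<^esub> E g') n" for n
    using assms s E_carrier by (simp add: coeff_E hcomp_add psubst_add \<rho>_simps(2) psubst_f_Pol hcomp_Pol)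
  show "E (g + g') \<in> carrier U" "E g \<oplus>\<^bsub>U\<^esub> E g' \<in> carrier U" using E_carrier assms s by auto
qed

lemma E_mult:
  assumes "g \<in> Pol W" "g' \<in> Pol W"
  shows "E (g * g') = E g \<otimes>\<^bsub>U\<^esub> E g'"
proof (rule up_eqI)
  have s: "g * g' \<in> Pol W" using assms by auto
  show "coeff U (E (g * g')) n = coeff U (E g \<otimes>\<^bsub>U\<^esub> E g') n" for n
  proof -
    have "coeff U (E (g * g')) n = \<rho> (\<Sum>i\<le>n. psubst f (hcomp i g) * psubst f (hcomp (n - i) g'))"
      using s by (simp add: coeff_E hcomp_mult psubst_sum psubst_mult)
    also have "\<dots> = finsum A (\<lambda>i. \<rho> (psubst f (hcomp i g) * psubst f (hcomp (n - i) g'))) {..n}"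
      using assms by (intro residue_sum[OF P(1)] Pol_mult psubst_f_Pol hcomp_Pol) auto
    also have "\<dots> = finsum A (\<lambda>i. coeff U (E g) i \<otimes>\<^bsub>A\<^esub> coeff U (E g') (n - i)) {..n}"
      using assms psubst_f_Pol
      by (intro R.finsum_cong' refl funcsetI R.m_closed coeff_closed E_carrier)
        (simp_all add: coeff_E \<rho>_simps(3) hcomp_Pol)
    also have "\<dots> = coeff U (E g \<otimes>\<^bsub>U\<^esub> E g') n"
      using assms E_carrier by simp
    finally show ?thesis .
  qed
  show "E (g * g') \<in> carrier U" "E g \<otimes>\<^bsub>U\<^esub> E g' \<in> carrier U" using E_carrier assms s by auto
qed

lemma hcomp_cst: "hcomp j (cst c) = (if j = 0 then cst c else 0)"
  by (auto simp: cst_def hcomp_single)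

lemma E_cst: "E (cst c) = monom U (\<rho> (cst c)) 0"
proof (rule up_eqI)
  show "coeff U (E (cst c)) n = coeff U (monom U (\<rho> (cst c)) 0) n" for n
    using \<rho>_simps(1)[OF Pol_intros(3)] by (simp add: coeff_E hcomp_cst psubst_cst psubst_zero \<rho>_simps(5))
  show "E (cst c) \<in> carrier U" "monom U (\<rho> (cst c)) 0 \<in> carrier U"
    using E_carrier \<rho>_simps(1) by auto
qed

lemma E_one: "E 1 = \<one>\<^bsub>U\<^esub>"
  using E_cst[of 1] \<rho>_simps(4) monom_one by simp

lemma hcomp_X': "hcomp j (X i) = (if j = 1 then X i else 0)"
  by (simp add: X_def hcomp_single)

lemma E_X:
  assumes i: "i \<in> W"
  shows "E (X i) = monom U (\<rho> (f i)) 1"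
proof (rule up_eqI)
  have X: "X i \<in> Pol W" using i by simp
  show "coeff U (E (X i)) n = coeff U (monom U (\<rho> (f i)) 1) n" for n
    using \<rho>_simps(1)[OF f(1)[OF i]] X by (simp add: coeff_E hcomp_X' psubst_X psubst_zero \<rho>_simps(5))
  show "E (X i) \<in> carrier U" "monom U (\<rho> (f i)) 1 \<in> carrier U"
    using E_carrier[OF X] \<rho>_simps(1)[OF f(1)[OF i]] by auto
qed

lemma E_RR: "g \<in> Pol W \<Longrightarrow> E g \<in> carrier RR"
proof (induction rule: Pol_induct)
  case (cst c)
  then show ?case using RR_monom0 \<rho>_simps(1) by (simp add: E_cst)
next
  case (var i)
  then show ?case using RR_monom1[OF II_f[OF var]] by (simp only: E_X)
qed (simp_all add: E_add E_mult RR_add RR_mult)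

abbreviation "F \<equiv> special_fiber A mm II"
abbreviation "\<pi> \<equiv> (\<lambda>p. JJ +>\<^bsub>RR\<^esub> p)"

lemma F_eq: "F = RR Quot JJ"
  by (simp add: special_fiber_def)

lemma \<pi>_hom: "ring_hom_cring RR F \<pi>"
  unfolding F_eq by (rule ideal.rcos_ring_hom_cring[OF JJ_ideal RR_cring])

lemma F_cring: "cring F"
  using \<pi>_hom by (simp add: ring_hom_cring_def)

lemma \<pi>_surj: "\<pi> ` carrier RR = carrier F"
  unfolding F_eq by (auto simp: FactRing_def A_RCOSETS_def')

lemma \<pi>_zero_iff: "p \<in> carrier RR \<Longrightarrow> \<pi> p = \<zero>\<^bsub>F\<^esub> \<longleftrightarrow> p \<in> JJ"
  unfolding F_eq using ideal.rcos_const_imp_mem[OF JJ_ideal, of p] ring.a_rcos_zero[OF RR_ring JJ_ideal, of p]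
  by (auto simp: FactRing_def)

lemma \<pi>_simps:
  assumes "p \<in> carrier RR" "q \<in> carrier RR"
  shows "\<pi> (p \<oplus>\<^bsub>U\<^esub> q) = \<pi> p \<oplus>\<^bsub>F\<^esub> \<pi> q" "\<pi> (p \<otimes>\<^bsub>U\<^esub> q) = \<pi> p \<otimes>\<^bsub>F\<^esub> \<pi> q"
    "\<pi> \<one>\<^bsub>U\<^esub> = \<one>\<^bsub>F\<^esub>"
proof -
  interpret h: ring_hom_cring RR F \<pi> by (rule \<pi>_hom)
  show "\<pi> (p \<oplus>\<^bsub>U\<^esub> q) = \<pi> p \<oplus>\<^bsub>F\<^esub> \<pi> q" "\<pi> (p \<otimes>\<^bsub>U\<^esub> q) = \<pi> p \<otimes>\<^bsub>F\<^esub> \<pi> q"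
    "\<pi> \<one>\<^bsub>U\<^esub> = \<one>\<^bsub>F\<^esub>"
    using h.hom_add[OF assms] h.hom_mult[OF assms] h.hom_one by simp_all
qed

definition \<Phi> :: "(nat, 'k) mpol \<Rightarrow> (nat \<Rightarrow> (nat, 'k) mpol set) set" where
  "\<Phi> g = \<pi> (E g)"

lemma \<Phi>_hom: "ring_hom_cring (poly_ring W) F \<Phi>"
proof (rule ring_hom_cringI[OF poly_ring_cring F_cring])
  show "\<Phi> \<in> ring_hom (poly_ring W) F"
  proof (rule ring_hom_memI)
    fix g g' :: "(nat, 'k) mpol" assume g: "g \<in> Pol W" "g' \<in> Pol W"
    show "\<Phi> g \<in> carrier F" using \<pi>_surj E_RR[OF g(1)] by (auto simp: \<Phi>_def)
    show "\<Phi> (g \<otimes>\<^bsub>poly_ring W\<^esub> g') = \<Phi> g \<otimes>\<^bsub>F\<^esub> \<Phi> g'" "\<Phi> (g \<oplus>\<^bsub>poly_ring W\<^esub> g') = \<Phi> g \<oplus>\<^bsub>F\<^esub> \<Phi> g'"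
      using g E_RR by (simp_all add: \<Phi>_def E_add E_mult \<pi>_simps)
  next
    show "\<Phi> \<one>\<^bsub>poly_ring W\<^esub> = \<one>\<^bsub>F\<^esub>"
      using \<pi>_simps(3)[OF E_RR E_RR, of 1 1] by (simp add: \<Phi>_def E_one)
  qed
qed

text \<open>Modulo \<open>JJ\<close> the coefficients in \<open>A\<close> become constants, so that the special fiber is generated
  over the field by the classes of the \<open>f i\<close> placed in degree one.\<close>
lemma \<Phi>_surj: "\<Phi> ` Pol W = carrier F"
proof -
  interpret h: ring_hom_cring "poly_ring W" F \<Phi> by (rule \<Phi>_hom)
  interpret F: cring F by (rule F_cring)
  have \<Phi>_add: "\<Phi> g \<oplus>\<^bsub>F\<^esub> \<Phi> g' \<in> \<Phi> ` Pol W" if "g \<in> Pol W" "g' \<in> Pol W" for g g'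
    using h.hom_add[OF that] Pol_add[OF that] by (metis imageI poly_ring_simps(4))
  have \<Phi>_mult: "\<Phi> g \<otimes>\<^bsub>F\<^esub> \<Phi> g' \<in> \<Phi> ` Pol W" if "g \<in> Pol W" "g' \<in> Pol W" for g g'
    using h.hom_mult[OF that] Pol_mult[OF that] by (metis imageI poly_ring_simps(1))
  define T where "T = {p\<in>carrier RR. \<pi> p \<in> \<Phi> ` Pol W}"
  have T_add: "p \<oplus>\<^bsub>U\<^esub> q \<in> T" if "p \<in> T" "q \<in> T" for p q
    using that \<Phi>_add by (auto simp: T_def RR_add \<pi>_simps)
  have T_mult: "p \<otimes>\<^bsub>U\<^esub> q \<in> T" if "p \<in> T" "q \<in> T" for p q
    using that \<Phi>_mult by (auto simp: T_def RR_mult \<pi>_simps)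
  have T_E: "E g \<in> T" if "g \<in> Pol W" for g
    using that E_RR by (auto simp: T_def \<Phi>_def)
  have T_const: "monom U a 0 \<in> T" if a: "a \<in> carrier A" for a
  proof -
    obtain g where g: "g \<in> Pol V" "a = \<rho> g" using \<rho>_obtain[OF a] by blast
    define c where "c = lk g 0"
    have gc: "g - cst c \<in> Pol V" using g(1) by auto
    have "lk (g - cst c) 0 = 0" by (simp add: c_def lookup_minus cst_def)
    then have "monom U (\<rho> (g - cst c)) 0 \<in> (\<lambda>a. monom U a 0) ` mm"
      using gc by (auto simp: mm_eq)
    then have J: "monom U (\<rho> (g - cst c)) 0 \<in> JJ"
      using ring.genideal_self[OF RR_ring JJ_gens] by blast
    have R1: "monom U (\<rho> (g - cst c)) 0 \<in> carrier RR" "monom U (\<rho> (cst c)) 0 \<in> carrier RR"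
      using RR_monom0 \<rho>_simps(1)[OF gc] \<rho>_simps(1)[OF Pol_intros(3)] by auto
    have "a = \<rho> (g - cst c) \<oplus>\<^bsub>A\<^esub> \<rho> (cst c)"
      using \<rho>_simps(2)[OF gc Pol_intros(3)[of c]] g(2) by simp
    then have "monom U a 0 = monom U (\<rho> (g - cst c)) 0 \<oplus>\<^bsub>U\<^esub> monom U (\<rho> (cst c)) 0"
      using monom_add[OF \<rho>_simps(1)[OF gc] \<rho>_simps(1)[OF Pol_intros(3)[of c]]] by simp
    then have "\<pi> (monom U a 0) = \<pi> (monom U (\<rho> (g - cst c)) 0) \<oplus>\<^bsub>F\<^esub> \<pi> (monom U (\<rho> (cst c)) 0)"
      using \<pi>_simps(1)[OF R1] by simp
    also have "\<pi> (monom U (\<rho> (g - cst c)) 0) = \<zero>\<^bsub>F\<^esub>" using \<pi>_zero_iff[OF R1(1)] J by blast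
    also have "\<pi> (monom U (\<rho> (cst c)) 0) = \<Phi> (cst c)" by (simp add: \<Phi>_def E_cst)
    finally have "\<pi> (monom U a 0) = \<Phi> (cst c)" using h.hom_closed[OF Pol_intros(3)] by simp
    then show ?thesis using RR_monom0[OF a] by (auto simp: T_def)
  qed
  let ?K = "{a\<in>carrier A. monom U a 1 \<in> T}"
  have "ideal ?K A"
  proof (rule ideal_of_closed[OF quot_cring[OF P(1)]])
    have "\<zero>\<^bsub>U\<^esub> \<in> T" using T_E[OF Pol_intros(1)] E_cst[of 0] \<rho>_simps(5) monom_zero by simp
    then show "\<zero>\<^bsub>A\<^esub> \<in> ?K" by simp
    show "x \<oplus>\<^bsub>A\<^esub> y \<in> ?K" if "x \<in> ?K" "y \<in> ?K" for x y
      using that T_add by auto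
    show "a \<otimes>\<^bsub>A\<^esub> x \<in> ?K" if "a \<in> carrier A" "x \<in> ?K" for a x
      using that T_mult[OF T_const[OF that(1)], of "monom U x 1"] monom_mult[of a x 0 1] by auto
  qed auto
  moreover have "\<rho> (f i) \<in> ?K" if i: "i \<in> W" for i
  proof -
    have "X i \<in> Pol W" using i by simp
    then show ?thesis using T_E[of "X i"] E_X[OF i] \<rho>_simps(1)[OF f(1)[OF i]] by simp
  qed
  ultimately have II_T: "II \<subseteq> ?K" by (rule II_minimal)
  have m1: "\<ominus>\<^bsub>U\<^esub> \<one>\<^bsub>U\<^esub> = E (cst (-1))"
  proof -
    have "E (cst (-1)) \<oplus>\<^bsub>U\<^esub> E 1 = E (cst (-1) + 1)" by (rule E_add[symmetric]) auto
    also have "cst (-1) + 1 = (cst 0 :: (nat, 'k) mpol)" using cst_add[of "-1" 1] by simp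
    also have "E (cst 0) = \<zero>\<^bsub>U\<^esub>" unfolding E_cst using \<rho>_simps(5) monom_zero by simp
    finally show ?thesis using P.minus_equality[of "E (cst (-1))" "\<one>\<^bsub>U\<^esub>"] E_carrier[OF Pol_intros(3)] by (simp add: E_one)
  qed
  have "p \<in> T" if "p \<in> carrier RR" for p
    using that unfolding carrier_RR
  proof (induction rule: generate_ring.induct)
    case one
    then show ?case using T_E[OF Pol_intros(2)] E_one by simp
  next
    case (incl h)
    then show ?case using T_const II_T by blast
  next
    case (a_inv h)
    then have "h \<in> carrier U" using RR_sub by (simp add: T_def)
    then have "\<ominus>\<^bsub>U\<^esub> h = E (cst (-1)) \<otimes>\<^bsub>U\<^esub> h" using P.l_minus[of "\<one>\<^bsub>U\<^esub>" h] m1 by simp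
    then show ?case using T_mult[OF T_E[OF Pol_intros(3)]] a_inv.IH by simp
  qed (simp_all add: T_add T_mult)
  then have "carrier F \<subseteq> \<Phi> ` Pol W" unfolding \<pi>_surj[symmetric] by (auto simp: T_def)
  moreover have "\<Phi> ` Pol W \<subseteq> carrier F" using h.hom_closed by auto
  ultimately show ?thesis by blast
qed

lemma ideal_finsum_closed:
  assumes "ideal K A" "finite S" "\<And>i. i \<in> S \<Longrightarrow> a i \<in> K"
  shows "finsum A a S \<in> K"
  using assms(2,3)
proof (induction S rule: finite_induct)
  case empty
  then show ?case using additive_subgroup.zero_closed[OF ideal.axioms(1)[OF assms(1)]] by simp
next
  case (insert x S)
  have "a \<in> insert x S \<rightarrow> carrier A" using insert.prems ideal.Icarr[OF assms(1)] by blast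
  then have "finsum A a (insert x S) = a x \<oplus>\<^bsub>A\<^esub> finsum A a S"
    using insert.hyps by (intro R.finsum_insert) auto
  then show ?case
    using insert additive_subgroup.a_closed[OF ideal.axioms(1)[OF assms(1)]] by simp
qed

abbreviation "L e \<equiv> \<rho> ` order_ge V e"

lemma L_ideal: "ideal (L e) A"
  by (rule \<rho>_image_ideal[OF order_ge_ideal])

lemma L_mult:
  assumes "a \<in> L i" "b \<in> L j"
  shows "a \<otimes>\<^bsub>A\<^esub> b \<in> L (i + j)"
proof -
  obtain p q where pq: "p \<in> order_ge V i" "a = \<rho> p" "q \<in> order_ge V j" "b = \<rho> q" using assms by blast
  then have "a \<otimes>\<^bsub>A\<^esub> b = \<rho> (p * q)" using \<rho>_simps(3)[OF order_ge_Pol order_ge_Pol] by simp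
  then show ?thesis using order_ge_mult[OF pq(1,3)] by (metis imageI)
qed

lemma L_zero: "\<zero>\<^bsub>A\<^esub> \<in> L e"
  by (rule additive_subgroup.zero_closed[OF ideal.axioms(1)[OF L_ideal]])

lemma L_add: "a \<in> L e \<Longrightarrow> b \<in> L e \<Longrightarrow> a \<oplus>\<^bsub>A\<^esub> b \<in> L e"
  by (rule additive_subgroup.a_closed[OF ideal.axioms(1)[OF L_ideal]])

lemma L_inv: "a \<in> L e \<Longrightarrow> \<ominus>\<^bsub>A\<^esub> a \<in> L e"
  by (rule additive_subgroup.a_inv_closed[OF ideal.axioms(1)[OF L_ideal]])

lemma L0: "L 0 = carrier A"
  using residue_surj[OF P(1)] by (simp add: order_ge_def)

lemma RR_order: "p \<in> carrier RR \<Longrightarrow> coeff U p j \<in> L (j * d)"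
  unfolding carrier_RR
proof (induction arbitrary: j rule: generate_ring.induct)
  case one
  show ?case using L_zero L0 by auto
next
  case (incl h)
  have II_L: "II \<subseteq> L d"
  proof (rule II_minimal[OF L_ideal])
    show "\<rho> (f i) \<in> L d" if "i \<in> W" for i
      using order_ge_hcomp[OF f(1)[OF that], of d] f(2)[OF that] by auto
  qed
  consider a where "a \<in> carrier A" "h = monom U a 0" | a where "a \<in> II" "h = monom U a 1"
    using incl by blast
  then show ?case
  proof cases
    case (1 a)
    then have "coeff U h j = (if 0 = j then a else \<zero>\<^bsub>A\<^esub>)" by simp
    then show ?thesis using 1(1) L_zero[of "j * d"] L0 by (cases "j = 0") simp_all
  next
    case (2 a)
    then have "coeff U h j = (if 1 = j then a else \<zero>\<^bsub>A\<^esub>)" using II_carrier[OF 2(1)] by simp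
    then show ?thesis using subsetD[OF II_L 2(1)] L_zero[of "j * d"] by (cases "j = 1") simp_all
  qed
next
  case (a_inv h)
  have "h \<in> carrier U" using P.generate_ring_in_carrier[OF gens_carrier a_inv.hyps] .
  then show ?case using L_inv[OF a_inv.IH] by simp
next
  case (eng_add h1 h2)
  have "h1 \<in> carrier U" "h2 \<in> carrier U" using P.generate_ring_in_carrier[OF gens_carrier] eng_add.hyps by blast+
  then show ?case using L_add[OF eng_add.IH] by simp
next
  case (eng_mult h1 h2)
  have h: "h1 \<in> carrier U" "h2 \<in> carrier U" using P.generate_ring_in_carrier[OF gens_carrier] eng_mult.hyps by blast+
  have "coeff U h1 i \<otimes>\<^bsub>A\<^esub> coeff U h2 (j - i) \<in> L (j * d)" if i: "i \<in> {..j}" for i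
  proof -
    have "i * d + (j - i) * d = j * d" using i by (simp add: distrib_right[symmetric])
    then show ?thesis using L_mult[OF eng_mult.IH(1)[of i] eng_mult.IH(2)[of "j - i"]] by simp
  qed
  then show ?case using h ideal_finsum_closed[OF L_ideal, of "{..j}"] by simp
qed

text \<open>The degree in \<open>A\<close> separates \<open>JJ\<close> from the image of \<open>E\<close>: the coefficients in degree \<open>j\<close> of
  an element of \<open>JJ\<close> are residues of polynomials of order greater than \<open>j d\<close>, those of \<open>E g\<close> are
  residues of forms of degree \<open>j d\<close>.\<close>
lemma JJ_order: "p \<in> JJ \<Longrightarrow> coeff U p j \<in> L (Suc (j * d))"
proof -
  let ?N = "{p\<in>carrier RR. \<forall>j. coeff U p j \<in> L (Suc (j * d))}"
  have "ideal ?N RR"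
  proof (rule ideal_of_closed[OF RR_cring])
    interpret r: ring RR by (rule RR_ring)
    have "\<zero>\<^bsub>U\<^esub> \<in> carrier RR" using r.zero_closed by simp
    then show "\<zero>\<^bsub>RR\<^esub> \<in> ?N" using L_zero by simp
    show "x \<oplus>\<^bsub>RR\<^esub> y \<in> ?N" if "x \<in> ?N" "y \<in> ?N" for x y
      using that RR_add RR_sub L_add by simp
    show "a \<otimes>\<^bsub>RR\<^esub> x \<in> ?N" if a: "a \<in> carrier RR" and x: "x \<in> ?N" for a x
    proof -
      have "coeff U (a \<otimes>\<^bsub>U\<^esub> x) j \<in> L (Suc (j * d))" for j
      proof -
        have "coeff U a i \<otimes>\<^bsub>A\<^esub> coeff U x (j - i) \<in> L (Suc (j * d))" if i: "i \<in> {..j}" for i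
        proof -
          have "i * d + Suc ((j - i) * d) = Suc (j * d)" using i by (simp add: distrib_right[symmetric])
          moreover have "coeff U x (j - i) \<in> L (Suc ((j - i) * d))" using x by blast
          ultimately show ?thesis using L_mult[OF RR_order[OF a, of i]] by metis
        qed
        then have "finsum A (\<lambda>i. coeff U a i \<otimes>\<^bsub>A\<^esub> coeff U x (j - i)) {..j} \<in> L (Suc (j * d))"
          by (intro ideal_finsum_closed[OF L_ideal]) auto
        then show ?thesis using a x RR_sub by simp
      qed
      then show ?thesis using RR_mult[OF a] x by simp
    qed
  qed auto
  moreover have "(\<lambda>a. monom U a 0) ` mm \<subseteq> ?N"
  proof (rule image_subsetI)
    fix a assume a: "a \<in> mm"
    then obtain g where g: "g \<in> Pol V" "lk g 0 = 0" "a = \<rho> g" by (auto simp: mm_eq)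
    have "1 \<le> mon_degree m" if "m \<in> Poly_Mapping.keys g" for m
      using that g(2) mon_degree_eq_0[of m] by (cases "mon_degree m") (auto simp: in_keys_iff)
    then have "g \<in> order_ge V (Suc 0)" using g(1) by (auto simp: order_ge_def)
    then have "a \<in> L (Suc 0)" using g(3) by blast
    moreover have "a \<in> carrier A" using g \<rho>_simps(1) by simp
    ultimately show "monom U a 0 \<in> ?N" using RR_monom0[of a] L_zero by auto
  qed
  ultimately have "JJ \<subseteq> ?N" by (rule ring.genideal_minimal[OF RR_ring])
  then show "p \<in> JJ \<Longrightarrow> coeff U p j \<in> L (Suc (j * d))" by blast
qed

text \<open>If \<open>E g\<close> lies in \<open>JJ\<close>, each of its coefficients is the residue of a form of degree \<open>j d\<close>
  and of a polynomial of larger order; the component of degree \<open>j d\<close> of their difference shows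
  that the form lies in \<open>P\<close>.\<close>
lemma \<Phi>_kernel:
  assumes g: "g \<in> Pol W"
  shows "\<Phi> g = \<zero>\<^bsub>F\<^esub> \<longleftrightarrow> g \<in> rel_ideal W P f"
proof -
  note IP = prime_ideal[OF P(1)]
  have comp: "psubst f (hcomp j g) = hcomp (j * d) (psubst f g)" for j
    by (rule psubst_hcomp[of W d f g j]) (use f(2) d g in auto)
  show ?thesis
  proof
    assume "\<Phi> g = \<zero>\<^bsub>F\<^esub>"
    then have J: "E g \<in> JJ" using \<pi>_zero_iff[OF E_RR[OF g]] by (simp add: \<Phi>_def)
    have "psubst f (hcomp j g) \<in> P" for j
    proof -
      obtain h where h: "h \<in> order_ge V (Suc (j * d))" "\<rho> (psubst f (hcomp j g)) = \<rho> h"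
        using JJ_order[OF J, of j] coeff_E[OF g, of j] by auto
      have "psubst f (hcomp j g) - h \<in> P"
        using residue_eq_iff[OF P(1) psubst_f_Pol[OF hcomp_Pol[OF g]] order_ge_Pol[OF h(1)]] h(2) by blast
      then have "hcomp (j * d) (psubst f (hcomp j g) - h) \<in> P" using P(2) by (auto simp: graded_def)
      moreover have "hcomp (j * d) (psubst f (hcomp j g) - h) = psubst f (hcomp j g)"
        using hcomp_add[of "j * d" "psubst f (hcomp j g) - h" h] hcomp_order_ge[OF h(1)]
        by (simp add: comp hcomp_hcomp)
      ultimately show ?thesis by simp
    qed
    moreover obtain J where "g \<in> PolL W J" using PolL_obtain[OF g] by blast
    then have "g = (\<Sum>j\<le>J. hcomp j g)" using hcomp_decomp by metis
    then have "psubst f g = (\<Sum>j\<le>J. psubst f (hcomp j g))" using psubst_sum[of f "\<lambda>j. hcomp j g" "{..J}"] by simp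
    ultimately have "psubst f g \<in> P" using ideal_sum[OF IP, of "{..J}"] by simp
    then show "g \<in> rel_ideal W P f" using g by (simp add: rel_ideal_def)
  next
    assume "g \<in> rel_ideal W P f"
    then have "psubst f g \<in> P" by (simp add: rel_ideal_def)
    then have z: "psubst f (hcomp j g) \<in> P" for j using P(2) by (simp add: comp graded_def)
    have "E g = E 0"
    proof
      fix j show "E g j = E 0 j"
        using residue_zero_iff[OF P(1) ideal_Pol[OF IP z[of j]]] z[of j]
        by (simp add: E_def psubst_zero \<rho>_simps(5))
    qed
    moreover have "E 0 = \<zero>\<^bsub>U\<^esub>" using E_cst[of 0] \<rho>_simps(5) monom_zero by simp
    moreover have "\<zero>\<^bsub>RR\<^esub> \<in> JJ"
      using additive_subgroup.zero_closed[OF ideal.axioms(1)[OF JJ_ideal]] .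
    ultimately have "E g \<in> JJ" by simp
    then show "\<Phi> g = \<zero>\<^bsub>F\<^esub>" using \<pi>_zero_iff[OF E_RR[OF g]] by (simp add: \<Phi>_def)
  qed
qed

theorem analytic_spread_eq:
  assumes W: "finite W"
  shows "analytic_spread A mm II = enat (vdim W (rel_ideal W P f))"
  unfolding analytic_spread_def
  by (rule krull_dim_hom_image[OF \<Phi>_hom \<Phi>_surj \<Phi>_kernel _ _ W])
    (use rel_ideal_prime[of W f V P] rel_ideal_graded[of W d f P] f d P in auto)

end

section \<open>The Noether normalization locus\<close>

lemma rel_ideal_cong:
  assumes "\<And>i. i \<in> W \<Longrightarrow> f i = g i"
  shows "rel_ideal W P f = rel_ideal W P g"
proof -
  have "psubst f h = psubst g h" if "h \<in> Pol W" for h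
    unfolding subst_def using that assms
    by (intro sum.cong refl arg_cong[where f = "(*) _"] mpow_cong) (auto simp: Pol_iff Mon_def)
  then show ?thesis by (auto simp: rel_ideal_def)
qed

lemma form_homogeneous:
  assumes "\<And>j. j \<in> {1..N} \<Longrightarrow> M j \<in> monomials V d"
  shows "form N M a \<in> PolL V d" "hcomp d (form N M a) = form N M a"
proof -
  have "Poly_Mapping.keys (form N M a) \<subseteq> M ` {1..N}"
  proof
    fix m assume "m \<in> Poly_Mapping.keys (form N M a)"
    then have "(\<Sum>j=1..N. lk (Poly_Mapping.single (M j) (a j)) m) \<noteq> 0"
      by (simp add: form_def in_keys_iff lookup_sum)
    then obtain j where "j \<in> {1..N}" "lk (Poly_Mapping.single (M j) (a j)) m \<noteq> 0"
      by (meson sum.neutral)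
    then show "m \<in> M ` {1..N}" by (cases "M j = m") (auto simp: lookup_single_not_eq)
  qed
  then have keys: "m \<in> monomials V d" if "m \<in> Poly_Mapping.keys (form N M a)" for m
    using that assms by blast
  then show "form N M a \<in> PolL V d" by (auto simp: PolL_def MonL_def Mon_def monomials_def)
  have "lk (form N M a) m = 0" if "mon_degree m \<noteq> d" for m
    using keys[of m] that by (auto simp: monomials_def in_keys_iff)
  then show "hcomp d (form N M a) = form N M a"
    by (intro poly_mapping_eqI) (simp add: lookup_hcomp)
qed

theorem theorem2p5:
  fixes P :: "(nat, 'k::field) mpol set"
    and n d N :: nat
    and M :: "nat \<Rightarrow> nat mon"
    and r :: enat
  assumes "infinite (UNIV :: 'k set)"
    and "primeideal P (poly_ring {0..n})"
    and "homogeneous_ideal {0..n} P"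
    and "krull_dim (poly_ring {0..n} Quot P) = r"
    and "d > 0"
    and "N = (n + d) choose d"
    and "bij_betw M {1..N} (monomials {0..n} d)"
  shows "noether_locus n P N M r \<noteq> {} \<and>
         zariski_open ({0..n} \<times> {1..N}) (noether_locus n P N M r)"
proof -
  let ?V = "{0..n}" and ?I = "{0..n} \<times> {1..N}"
  let ?f = "\<lambda>v i. form N M (\<lambda>j. v (i, j))"
  note P = assms(2)
  have gP: "graded P" by (rule graded_of_homogeneous_ideal[OF assms(3)])
  have r: "r = enat (vdim ?V P)" using krull_dim_quotient[OF P gP] assms(4) by simp
  have M: "M j \<in> monomials ?V d" if "j \<in> {1..N}" for j
    using assms(7) that by (auto simp: bij_betw_def)
  have fL: "?f v i \<in> PolL ?V d" and fh: "hcomp d (?f v i) = ?f v i" for v :: "nat \<times> nat \<Rightarrow> 'k" and i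
    using form_homogeneous[of N M ?V d, OF M] by blast+
  obtain J h where Jh: "\<And>f. \<forall>i\<in>?V. f i \<in> PolL ?V d \<Longrightarrow>
      vdim ?V P \<le> vdim ?V (rel_ideal ?V P f) \<longleftrightarrow> h \<le> growth P f ?V J"
    using vdim_rel_ideal_threshold[OF P, of ?V d] by (metis finite_atLeastAtMost)
  let ?ell = "\<lambda>v. analytic_spread (poly_ring ?V Quot P) (irrelevant_ideal ?V P)
      (genideal (poly_ring ?V Quot P) ((\<lambda>i. residue ?V P (?f v i)) ` ?V))"
  have ell: "?ell v = r \<longleftrightarrow> vdim ?V P \<le> vdim ?V (rel_ideal ?V P (?f v))" for v
  proof -
    have "fiber ?V P ?V (?f v) d"
    proof (rule fiber.intro)
      show "?f v i \<in> Pol ?V" for i by (rule PolL_Pol[OF fL])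
      show "hcomp d (?f v i) = ?f v i" for i by (rule fh)
    qed (fact P gP assms(5))+
    then have "?ell v = enat (vdim ?V (rel_ideal ?V P (?f v)))"
      using fiber.analytic_spread_eq[of ?V P ?V "?f v" d] by (simp add: image_image)
    moreover have "vdim ?V (rel_ideal ?V P (?f v)) \<le> vdim ?V P"
      by (rule vdim_rel_ideal_le[OF P _ _ fL]) auto
    ultimately show ?thesis using r by auto
  qed
  have ell_growth: "?ell v = r \<longleftrightarrow> h \<le> growth P (?f v) ?V J" for v
    unfolding ell using Jh[of "?f v"] fL by blast
  have locus: "noether_locus n P N M r = {proj_point ?I v | v. v \<in> proj_vectors ?I \<and> ?ell v = r}"
    by (simp add: noether_locus_def Let_def)
  have "zariski_open ?I (noether_locus n P N M r)"
    unfolding locus ell_growth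
    by (rule zariski_open_growth[OF prime_ideal[OF P]]) (simp, rule form_family_form)
  moreover have "noether_locus n P N M r \<noteq> {}"
  proof -
    \<comment> \<open>the tuple of the powers \<open>x\<^sub>i\<^sup>d\<close> of the variables\<close>
    define v where "v = (\<lambda>x\<in>?I. if M (snd x) = Poly_Mapping.single (fst x) d then 1 else 0 :: 'k)"
    have ex: "\<exists>j\<in>{1..N}. M j = Poly_Mapping.single i d" if "i \<in> ?V" for i
    proof -
      have "Poly_Mapping.single i d \<in> monomials ?V d" using that by (auto simp: monomials_def)
      then show ?thesis using assms(7) unfolding bij_betw_def by (metis imageE)
    qed
    have fv: "?f v i = X i ^ d" if i: "i \<in> ?V" for i
    proof -
      obtain j0 where j0: "j0 \<in> {1..N}" "M j0 = Poly_Mapping.single i d" using ex[OF i] by blast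
      have inj: "M j = Poly_Mapping.single i d \<longleftrightarrow> j = j0" if "j \<in> {1..N}" for j
        using assms(7) j0 that by (metis bij_betw_def inj_onD)
      have "?f v i = (\<Sum>j\<in>{1..N}. if j = j0 then X i ^ d else 0)"
        unfolding form_def
      proof (rule sum.cong[OF refl])
        fix j assume j: "j \<in> {1..N}"
        then have "v (i, j) = (if j = j0 then 1 else 0)" using inj[OF j] i by (simp add: v_def)
        then show "Poly_Mapping.single (M j) (v (i, j)) = (if j = j0 then X i ^ d else 0)"
          using j0(2) by (simp add: X_power)
      qed
      then show ?thesis using j0(1) by (simp add: sum.delta)
    qed
    have "rel_ideal ?V P (?f v) = rel_ideal ?V P (\<lambda>i. X i ^ d)"
      by (rule rel_ideal_cong) (rule fv)
    then have "?ell v = r"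
      unfolding ell using vdim_rel_ideal_powers[OF P _ assms(5)] by simp
    moreover have "v \<in> proj_vectors ?I"
    proof -
      obtain j where "j \<in> {1..N}" "M j = Poly_Mapping.single 0 d" using ex[of 0] by auto
      then have "(0, j) \<in> ?I" "v (0, j) \<noteq> 0" by (simp_all add: v_def)
      moreover have "v \<in> extensional ?I" by (simp add: v_def)
      ultimately show ?thesis unfolding proj_vectors_def by blast
    qed
    ultimately show ?thesis unfolding locus by blast
  qed
  ultimately show ?thesis by blast
qed

end
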